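(* Let $d\ge3$ be an odd integer and $\delta_d=2\cos\frac{\pi}{2d}$. There exist a constant $A>0$ and a threshold $p_0$ (possibly depending on $d$) such that for every prime $p\ge p_0$, every Dirichlet character $\chi\pmod p$ of order $d$, and every real $V$ with $1\le V\le\frac{\delta_d}{\pi}\bigl(\log\log p-2\log\log\log p\bigr)-7\sqrt{\log d}$, \[ \Phi_\chi(V)\ge\exp\!\left(-\tilde C_d^-\exp\!\left(\frac\pi{\delta_d}V\right)(1+\eta)\right)\quad\text{for some }\eta\text{ with }|\eta|\le Ae^{-\pi V/(2\delta_d)}, \] where $\tilde C_d^-=\frac{\log d}{2}\exp\!\left(\frac{7\pi}{\delta_d}\sqrt{\log d}-\gamma\right)$ and $\gamma$ is the Euler–Mascheroni constant.
   Context: Let $e_p(x)=e^{2\pi ix/p}$ and $\mathbb{F}_p$ the residues modulo $p$. For a Dirichlet character $\chi\pmod p$ ($\chi(0)=0$) put $f_\chi(z)=\sum_{n=0}^{p-1}\chi(n)z^n$ and \[ \Phi_\chi(V)=\frac1p\left|\left\{K\in\mathbb{F}_p:\ \max_{x\in[0,1]}\left|\frac{f_\chi(e_p(K+x))}{\sqrt p}\right|\ge V\right\}\right|. \] *)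

theory Defs
  imports
    "HOL-Analysis.Analysis"
    "HOL-Computational_Algebra.Primes"
begin

definition dirichlet_character :: "nat \<Rightarrow> (int \<Rightarrow> complex) \<Rightarrow> bool" where
  "dirichlet_character q chi \<longleftrightarrow>
     (\<forall>a b. chi (a * b) = chi a * chi b) \<and>
     (\<forall>a. chi (a + int q) = chi a) \<and>
     (\<forall>a. chi a \<noteq> 0 \<longleftrightarrow> coprime a (int q))"

definition principal_character :: "nat \<Rightarrow> int \<Rightarrow> complex" where
  "principal_character q a = (if coprime a (int q) then 1 else 0)"

text \<open>Order in the group of characters modulo \<open>q\<close>, whose product is pointwise.\<close>

definition character_order :: "nat \<Rightarrow> (int \<Rightarrow> complex) \<Rightarrow> nat" where
  "character_order q chi = (LEAST k. k > 0 \<and> (\<lambda>a. chi a ^ k) = principal_character q)"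

definition e_mod :: "nat \<Rightarrow> real \<Rightarrow> complex" where
  "e_mod p x = exp (2 * of_real pi * \<i> * of_real x / of_nat p)"

definition fekete :: "nat \<Rightarrow> (int \<Rightarrow> complex) \<Rightarrow> complex \<Rightarrow> complex" where
  "fekete p chi z = (\<Sum>n<p. chi (int n) * z ^ n)"

definition arc_max :: "nat \<Rightarrow> (int \<Rightarrow> complex) \<Rightarrow> nat \<Rightarrow> real" where
  "arc_max p chi K =
     (SUP x\<in>{0..1::real}. norm (fekete p chi (e_mod p (real K + x)) / of_real (sqrt (real p))))"

text \<open>The supremum above is a maximum.\<close>

lemma arc_max_attained:
  "\<exists>x\<in>{0..1::real}.
     arc_max p chi K = norm (fekete p chi (e_mod p (real K + x)) / of_real (sqrt (real p))) \<and>
     (\<forall>y\<in>{0..1::real}. norm (fekete p chi (e_mod p (real K + y)) / of_real (sqrt (real p))) \<le> arc_max p chi K)"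
proof -
  let ?g = "\<lambda>x::real. norm (fekete p chi (e_mod p (real K + x)) / of_real (sqrt (real p)))"
  have "continuous_on {0..1} ?g"
    unfolding fekete_def e_mod_def divide_inverse by (intro continuous_intros)
  then obtain x where x: "x \<in> {0..1}" "\<forall>y\<in>{0..1}. ?g y \<le> ?g x"
    using continuous_attains_sup[of "{0..1::real}" ?g] by auto
  have "arc_max p chi K = ?g x"
    unfolding arc_max_def by (rule cSup_eq_maximum) (use x in auto)
  with x show ?thesis by auto
qed

text \<open>Residues modulo \<open>p\<close> are represented by \<open>0, \<dots>, p - 1\<close>; replacing \<open>K\<close> by \<open>K + p\<close>
  does not change \<open>e_mod p (K + x)\<close>.\<close>

definition Phi :: "nat \<Rightarrow> (int \<Rightarrow> complex) \<Rightarrow> real \<Rightarrow> real" where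
  "Phi p chi V = real (card {K\<in>{0..<p}. arc_max p chi K \<ge> V}) / real p"

definition delta :: "nat \<Rightarrow> real" where
  "delta d = 2 * cos (pi / (2 * real d))"

definition C_minus :: "nat \<Rightarrow> real" where
  "C_minus d = ln (real d) / 2 * exp (7 * pi / delta d * sqrt (ln (real d)) - euler_mascheroni)"

end

theory Submission
  imports Defs "HOL-Number_Theory.Residue_Primitive_Roots" "HOL-Real_Asymp.Real_Asymp"
begin

text \<open>
  Expanding \<open>\<chi>\<close> by its Gauss sum shows that at the midpoint of the arc
  \<open>\<bar>f(e\<^sub>p(K + 1/2))\<bar> / \<surd>p = \<bar>\<Sum>\<^sub>i \<chi>(K - i) cot(\<pi>(i + 1/2)/p) / p\<bar>\<close>, with weights close to \<open>1 / (\<pi>(i + 1/2))\<close>.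
  If \<open>\<chi>(K - i)\<close> equals \<open>1\<close> for \<open>0 \<le> i < N\<close> and equals the \<open>d\<close>-th root of unity nearest to \<open>-1\<close>
  for \<open>-N \<le> i < 0\<close>, these terms contribute about \<open>(\<delta>\<^sub>d / \<pi>) ln N\<close>. A proportion of about \<open>d\<^bsup>-2N\<^esup>\<close>
  of the \<open>K\<close> has this pattern, and by a second moment estimate the remaining terms are bounded for most
  of them. The slack \<open>7 \<surd>(ln d)\<close> absorbs all constants, so \<open>\<eta> = 0\<close> works.

  Since \<open>d\<^bsup>2N\<^esup> = p\<^bsup>o(1)\<^esup>\<close>, any power saving, polynomial in the number of factors, for the complete sums of
  \<open>\<Prod>\<^sub>j \<chi>(x - j)\<^bsup>b\<^sub>j\<^esup>\<close> suffices for the independence of the values \<open>\<chi>(K - i)\<close>; it is provided by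
  Stepanov's method. Polynomials over the field with \<open>p\<close> elements are represented by integer
  polynomials modulo the prime element \<open>[:p:]\<close>, and the linear algebra is replaced by counting.
\<close>

hide_const (open) up_ring.coeff up_ring.monom Module.smult Coset.order

section \<open>Integer polynomials modulo a prime\<close>

text \<open>Only a factor \<open>d ^ (2 * N)\<close>, at most \<open>p powr (1/8)\<close>, and
  logarithms have to be beaten, so a saving of about \<open>p powr (1/4)\<close> can stand in for
  Weil's bound. Stepanov's method bounds level sets from above only; this is enough because the
  level sets almost exhaust the residues. Its crux is that the auxiliary polynomial is nonzero
  modulo \<open>p\<close>. The blocks multiplied by \<open>X ^ (p * k)\<close> can overlap, since
  \<open>f ^ (i * s)\<close> may have degree above \<open>p\<close>, so leading terms do not decide;
  the lowest nonzero block is examined at the origin instead, where \<open>f\<close> must not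
  vanish. The constants come from \<open>W = exp (pi / delta d * (V + 7 * sqrt (ln d)))\<close>: the
  claimed exponent is \<open>ln d / 2 * exp (- gamma) * W\<close>, whereas a pattern of
  \<open>2 * N\<close> values costs \<open>2 * N * ln d\<close>. Taking \<open>N\<close> about
  \<open>W / 16\<close> makes this \<open>W / 8 * ln d\<close>, and
  \<open>1 / 8 < exp (- gamma) / 2\<close>. The divisor 16 lowers the main term by at most
  \<open>(delta d / pi) * ln 16 < 2\<close>, the tail takes 4 and the error of the weights
  \<open>1 / 4\<close>; together these stay below the available 7.\<close>

lemma pderiv_const_dvd:
  fixes c :: int
  assumes "[:c:] dvd h"
  shows "[:c:] dvd pderiv h"
  using assms by (auto simp: const_poly_dvd_iff coeff_pderiv)

lemma prime_elem_const_int_poly: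
  assumes "prime p"
  shows "prime_elem [:int p:]"
  using assms by (simp add: prime_elem_const_poly_iff)

lemma const_dvd_poly:
  fixes c :: int
  assumes "[:c:] dvd h"
  shows "c dvd poly h a"
  using assms by (auto elim!: dvdE)

lemma not_const_dvd_linear_power:
  assumes "prime p"
  shows "\<not> [:int p:] dvd [:-a, 1:] ^ n"
proof
  assume *: "[:int p:] dvd [:-a, 1:] ^ n"
  have "int p dvd coeff ([:-a, 1:] ^ n) n"
    using * by (simp only: const_poly_dvd_iff)
  moreover have "coeff ([:-a, 1:] ^ n) n = 1"
    by (metis coeff_linear_power)
  ultimately show False
    using prime_gt_1_nat[OF assms] by simp
qed

lemma linear_factor_remainder:
  fixes h :: "int poly"
  obtains q where "h = [:-a, 1:] * q + [:poly h a:]" "degree q = degree h - 1"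
proof -
  let ?q = "synthetic_div h a"
  have "h = [:-a, 1:] * ?q + [:poly h a:]"
    using synthetic_div_correct'[of a h] by simp
  moreover have "degree ?q = degree h - 1"
    by (rule degree_synthetic_div)
  ultimately show ?thesis
    by (rule that)
qed

text \<open>This is the order of vanishing at \<open>j\<close> modulo \<open>p\<close>. Factors
  \<open>X - j\<close> are split off one at a time, and \<open>t\<close> collects the multiples of
  \<open>p\<close> discarded on the way. The bound on \<open>v\<close> later allows orders to be
  compared as integers, not only modulo \<open>p\<close>.\<close>

lemma mod_prime_valuation:
  assumes p: "prime p" and "\<not> [:int p:] dvd k"
  obtains v u t where "k = [:-j, 1:] ^ v * u + [:int p:] * t" "\<not> int p dvd poly u j" "v \<le> degree k"
proof -
  have "\<exists>v u t. k = [:-j, 1:] ^ v * u + [:int p:] * t \<and> \<not> int p dvd poly u j \<and> v \<le> degree k"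
    using assms(2)
  proof (induction "degree k" arbitrary: k rule: less_induct)
    case less
    show ?case
    proof (cases "int p dvd poly k j")
      case False
      then show ?thesis by (intro exI[of _ 0] exI[of _ k] exI[of _ 0]) auto
    next
      case True
      then obtain c where c: "poly k j = int p * c" by (auto elim: dvdE)
      obtain q where q: "k = [:-j, 1:] * q + [:poly k j:]" "degree q = degree k - 1"
        by (rule linear_factor_remainder)
      have pc: "[:poly k j:] = [:int p:] * [:c:]" by (simp add: c)
      have "degree k \<noteq> 0"
      proof
        assume "degree k = 0"
        then obtain e where "k = [:e:]" by (rule degree_eq_zeroE)
        with True less.prems show False by simp
      qed
      moreover have "\<not> [:int p:] dvd q"
      proof
        assume "[:int p:] dvd q"
        then have "[:int p:] dvd [:-j, 1:] * q + [:int p:] * [:c:]"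
          by (intro dvd_add dvd_mult dvd_triv_left)
        with q(1) pc less.prems show False by metis
      qed
      ultimately obtain v u t where vut: "q = [:-j, 1:] ^ v * u + [:int p:] * t"
          "\<not> int p dvd poly u j" "v \<le> degree q"
        using less.hyps[of q] q(2) by auto
      have "k = [:-j, 1:] ^ Suc v * u + [:int p:] * ([:-j, 1:] * t + [:c:])"
        by (subst q(1), subst vut(1), subst pc) (simp only: algebra_simps power_Suc)
      then show ?thesis
        using vut(2,3) q(2) \<open>degree k \<noteq> 0\<close>
        by (intro exI[of _ "Suc v"] exI[of _ u] exI[of _ "[:-j, 1:] * t + [:c:]"]) auto
    qed
  qed
  with that show ?thesis by blast
qed

text \<open>The extra factor \<open>X - j\<close> avoids the exponent \<open>v - 1\<close> and makes
  the residue \<open>v\<close> of the logarithmic derivative at \<open>j\<close> visible.\<close>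

lemma linear_times_pderiv_power:
  fixes u :: "int poly"
  shows "[:-j, 1:] * pderiv ([:-j, 1:] ^ v * u) = [:-j, 1:] ^ v * (of_nat v * u + [:-j, 1:] * pderiv u)"
proof (cases v)
  case 0
  then show ?thesis by simp
next
  case (Suc w)
  define L where "L = [:-j, 1::int:]"
  have "pderiv L = 1" by (simp add: L_def pderiv_pCons)
  then have "pderiv (L ^ Suc w) = of_nat (Suc w) * L ^ w"
    by (simp only: pderiv_power_Suc) (simp add: of_nat_poly)
  then have "L * pderiv (L ^ Suc w * u) = L ^ Suc w * (of_nat (Suc w) * u + L * pderiv u)"
    by (simp only: pderiv_mult) (simp add: algebra_simps)
  then show ?thesis by (simp only: Suc L_def)
qed

text \<open>Differentiation respects congruence modulo a constant, so \<open>k\<close> and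
  \<open>l\<close> may be exchanged for representatives with an explicit power of
  \<open>X - j\<close>.\<close>

lemma cong_mult_pderiv_sub:
  fixes c :: int
  assumes "[:c:] dvd k - k'" "[:c:] dvd l - l'"
  shows "[:c:] dvd (f * (l * pderiv k - k * pderiv l) + e * (k * l)) -
      (f * (l' * pderiv k' - k' * pderiv l') + e * (k' * l'))"
proof -
  have 1: "[:c:] dvd pderiv k - pderiv k'" "[:c:] dvd pderiv l - pderiv l'"
    using assms pderiv_const_dvd by (metis pderiv_diff)+
  have "(f * (l * pderiv k - k * pderiv l) + e * (k * l)) -
      (f * (l' * pderiv k' - k' * pderiv l') + e * (k' * l'))
    = f * (l - l') * pderiv k + f * l' * (pderiv k - pderiv k')
      - f * (k - k') * pderiv l - f * k' * (pderiv l - pderiv l')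
      + e * (k - k') * l + e * k' * (l - l')"
    by (simp add: algebra_simps)
  also have "[:c:] dvd \<dots>"
    using assms 1 by (intro dvd_add dvd_diff) (auto intro: dvd_mult dvd_mult2)
  finally show ?thesis .
qed

text \<open>In characteristic \<open>p\<close>, the Wronskian-like expression below vanishes only if
  \<open>k / l\<close> has logarithmic derivative \<open>- e f' / f\<close>; the conclusion compares residues at \<open>j\<close>.\<close>

lemma logarithmic_wronskian_residue:
  assumes p: "prime p" and k: "\<not> [:int p:] dvd k" and l: "\<not> [:int p:] dvd l"
    and f: "f = [:-j, 1:] ^ a * h" and h: "\<not> int p dvd poly h j"
    and dvd: "[:int p:] dvd f * (l * pderiv k - k * pderiv l) + smult e (pderiv f * k * l)"
  obtains v w where "int p dvd int v - int w + e * int a" "v \<le> degree k" "w \<le> degree l"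
proof -
  obtain v u t where v: "k = [:-j, 1:] ^ v * u + [:int p:] * t" "\<not> int p dvd poly u j" "v \<le> degree k"
    using mod_prime_valuation[OF p k] by blast
  obtain w u' t' where w: "l = [:-j, 1:] ^ w * u' + [:int p:] * t'" "\<not> int p dvd poly u' j" "w \<le> degree l"
    using mod_prime_valuation[OF p l] by blast
  define L where "L = [:-j, 1::int:]"
  define k' l' where "k' = L ^ v * u" and "l' = L ^ w * u'"
  let ?E = "\<lambda>k l. f * (l * pderiv k - k * pderiv l) + ([:e:] * pderiv f) * (k * l)"
  have "k - k' = [:int p:] * t" "l - l' = [:int p:] * t'"
    unfolding k'_def l'_def L_def by (subst v(1), simp) (subst w(1), simp)
  then have "[:int p:] dvd ?E k l - ?E k' l'"
    by (intro cong_mult_pderiv_sub) (metis dvd_triv_left)+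
  moreover have "[:int p:] dvd ?E k l"
    using dvd by (simp add: algebra_simps)
  ultimately have "[:int p:] dvd ?E k' l'"
    by (metis dvd_diff_right_iff)
  \<comment> \<open>One factor \<open>L\<close> clears the simple poles of the three logarithmic
    derivatives; all terms then share \<open>L ^ (a + v + w)\<close>, which is cancelled modulo
    \<open>p\<close>.\<close>
  then have "[:int p:] dvd L * ?E k' l'" by (rule dvd_mult)
  also have "L * ?E k' l' = f * (l' * (L * pderiv k') - k' * (L * pderiv l')) + ([:e:] * (L * pderiv f)) * (k' * l')"
    by (simp add: algebra_simps)
  also have "L * pderiv k' = L ^ v * (of_nat v * u + L * pderiv u)"
    unfolding L_def k'_def by (rule linear_times_pderiv_power)
  also have "L * pderiv l' = L ^ w * (of_nat w * u' + L * pderiv u')"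
    unfolding L_def l'_def by (rule linear_times_pderiv_power)
  also have "L * pderiv f = L ^ a * (of_nat a * h + L * pderiv h)"
    unfolding L_def f by (rule linear_times_pderiv_power)
  also have "f * (l' * (L ^ v * (of_nat v * u + L * pderiv u)) - k' * (L ^ w * (of_nat w * u' + L * pderiv u')))
      + ([:e:] * (L ^ a * (of_nat a * h + L * pderiv h))) * (k' * l')
    = L ^ (a + v + w) * (h * u' * (of_nat v * u + L * pderiv u) - h * u * (of_nat w * u' + L * pderiv u')
      + [:e:] * (of_nat a * h + L * pderiv h) * u * u')"
    unfolding f k'_def l'_def L_def[symmetric] power_add by (simp only: algebra_simps)
  finally have "[:int p:] dvd L ^ (a + v + w) * (h * u' * (of_nat v * u + L * pderiv u) - h * u * (of_nat w * u' + L * pderiv u')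
      + [:e:] * (of_nat a * h + L * pderiv h) * u * u')" .
  then have "[:int p:] dvd h * u' * (of_nat v * u + L * pderiv u) - h * u * (of_nat w * u' + L * pderiv u')
      + [:e:] * (of_nat a * h + L * pderiv h) * u * u'" (is "_ dvd ?B")
    using prime_elem_dvd_multD[OF prime_elem_const_int_poly[OF p]] not_const_dvd_linear_power[OF p]
    unfolding L_def by blast
  \<comment> \<open>At \<open>j\<close> every term containing \<open>L\<close> disappears. What
    remains is the total residue times values that are units modulo \<open>p\<close>.\<close>
  then have "int p dvd poly ?B j" by (rule const_dvd_poly)
  also have "poly ?B j = poly h j * (poly u j * (poly u' j * (int v - int w + e * int a)))"
    by (simp add: L_def algebra_simps)
  finally have "int p dvd int v - int w + e * int a"
    using v(2) w(2) h p by (simp add: prime_dvd_mult_iff)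
  with v(3) w(3) that show ?thesis by blast
qed

text \<open>Divisibility of \<open>h\<close> by \<open>X ^ n\<close> modulo \<open>c\<close>, that
  is, vanishing at the origin to order \<open>n\<close>. Each differentiation costs one
  order.\<close>

definition low_vanish :: "int \<Rightarrow> nat \<Rightarrow> int poly \<Rightarrow> bool" where
  "low_vanish c n h \<longleftrightarrow> (\<forall>i<n. c dvd coeff h i)"

lemma low_vanish_mult: "low_vanish c n h \<Longrightarrow> low_vanish c n (q * h)"
  unfolding low_vanish_def coeff_mult by (auto intro!: dvd_sum dvd_mult)

lemma low_vanish_diff: "low_vanish c n h \<Longrightarrow> low_vanish c n q \<Longrightarrow> low_vanish c n (h - q)"
  unfolding low_vanish_def by auto

lemma low_vanish_mono: "low_vanish c n h \<Longrightarrow> m \<le> n \<Longrightarrow> low_vanish c m h"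
  unfolding low_vanish_def by auto

lemma low_vanish_pderiv: "low_vanish c (Suc n) h \<Longrightarrow> low_vanish c n (pderiv h)"
  unfolding low_vanish_def coeff_pderiv by auto

text \<open>Modulo \<open>p\<close>, \<open>g\<close> is a unit among power series because its
  constant coefficient is one. The coefficients of \<open>k\<close> are recovered from the lowest
  upwards.\<close>

lemma low_vanish_cancel:
  assumes p: "prime p" and van: "low_vanish (int p) n (k * g)" and g: "\<not> int p dvd coeff g 0"
  shows "low_vanish (int p) n k"
proof -
  have "int p dvd coeff k i" if "i < n" for i
    using that
  proof (induction i rule: less_induct)
    case (less i)
    have "int p dvd coeff (k * g) i" using van less.prems unfolding low_vanish_def by blast
    also have "coeff (k * g) i = (\<Sum>l<i. coeff k l * coeff g (i - l)) + coeff k i * coeff g 0"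
      by (simp add: coeff_mult lessThan_Suc_atMost[symmetric])
    finally have "int p dvd coeff k i * coeff g 0"
      using less by (subst (asm) dvd_add_right_iff) (auto intro!: dvd_sum)
    with g p show ?case by (simp add: prime_dvd_mult_iff)
  qed
  then show ?thesis by (simp add: low_vanish_def)
qed

lemma low_vanish_degree: "low_vanish c n h \<Longrightarrow> degree h < n \<Longrightarrow> [:c:] dvd h"
  unfolding low_vanish_def const_poly_dvd_iff
  by (metis coeff_eq_0 dvd_0_right leI order_less_le_trans)

lemma degree_mult_bound: "degree a \<le> x \<Longrightarrow> degree b \<le> y \<Longrightarrow> degree (a * b) \<le> x + y"
  by (rule order_trans[OF degree_mult_le]) simp

lemma mult_pderiv_power:
  fixes f :: "int poly"
  shows "f * pderiv (f ^ e) = smult (int e) (pderiv f * f ^ e)"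
  by (cases e) (simp_all add: pderiv_power_Suc algebra_simps del: power_Suc, simp add: algebra_simps)

text \<open>Differentiating a relation and eliminating one of its terms gives a shorter relation, whose
  coefficients do not vanish by comparison of residues.\<close>

lemma powers_independent_mod_prime:
  fixes f :: "int poly" and k :: "nat \<Rightarrow> int poly"
  assumes p: "prime p" and ds: "d * s = p - 1" and f0: "\<not> int p dvd poly f 0"
    and root: "\<And>i i'. i < d \<Longrightarrow> i' < d \<Longrightarrow> i \<noteq> i' \<Longrightarrow>
      \<exists>j a h. f = [:-j, 1:] ^ a * h \<and> \<not> int p dvd poly h j \<and> \<not> int d dvd (int i - int i') * int a \<and> a \<le> degree f"
    and "I \<subseteq> {..<d}" "I \<noteq> {}"
    and "\<And>i. i \<in> I \<Longrightarrow> \<not> [:int p:] dvd k i" "\<And>i. i \<in> I \<Longrightarrow> degree (k i) \<le> B"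
    and "d * 2 ^ card I * (B + degree f) < p" and "2 ^ card I * (B + degree f) + card I < P"
  shows "\<not> low_vanish (int p) P (\<Sum>i\<in>I. k i * f ^ (i * s))"
  using assms(5-)
proof (induction "card I" arbitrary: I k B P)
  case 0
  then show ?case using finite_subset[of I "{..<d}"] by auto
next
  case (Suc c)
  have fin: "finite I" using Suc.prems(1) finite_subset by blast
  obtain i0 where i0: "i0 \<in> I" using Suc.prems(2) by blast
  have card_rem: "c = card (I - {i0})" using Suc.hyps(2) i0 fin by simp
  let ?n = "degree f"
  have BP: "B + ?n \<le> 2 ^ card I * (B + ?n)" by simp
  show ?case
  proof
    assume van: "low_vanish (int p) P (\<Sum>i\<in>I. k i * f ^ (i * s))"
    show False
    proof (cases "I = {i0}")
      case True
      have "\<not> int p dvd coeff (f ^ (i0 * s)) 0"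
        using f0 p by (simp add: poly_0_coeff_0[symmetric]) (meson prime_dvd_power prime_nat_int_transfer)
      moreover have "low_vanish (int p) P (k i0 * f ^ (i0 * s))" using van True by simp
      ultimately have "low_vanish (int p) P (k i0)" using low_vanish_cancel[OF p] by blast
      moreover have "degree (k i0) < P" using Suc.prems(4)[OF i0] Suc.prems(6) BP by linarith
      ultimately show False using low_vanish_degree Suc.prems(3)[OF i0] by blast
    next
      case False
      define q where "q i = f * pderiv (k i) + smult (int (i * s)) (pderiv f * k i)" for i
      define k' where "k' i = k i0 * q i - q i0 * k i" for i
      obtain P' where P': "P = Suc P'" using Suc.prems(6) by (cases P) auto
      let ?H = "\<Sum>i\<in>I. k i * f ^ (i * s)"
      have "f * pderiv (k i * f ^ (i * s)) = q i * f ^ (i * s)" for i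
      proof -
        have "f * pderiv (k i * f ^ (i * s)) = k i * (f * pderiv (f ^ (i * s))) + f * pderiv (k i) * f ^ (i * s)"
          by (simp add: pderiv_mult algebra_simps)
        also have "\<dots> = q i * f ^ (i * s)" unfolding mult_pderiv_power q_def by (simp add: algebra_simps)
        finally show ?thesis .
      qed
      then have "f * pderiv ?H = (\<Sum>i\<in>I. q i * f ^ (i * s))"
        by (simp add: higher_pderiv_sum[of 1, simplified] sum_distrib_left)
      \<comment> \<open>Elimination step: the coefficient at \<open>i0\<close> becomes
        \<open>k i0 * q i0 - q i0 * k i0 = 0\<close>. The derivative loses one order of vanishing,
        hence \<open>P'\<close>.\<close>
      then have "k i0 * (f * pderiv ?H) - q i0 * ?H = (\<Sum>i\<in>I. k' i * f ^ (i * s))"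
        by (simp add: sum_distrib_left k'_def sum_subtractf algebra_simps)
      also have "\<dots> = (\<Sum>i\<in>I - {i0}. k' i * f ^ (i * s))"
        using i0 fin by (subst sum.remove[of _ i0]) (auto simp: k'_def)
      finally have "low_vanish (int p) P' (\<Sum>i\<in>I - {i0}. k' i * f ^ (i * s))"
        using low_vanish_diff[of "int p" P' "k i0 * (f * pderiv ?H)" "q i0 * ?H"] van
          low_vanish_mult low_vanish_pderiv low_vanish_mono[of "int p" P ?H P'] P' by simp
      moreover have "\<not> low_vanish (int p) P' (\<Sum>i\<in>I - {i0}. k' i * f ^ (i * s))"
      \<comment> \<open>The degree bound plus \<open>degree f\<close> doubles exactly:
        \<open>(2 * B + n) + n = 2 * (B + n)\<close>. This is the origin of
        \<open>2 ^ card I\<close> in the size hypotheses.\<close>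
      proof (rule Suc.hyps(1)[OF card_rem, where B = "2 * B + ?n"])
        show "I - {i0} \<subseteq> {..<d}" "I - {i0} \<noteq> {}" using Suc.prems(1,2) False i0 by auto
      next
        fix i assume i: "i \<in> I - {i0}"
        then have id: "i < d" "i0 < d" "i \<noteq> i0" using Suc.prems(1) i0 by auto
        obtain j a h where j: "f = [:-j, 1:] ^ a * h" "\<not> int p dvd poly h j"
            "\<not> int d dvd (int i - int i0) * int a" "a \<le> degree f"
          using root[OF id] by blast
        have k'_eq: "k' i = f * (k i0 * pderiv (k i) - k i * pderiv (k i0))
            + smult ((int i - int i0) * int s) (pderiv f * k i * k i0)"
          by (simp add: k'_def q_def algebra_simps smult_diff_left)
        show "\<not> [:int p:] dvd k' i"
        proof
          assume dvd: "[:int p:] dvd k' i"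
          obtain v w where vw: "int p dvd int v - int w + ((int i - int i0) * int s) * int a"
              "v \<le> degree (k i)" "w \<le> degree (k i0)"
            using logarithmic_wronskian_residue[OF p _ _ j(1,2) dvd[unfolded k'_eq]] Suc.prems(3) i i0 by blast
          \<comment> \<open>Since \<open>d * s\<close> is \<open>-1\<close> modulo \<open>p\<close>,
            multiplying the residue relation by \<open>d\<close> removes the large exponent
            \<open>s\<close> and leaves \<open>d * (v - w)\<close> congruent to
            \<open>(i - i0) * a\<close>. The difference of the two is smaller than \<open>p\<close>,
            so they are equal integers, and \<open>d\<close> would divide
            \<open>(i - i0) * a\<close>.\<close>
          have pe: "int p = 1 + int d * int s"
            using ds prime_gt_1_nat[OF p] by (simp flip: of_nat_mult)
          have dvd2: "int d * (int v - int w + ((int i - int i0) * int s) * int a)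
            = int d * (int v - int w) - (int i - int i0) * int a + int p * ((int i - int i0) * int a)"
            unfolding pe by (simp add: algebra_simps)
          have "int p dvd int d * (int v - int w) - (int i - int i0) * int a"
            using vw(1) dvd2 by (metis dvd_add_left_iff dvd_mult dvd_triv_left)
          moreover have "\<bar>int d * (int v - int w) - (int i - int i0) * int a\<bar> < int p"
          proof -
            have v: "\<bar>int v - int w\<bar> \<le> int B"
              using vw(2,3) Suc.prems(4)[of i] Suc.prems(4)[of i0] i i0 by auto
            have "\<bar>int d * (int v - int w) - (int i - int i0) * int a\<bar>
              \<le> \<bar>int d * (int v - int w)\<bar> + \<bar>(int i - int i0) * int a\<bar>" by linarith
            also have "\<dots> \<le> int d * int B + int d * int ?n"
              unfolding abs_mult using v id j(4) by (intro add_mono mult_mono) auto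
            also have "\<dots> = int (d * (B + ?n))" by (simp add: algebra_simps)
            also have "d * (B + ?n) \<le> d * 2 ^ card I * (B + ?n)" by simp
            also have "\<dots> < p" by (rule Suc.prems(5))
            finally show ?thesis by simp
          qed
          ultimately have "int d * (int v - int w) - (int i - int i0) * int a = 0"
            by (metis dvd_imp_le_int abs_of_nat linorder_not_less)
          with j(3) show False by (metis dvd_triv_left eq_iff_diff_eq_0)
        qed
        have "degree (k i) \<le> B" "degree (k i0) \<le> B" using Suc.prems(4) i i0 by auto
        moreover have "degree (pderiv g) \<le> degree g" for g :: "int poly" by (simp add: degree_pderiv)
        ultimately have dd: "degree (pderiv (k i)) \<le> B" "degree (pderiv (k i0)) \<le> B" "degree (pderiv f) \<le> ?n"
          "degree (k i) \<le> B" "degree (k i0) \<le> B"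
          by (meson order_trans)+
        have d1: "degree (f * (k i0 * pderiv (k i) - k i * pderiv (k i0))) \<le> ?n + (B + B)"
          by (intro degree_mult_bound degree_diff_le dd order_refl)
        have d2: "degree (smult ((int i - int i0) * int s) (pderiv f * k i * k i0)) \<le> ?n + (B + B)"
          unfolding add.assoc[symmetric]
          by (intro order_trans[OF degree_smult_le] degree_mult_bound dd)
        show "degree (k' i) \<le> 2 * B + ?n"
          using degree_add_le[OF d1 d2] unfolding k'_eq by simp
      next
        have pw: "2 ^ card I = (2::nat) * 2 ^ card (I - {i0})"
          using card_rem Suc.hyps(2) by (metis power_Suc)
        have e: "2 ^ card (I - {i0}) * (2 * B + ?n + ?n) = 2 ^ card I * (B + ?n)"
          unfolding pw by (simp add: algebra_simps)
        show "d * 2 ^ card (I - {i0}) * (2 * B + ?n + ?n) < p"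
          using Suc.prems(5) e by (metis mult.assoc)
        show "2 ^ card (I - {i0}) * (2 * B + ?n + ?n) + card (I - {i0}) < P'"
          using Suc.prems(6) e card_rem Suc.hyps(2) P' by simp
      qed
      ultimately show False by blast
    qed
  qed
qed

section \<open>Stepanov's method\<close>

lemma fermat_theorem_int:
  assumes "prime p" "\<not> int p dvd a"
  shows "[a ^ (p - 1) = 1] (mod int p)"
proof -
  have "residues (int p)" using prime_gt_1_nat[OF assms(1)] by (simp add: residues_def)
  moreover have "coprime a (int p)"
    using assms by (metis coprime_commute prime_imp_coprime prime_nat_int_transfer)
  ultimately show ?thesis
    using residues.euler_theorem[of "int p" a] totient_prime[OF assms(1)] by simp
qed

text \<open>Formally, the \<open>l\<close>-th derivative of \<open>f ^ e * r\<close> is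
  \<open>f ^ (e - l)\<close> times this polynomial. The parameter \<open>e\<close> is an integer
  because \<open>e - l\<close> may be negative, as it is for \<open>e = 0\<close>.\<close>

primrec deriv_numerator :: "int poly \<Rightarrow> int \<Rightarrow> nat \<Rightarrow> int poly \<Rightarrow> int poly" where
  "deriv_numerator f e 0 r = r"
| "deriv_numerator f e (Suc l) r =
     f * pderiv (deriv_numerator f e l r) + smult (e - int l) (pderiv f * deriv_numerator f e l r)"

lemma deriv_numerator_diff:
  "deriv_numerator f e l (r - q) = deriv_numerator f e l r - deriv_numerator f e l q"
proof (induction l)
  case (Suc l)
  show ?case
    by (simp only: deriv_numerator.simps Suc.IH pderiv_diff right_diff_distrib smult_diff_right algebra_simps)
qed simp

lemma degree_deriv_numerator: "degree (deriv_numerator f e l r) \<le> degree r + l * degree f"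
proof (induction l)
  case (Suc l)
  have d: "degree (pderiv g) \<le> degree g" for g :: "int poly" by (simp add: degree_pderiv)
  have "degree (f * pderiv (deriv_numerator f e l r)) \<le> degree f + (degree r + l * degree f)"
    using Suc d by (intro degree_mult_bound) (auto intro: order_trans)
  moreover have "degree (smult (e - int l) (pderiv f * deriv_numerator f e l r)) \<le> degree f + (degree r + l * degree f)"
    using Suc d by (intro order_trans[OF degree_smult_le] degree_mult_bound) auto
  ultimately show ?case
    using degree_add_le by (simp add: algebra_simps del: degree_smult_eq)
qed simp

lemma higher_pderiv_power_mult:
  "f ^ l * (pderiv ^^ l) (f ^ e * r) = f ^ e * deriv_numerator f (int e) l r"
proof (induction l)
  case (Suc l)
  let ?h = "(pderiv ^^ l) (f ^ e * r)" and ?g = "deriv_numerator f (int e) l r"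
  have "f * pderiv (f ^ l * ?h) = f * f ^ l * pderiv ?h + (f * pderiv (f ^ l)) * ?h"
    by (simp add: pderiv_mult algebra_simps)
  also have "\<dots> = f ^ Suc l * (pderiv ^^ Suc l) (f ^ e * r) + smult (int l) (pderiv f * (f ^ l * ?h))"
    unfolding mult_pderiv_power by (simp add: algebra_simps)
  finally have "f ^ Suc l * (pderiv ^^ Suc l) (f ^ e * r) = f * pderiv (f ^ e * ?g) - smult (int l) (pderiv f * (f ^ e * ?g))"
    unfolding Suc.IH by simp
  also have "f * pderiv (f ^ e * ?g) = f ^ e * (f * pderiv ?g) + (f * pderiv (f ^ e)) * ?g"
    by (simp add: pderiv_mult algebra_simps)
  also have "\<dots> - smult (int l) (pderiv f * (f ^ e * ?g)) = f ^ e * deriv_numerator f (int e) (Suc l) r"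
    unfolding mult_pderiv_power by (simp add: algebra_simps smult_diff_left)
  finally show ?case .
qed simp

text \<open>The derivative of \<open>X ^ (p * k)\<close> carries the factor \<open>p\<close>, so
  this monomial behaves like a constant under differentiation modulo \<open>p\<close>.\<close>

lemma higher_pderiv_mult_frobenius:
  "[:int p:] dvd (pderiv ^^ l) (h * monom 1 (p * k)) - (pderiv ^^ l) h * monom 1 (p * k)"
proof (induction l)
  case (Suc l)
  let ?X = "monom (1::int) (p * k)"
  have "pderiv ?X = [:int p:] * monom (int k) (p * k - 1)"
    by (simp add: pderiv_monom smult_monom)
  then have "[:int p:] dvd (pderiv ^^ l) h * pderiv ?X"
    by (metis dvd_mult dvd_triv_left)
  moreover have "[:int p:] dvd pderiv ((pderiv ^^ l) (h * ?X) - (pderiv ^^ l) h * ?X)"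
    by (rule pderiv_const_dvd) (rule Suc.IH)
  ultimately have "[:int p:] dvd pderiv ((pderiv ^^ l) (h * ?X) - (pderiv ^^ l) h * ?X) + (pderiv ^^ l) h * pderiv ?X"
    by (intro dvd_add)
  also have "pderiv ((pderiv ^^ l) (h * ?X) - (pderiv ^^ l) h * ?X) + (pderiv ^^ l) h * pderiv ?X
    = (pderiv ^^ Suc l) (h * ?X) - (pderiv ^^ Suc l) h * ?X"
    by (simp add: pderiv_diff pderiv_mult algebra_simps)
  finally show ?case .
qed simp

section \<open>Zeros of high order modulo a prime\<close>

lemma poly_higher_pderiv_linear_power:
  fixes q :: "int poly"
  shows "poly ((pderiv ^^ n) ([:-a, 1:] ^ n * q)) a = fact n * poly q a"
proof (induction n arbitrary: q)
  case (Suc n)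
  define L where "L = [:-a, 1::int:]"
  have "pderiv L = 1" by (simp add: L_def pderiv_pCons)
  then have "pderiv (L ^ Suc n) = of_nat (Suc n) * L ^ n"
    by (simp only: pderiv_power_Suc) (simp add: of_nat_poly)
  then have "pderiv (L ^ Suc n * q) = L ^ n * (of_nat (Suc n) * q + L * pderiv q)"
    by (simp only: pderiv_mult) (simp add: algebra_simps)
  then have "(pderiv ^^ Suc n) (L ^ Suc n * q) = (pderiv ^^ n) (L ^ n * (of_nat (Suc n) * q + L * pderiv q))"
    by (simp only: funpow_Suc_right o_def)
  then have "poly ((pderiv ^^ Suc n) (L ^ Suc n * q)) a = fact n * poly (of_nat (Suc n) * q + L * pderiv q) a"
    using Suc.IH unfolding L_def by metis
  then show ?case by (simp add: L_def algebra_simps)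
qed simp

text \<open>Taylor expansion at \<open>a\<close>, one order at a time. The condition
  \<open>M \<le> p\<close> keeps the factorials that occur prime to \<open>p\<close>, so ordinary
  derivatives detect multiplicity.\<close>

lemma linear_power_dvd_mod_prime:
  assumes p: "prime p" and "M \<le> p" and van: "\<And>l. l < M \<Longrightarrow> int p dvd poly ((pderiv ^^ l) R) a"
  shows "\<exists>Q. [:int p:] dvd R - [:-a, 1:] ^ M * Q"
  using assms(2,3)
proof (induction M)
  case 0
  show ?case by (intro exI[of _ R]) simp
next
  case (Suc M)
  then obtain Q where "[:int p:] dvd R - [:-a, 1:] ^ M * Q" by auto
  then obtain t where t: "R - [:-a, 1:] ^ M * Q = [:int p:] * t" by (auto elim: dvdE)
  then have R: "R = [:-a, 1:] ^ M * Q + smult (int p) t" by (simp add: algebra_simps)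
  have "poly ((pderiv ^^ M) R) a = fact M * poly Q a + int p * poly ((pderiv ^^ M) t) a"
    by (subst R) (simp add: higher_pderiv_add higher_pderiv_smult poly_higher_pderiv_linear_power)
  moreover have "int p dvd poly ((pderiv ^^ M) R) a" using Suc.prems by simp
  ultimately have "int p dvd fact M * poly Q a" by (metis dvd_add_left_iff dvd_triv_left)
  moreover have "\<not> int p dvd fact M"
    using prime_dvd_fact_iff[OF p, of M] Suc.prems(1) by (metis int_dvd_int_iff not_less_eq_eq of_nat_fact)
  ultimately have "int p dvd poly Q a" using p by (simp add: prime_dvd_mult_iff)
  then obtain c where c: "poly Q a = int p * c" by (auto elim: dvdE)
  obtain q where q: "Q = [:-a, 1:] * q + [:poly Q a:]" using linear_factor_remainder .
  have pc: "[:poly Q a:] = [:int p:] * [:c:]" by (simp add: c)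
  have "R - [:-a, 1:] ^ Suc M * q = [:int p:] * t + [:-a, 1:] ^ M * (Q - [:-a, 1:] * q)"
    unfolding t[symmetric] by (simp only: algebra_simps power_Suc)
  also have "Q - [:-a, 1:] * q = [:int p:] * [:c:]"
    using q unfolding pc[symmetric] by (metis add_diff_cancel_left')
  finally have "R - [:-a, 1:] ^ Suc M * q = [:int p:] * (t + [:-a, 1:] ^ M * [:c:])"
    by (simp only: algebra_simps)
  then show ?case by (intro exI[of _ q]) (metis dvd_triv_left)
qed

lemma prod_linear_power_dvd_mod_prime:
  assumes p: "prime p" and "finite S"
    and incong: "\<And>a b. a \<in> S \<Longrightarrow> b \<in> S \<Longrightarrow> int p dvd b - a \<Longrightarrow> a = b"
    and fac: "\<And>a. a \<in> S \<Longrightarrow> \<exists>Q. [:int p:] dvd R - [:-a, 1:] ^ M * Q"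
  shows "\<exists>Q. [:int p:] dvd R - (\<Prod>a\<in>S. [:-a, 1:] ^ M) * Q"
  using assms(2-)
proof (induction S rule: finite_induct)
  case empty
  show ?case by (intro exI[of _ R]) simp
next
  case (insert b S)
  define G where "G = (\<Prod>a\<in>S. [:-a, 1::int:] ^ M)"
  define L where "L = [:-b, 1::int:]"
  have nG: "\<not> int p dvd poly G b"
  proof
    assume "int p dvd poly G b"
    then have "int p dvd (\<Prod>a\<in>S. (b - a) ^ M)"
      unfolding G_def by (simp add: poly_prod)
    then obtain a where a: "a \<in> S" "int p dvd (b - a) ^ M"
      using p insert.hyps(1) by (auto simp: prime_dvd_prod_iff)
    then have "int p dvd b - a" using p by (metis prime_dvd_power prime_nat_int_transfer)
    with insert a show False by auto
  qed
  have "\<exists>H. [:int p:] dvd R - G * H"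
    using insert unfolding G_def by auto
  moreover obtain Q where Q: "[:int p:] dvd R - L ^ M * Q"
    using insert.prems(2)[of b] unfolding L_def by auto
  \<comment> \<open>Factors \<open>X - b\<close> are moved next to \<open>G\<close> singly. After
    cancelling \<open>L ^ m\<close>, the product \<open>G * H\<close> is divisible by
    \<open>L\<close> modulo \<open>p\<close>; since \<open>G\<close> does not vanish at
    \<open>b\<close>, \<open>H\<close> must.\<close>
  have "\<exists>H. [:int p:] dvd R - G * L ^ m * H" if "m \<le> M" "\<exists>H. [:int p:] dvd R - G * H" for m
    using that
  proof (induction m)
    case (Suc m)
    then obtain H where H: "[:int p:] dvd R - G * L ^ m * H" by auto
    obtain r where r: "M = m + Suc r" using Suc.prems(1) less_imp_Suc_add[of m M] by auto
    have "[:int p:] dvd (R - L ^ M * Q) - (R - G * L ^ m * H)" using Q H by (rule dvd_diff)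
    also have "(R - L ^ M * Q) - (R - G * L ^ m * H) = L ^ m * (G * H - L ^ Suc r * Q)"
      unfolding r power_add by (simp add: algebra_simps)
    finally have "[:int p:] dvd G * H - L ^ Suc r * Q"
      using prime_elem_dvd_multD[OF prime_elem_const_int_poly[OF p]] not_const_dvd_linear_power[OF p]
      unfolding L_def by blast
    then have "int p dvd poly (G * H - L ^ Suc r * Q) b" by (rule const_dvd_poly)
    then have "int p dvd poly G b * poly H b" by (simp add: L_def)
    then have "int p dvd poly H b" using nG p by (simp add: prime_dvd_mult_iff)
    then obtain c where c: "poly H b = int p * c" by (auto elim: dvdE)
    obtain q where q: "H = [:-b, 1:] * q + [:poly H b:]" using linear_factor_remainder .
    have pc: "[:poly H b:] = [:int p:] * [:c:]" by (simp add: c)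
    have Hq: "H = L * q + [:int p:] * [:c:]" using q unfolding pc L_def .
    have "R - G * L ^ Suc m * q = (R - G * L ^ m * H) + [:int p:] * (G * L ^ m * [:c:])"
      by (subst Hq) (simp only: algebra_simps power_Suc)
    also have "[:int p:] dvd \<dots>" using H by (intro dvd_add dvd_triv_left)
    finally show ?case by blast
  qed simp
  from this[OF order_refl] calculation have "\<exists>H. [:int p:] dvd R - G * L ^ M * H" by blast
  then show ?case
    using insert.hyps unfolding G_def L_def by (simp add: mult.commute)
qed

text \<open>Let \<open>t\<close> be the degree of \<open>Q\<close> modulo \<open>p\<close>. As
  \<open>G\<close> is monic, the coefficient of \<open>G * Q\<close> in degree
  \<open>degree G + t\<close> survives modulo \<open>p\<close>, so \<open>R\<close> must reach that
  degree.\<close>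

lemma monic_mult_dvd_degree:
  assumes p: "prime p" and lead: "lead_coeff G = 1"
    and dvd: "[:int p:] dvd R - G * Q" and R: "\<not> [:int p:] dvd R"
  shows "degree G \<le> degree R"
proof (rule ccontr)
  assume less: "\<not> degree G \<le> degree R"
  define T where "T = {t. \<not> int p dvd coeff Q t}"
  have "finite T"
    by (rule finite_subset[of _ "{..degree Q}"]) (auto simp: T_def intro: le_degree)
  have "T \<noteq> {}"
  proof
    assume "T = {}"
    then have "[:int p:] dvd Q" by (auto simp: T_def const_poly_dvd_iff)
    then have "[:int p:] dvd (R - G * Q) + G * Q" using dvd by (intro dvd_add dvd_mult)
    with R show False by simp
  qed
  define t where "t = Max T"
  have t: "\<not> int p dvd coeff Q t" using Max_in[OF \<open>finite T\<close> \<open>T \<noteq> {}\<close>] unfolding t_def T_def by simp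
  have above: "int p dvd coeff Q i" if "i > t" for i
    using Max_ge[OF \<open>finite T\<close>, of i] that unfolding t_def T_def by fastforce
  let ?n = "degree G"
  have "coeff (G * Q) (?n + t) = coeff G ?n * coeff Q t + (\<Sum>i\<in>{..?n + t} - {?n}. coeff G i * coeff Q (?n + t - i))"
    by (subst coeff_mult, subst sum.remove[of _ ?n]) auto
  moreover have "int p dvd (\<Sum>i\<in>{..?n + t} - {?n}. coeff G i * coeff Q (?n + t - i))"
  proof (rule dvd_sum)
    fix i assume i: "i \<in> {..?n + t} - {?n}"
    show "int p dvd coeff G i * coeff Q (?n + t - i)"
    proof (cases "i < ?n")
      case True
      then show ?thesis by (intro dvd_mult above) simp
    next
      case False
      then have "coeff G i = 0" using i by (intro coeff_eq_0) auto
      then show ?thesis by simp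
    qed
  qed
  moreover have "coeff R (?n + t) = 0" using less by (intro coeff_eq_0) auto
  moreover have "int p dvd coeff (R - G * Q) (?n + t)" using dvd by (simp add: const_poly_dvd_iff)
  ultimately have "int p dvd coeff Q t" using lead
    by (simp add: dvd_diff_left_iff)
  with t show False by blast
qed

lemma card_high_order_zeros:
  assumes p: "prime p" and "M \<le> p" and R: "\<not> [:int p:] dvd R" and "finite S"
    and incong: "\<And>a b. a \<in> S \<Longrightarrow> b \<in> S \<Longrightarrow> int p dvd b - a \<Longrightarrow> a = b"
    and van: "\<And>a l. a \<in> S \<Longrightarrow> l < M \<Longrightarrow> int p dvd poly ((pderiv ^^ l) R) a"
  shows "card S * M \<le> degree R"
proof -
  let ?G = "\<Prod>a\<in>S. [:-a, 1::int:] ^ M"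
  obtain Q where Q: "[:int p:] dvd R - ?G * Q"
    using prod_linear_power_dvd_mod_prime[OF p \<open>finite S\<close> incong, where M = M and R = R]
      linear_power_dvd_mod_prime[OF p \<open>M \<le> p\<close>] van by blast
  have "lead_coeff ?G = 1"
    by (simp add: lead_coeff_prod lead_coeff_power)
  moreover have "degree ?G = card S * M"
    by (subst degree_prod_eq_sum_degree) (simp_all add: degree_power_eq)
  ultimately show ?thesis
    using monic_mult_dvd_degree[OF p _ Q R] by simp
qed

text \<open>There are \<open>p ^ card I\<close> vectors with entries in \<open>0..p-1\<close> but
  only \<open>p ^ card Q\<close> tuples of residues, so two vectors collide and their difference
  solves the system. Hence compatibility with subtraction is the only linearity required.\<close>

lemma pigeonhole_linear_mod:
  fixes \<phi> :: "('i \<Rightarrow> int) \<Rightarrow> 'q \<Rightarrow> int"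
  assumes "p > 1" "finite I" "finite Q" "card Q < card I"
    and lin: "\<And>u v q. \<phi> (\<lambda>i. u i - v i) q = \<phi> u q - \<phi> v q"
  shows "\<exists>u. (\<exists>i\<in>I. \<not> int p dvd u i) \<and> (\<forall>q\<in>Q. int p dvd \<phi> u q)"
proof -
  define A where "A = (PiE I (\<lambda>_. {0..<int p}))"
  define B where "B = (PiE Q (\<lambda>_. {0..<int p}))"
  define F where "F u = restrict (\<lambda>q. \<phi> u q mod int p) Q" for u
  have "card A = p ^ card I" "card B = p ^ card Q"
    using assms(2,3) by (simp_all add: A_def B_def card_PiE)
  then have "card B < card A" using assms(1,4) by simp
  moreover have "F ` A \<subseteq> B" using assms(1) by (auto simp: F_def B_def)
  moreover have "finite B" using assms(3) by (simp add: B_def finite_PiE)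
  ultimately have "\<not> inj_on F A" using card_inj_on_le[of F A B] by auto
  then obtain u v where uv: "u \<in> A" "v \<in> A" "F u = F v" "u \<noteq> v" unfolding inj_on_def by blast
  then obtain i where i: "i \<in> I" "u i \<noteq> v i" unfolding A_def using PiE_ext by metis
  have "u i \<in> {0..<int p}" "v i \<in> {0..<int p}" using uv i unfolding A_def by auto
  then have "\<bar>u i - v i\<bar> < int p" by auto
  then have "\<not> int p dvd u i - v i" using i(2) dvd_imp_le_int[of "u i - v i" "int p"] by auto
  moreover have "int p dvd \<phi> (\<lambda>i. u i - v i) q" if "q \<in> Q" for q
  proof -
    have "\<phi> u q mod int p = \<phi> v q mod int p" using fun_cong[OF uv(3), of q] that by (simp add: F_def)
    then show ?thesis by (simp add: lin mod_eq_dvd_iff)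
  qed
  ultimately show ?thesis using i(1) by (intro exI[of _ "\<lambda>i. u i - v i"]) auto
qed

text \<open>The auxiliary polynomial is
  \<open>\<Sum>i<d. \<Sum>k<K. r i k * f ^ (i * s) * X ^ (p * k)\<close>, where the \<open>r i k\<close> have degree less than \<open>D\<close>.\<close>

theorem stepanov_bound:
  fixes f :: "int poly" and c :: int
  assumes p: "prime p" and ds: "d * s = p - 1" and "d \<ge> 2" and f0: "\<not> int p dvd poly f 0"
    and root: "\<And>i i'. i < d \<Longrightarrow> i' < d \<Longrightarrow> i \<noteq> i' \<Longrightarrow>
      \<exists>j a h. f = [:-j, 1:] ^ a * h \<and> \<not> int p dvd poly h j \<and> \<not> int d dvd (int i - int i') * int a \<and> a \<le> degree f"
    and n: "n = degree f" and "K \<ge> 1" and D: "D = d * K\<^sup>2 * (d * n + 1) + 1"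
    and large: "d * 2 ^ d * (D + n) < p"
  shows "card {a\<in>{0..<int p}. \<not> int p dvd poly f a \<and> [poly f a ^ s = c] (mod int p)} * (d * K - 1) \<le> p * (K + n)"
proof -
  \<comment> \<open>\<open>M\<close> is the order of vanishing to be forced. There are
    \<open>d * K * D\<close> unknowns and \<open>M * (D + M * n + K)\<close> equations; taking
    \<open>M\<close> one below \<open>d * K\<close> leaves a surplus of \<open>D\<close> against
    \<open>M * (M * n + K)\<close>, and \<open>D\<close> is chosen to exceed the latter.\<close>
  define M where "M = d * K - 1"
  define Ix where "Ix = {..<d} \<times> {..<K} \<times> {..<D}"
  define Eq where "Eq = {..<M} \<times> {..<D + M * n + K}"
  define r where "r u i k = (\<Sum>t<D. monom (u (i, k, t)) t)" for u :: "nat \<times> nat \<times> nat \<Rightarrow> int" and i k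
  \<comment> \<open>This is what \<open>f ^ l\<close> times the \<open>l\<close>-th derivative of
    the auxiliary polynomial becomes on the level set, where \<open>f ^ s\<close> may be replaced by
    \<open>c\<close> and \<open>X ^ p\<close> by \<open>X\<close>. The degree falls to about
    \<open>D + M * n + K\<close>, so requiring it to vanish identically modulo \<open>p\<close>
    takes few conditions.\<close>
  define C where "C u l = (\<Sum>i<d. \<Sum>k<K. smult (c ^ i) (monom 1 k * deriv_numerator f (int (i * s)) l (r u i k)))" for u l
  have p1: "p > 1" using p by (rule prime_gt_1_nat)
  have Dpos: "D > 0" by (simp add: D)
  have r_diff: "r (\<lambda>x. u x - v x) i k = r u i k - r v i k" for u v i k
    unfolding r_def by (simp add: sum_subtractf flip: diff_monom)
  have coeff_r: "coeff (r u i k) t = (if t < D then u (i, k, t) else 0)" for u i k t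
    unfolding r_def coeff_sum by (auto simp: coeff_monom)
  have deg_r: "degree (r u i k) \<le> D - 1" for u i k
    using Dpos by (intro degree_le) (auto simp: coeff_r)
  have C_diff: "C (\<lambda>x. u x - v x) l = C u l - C v l" for u v l
    unfolding C_def r_diff deriv_numerator_diff
    by (simp only: right_diff_distrib smult_diff_right sum_subtractf)
  have deg_C: "degree (C u l) < D + M * n + K" if "l < M" for u l
  proof -
    have "degree (C u l) \<le> (K - 1) + ((D - 1) + M * n)"
      unfolding C_def
    proof (intro degree_sum_le order_trans[OF degree_smult_le] degree_mult_bound)
      fix i k assume "k \<in> {..<K}"
      then show "degree (monom (1::int) k) \<le> K - 1" by (auto simp: degree_monom_eq)
      have "degree (deriv_numerator f (int (i * s)) l (r u i k)) \<le> degree (r u i k) + l * n"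
        unfolding n by (rule degree_deriv_numerator)
      also have "\<dots> \<le> D - 1 + M * n"
        using deg_r that by (intro add_mono mult_right_mono) auto
      finally show "degree (deriv_numerator f (int (i * s)) l (r u i k)) \<le> D - 1 + M * n" .
    qed auto
    then show ?thesis using Dpos \<open>K \<ge> 1\<close> by linarith
  qed
  have dK: "d * K \<ge> 1" using \<open>d \<ge> 2\<close> \<open>K \<ge> 1\<close> by simp
  have "card Eq < card Ix"
  proof -
    have "M * (M * n + K) \<le> (d * K) * ((d * K) * n + K)"
      unfolding M_def by (intro mult_mono add_mono) auto
    also have "\<dots> < D" unfolding D by (simp add: power2_eq_square algebra_simps)
    finally have "M * (D + M * n + K) < (M + 1) * D" by (simp add: algebra_simps)
    also have "M + 1 = d * K" using dK by (simp add: M_def)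
    finally show ?thesis by (simp add: Eq_def Ix_def card_cartesian_product)
  qed
  then obtain u where u: "\<exists>x\<in>Ix. \<not> int p dvd u x" "\<forall>q\<in>Eq. int p dvd (case q of (l, t) \<Rightarrow> coeff (C u l) t)"
    using pigeonhole_linear_mod[where I = Ix and Q = Eq and \<phi> = "\<lambda>u (l, t). coeff (C u l) t" and p = p]
      p1 by (auto simp: C_diff Ix_def Eq_def split: prod.splits)
  have C0: "[:int p:] dvd C u l" if "l < M" for l
  proof (rule low_vanish_degree[OF _ deg_C[OF that]])
    show "low_vanish (int p) (D + M * n + K) (C u l)"
      using u(2) that by (auto simp: low_vanish_def Eq_def)
  qed
  define R where "R = (\<Sum>i<d. \<Sum>k<K. f ^ (i * s) * r u i k * monom 1 (p * k))"
  define S where "S = {a\<in>{0..<int p}. \<not> int p dvd poly f a \<and> [poly f a ^ s = c] (mod int p)}"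
  have ds_le: "(d - 1) * s \<le> p"
  proof -
    have "(d - 1) * s \<le> d * s" by simp
    then show ?thesis using ds by linarith
  qed
  have Dp: "D + n < p"
  proof -
    have "D + n \<le> d * 2 ^ d * (D + n)" using \<open>d \<ge> 2\<close> by simp
    then show ?thesis using large by linarith
  qed
  have deg_R: "degree R \<le> p * (K + n)"
  proof -
    have "degree R \<le> n * p + (D - 1) + p * (K - 1)"
      unfolding R_def
    proof (intro degree_sum_le degree_mult_bound deg_r)
      fix i k assume i: "i \<in> {..<d}" and k: "k \<in> {..<K}"
      have "degree (f ^ (i * s)) \<le> n * (i * s)" unfolding n by (rule degree_power_le)
      also have "i * s \<le> (d - 1) * s" using i by (intro mult_right_mono) auto
      also have "\<dots> \<le> p" by (rule ds_le)
      finally show "degree (f ^ (i * s)) \<le> n * p" by simp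
      show "degree (monom (1::int) (p * k)) \<le> p * (K - 1)"
        using k by (auto simp: degree_monom_eq)
    qed auto
    also have "D - 1 \<le> p" using Dp by linarith
    also have "n * p + p + p * (K - 1) = p * (K + n)"
      using \<open>K \<ge> 1\<close> by (cases K) (auto simp: algebra_simps)
    finally show ?thesis by simp
  qed
  have R_nz: "\<not> [:int p:] dvd R"
  proof
    assume dvd: "[:int p:] dvd R"
    define G where "G k = (\<Sum>i<d. r u i k * f ^ (i * s))" for k
    define bad where "bad k \<longleftrightarrow> k < K \<and> (\<exists>i<d. \<not> [:int p:] dvd r u i k)" for k
    have "\<exists>k. bad k"
    proof -
      obtain i k t where ikt: "i < d" "k < K" "t < D" "\<not> int p dvd u (i, k, t)"
        using u(1) by (auto simp: Ix_def)
      then have "\<not> int p dvd coeff (r u i k) t" by (simp add: coeff_r)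
      then have "\<not> [:int p:] dvd r u i k" by (auto simp: const_poly_dvd_iff)
      with ikt show ?thesis unfolding bad_def by blast
    qed
    \<comment> \<open>In degrees \<open>p * k\<close> to \<open>p * k + p - 1\<close>, lower blocks
      contribute nothing modulo \<open>p\<close> and higher blocks have not started. So
      \<open>G k\<close> would vanish at the origin to order \<open>p\<close>, contradicting
      \<open>powers_independent_mod_prime\<close>.\<close>
    define k where "k = (LEAST k. bad k)"
    have k: "bad k" unfolding k_def using \<open>\<exists>k. bad k\<close> by (rule LeastI_ex)
    have below: "[:int p:] dvd G k'" if "k' < k" for k'
    proof -
      have "\<not> bad k'" using that unfolding k_def by (rule not_less_Least)
      then have "[:int p:] dvd r u i k'" if "i < d" for i
        using \<open>k' < k\<close> k that unfolding bad_def by auto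
      then show ?thesis unfolding G_def by (intro dvd_sum dvd_mult2) auto
    qed
    have R_alt: "R = (\<Sum>k'<K. monom 1 (p * k') * G k')"
      unfolding R_def G_def sum_distrib_left by (subst sum.swap) (simp add: algebra_simps)
    have vanG: "low_vanish (int p) p (G k)"
      unfolding low_vanish_def
    proof (intro allI impI)
      fix t assume t: "t < p"
      have "coeff R (p * k + t) = (\<Sum>k'<K. coeff (monom 1 (p * k') * G k') (p * k + t))"
        unfolding R_alt by (simp add: coeff_sum)
      also have "\<dots> = coeff (monom 1 (p * k) * G k) (p * k + t)
          + (\<Sum>k'\<in>{..<K} - {k}. coeff (monom 1 (p * k') * G k') (p * k + t))"
        using k unfolding bad_def by (subst sum.remove[of _ k]) auto
      also have "coeff (monom 1 (p * k) * G k) (p * k + t) = coeff (G k) t"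
        by (simp add: coeff_monom_mult)
      finally have *: "coeff R (p * k + t) = coeff (G k) t
          + (\<Sum>k'\<in>{..<K} - {k}. coeff (monom 1 (p * k') * G k') (p * k + t))" .
      have "int p dvd (\<Sum>k'\<in>{..<K} - {k}. coeff (monom 1 (p * k') * G k') (p * k + t))"
      proof (rule dvd_sum)
        fix k' assume k': "k' \<in> {..<K} - {k}"
        show "int p dvd coeff (monom 1 (p * k') * G k') (p * k + t)"
        proof (cases "k' < k")
          case True
          then have "[:int p:] dvd monom 1 (p * k') * G k'" using below by (intro dvd_mult)
          then show ?thesis by (simp only: const_poly_dvd_iff)
        next
          case False
          then have "Suc k \<le> k'" using k' by auto
          then have "p * Suc k \<le> p * k'" by (intro mult_left_mono) auto
          then have "\<not> p * k' \<le> p * k + t" using t by simp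
          then show ?thesis by (simp add: coeff_monom_mult)
        qed
      qed
      moreover have "int p dvd coeff R (p * k + t)" using dvd by (simp only: const_poly_dvd_iff)
      ultimately show "int p dvd coeff (G k) t" unfolding * by (simp add: dvd_add_left_iff)
    qed
    \<comment> \<open>Indices whose coefficient vanishes modulo \<open>p\<close> are discarded,
      since the independence lemma wants all remaining coefficients nonzero.\<close>
    define I where "I = {i. i < d \<and> \<not> [:int p:] dvd r u i k}"
    have cI: "card I \<le> d" using card_mono[of "{..<d}" I] by (auto simp: I_def)
    have split: "G k - (\<Sum>i\<in>I. r u i k * f ^ (i * s)) = (\<Sum>i\<in>{..<d} - I. r u i k * f ^ (i * s))"
      unfolding G_def by (subst sum.subset_diff[of I]) (auto simp: I_def)
    have "[:int p:] dvd (\<Sum>i\<in>{..<d} - I. r u i k * f ^ (i * s))"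
      by (intro dvd_sum dvd_mult2) (auto simp: I_def)
    then have "low_vanish (int p) p (\<Sum>i\<in>{..<d} - I. r u i k * f ^ (i * s))"
      by (simp add: low_vanish_def const_poly_dvd_iff)
    then have "low_vanish (int p) p (\<Sum>i\<in>I. r u i k * f ^ (i * s))"
      using low_vanish_diff[OF vanG] split by (metis diff_diff_eq2 add_diff_cancel_left')
    moreover have "\<not> low_vanish (int p) p (\<Sum>i\<in>I. r u i k * f ^ (i * s))"
    proof (rule powers_independent_mod_prime[OF p ds f0 root, where B = "D - 1"])
      show "I \<subseteq> {..<d}" "I \<noteq> {}" using k by (auto simp: I_def bad_def)
      have "2 ^ card I * (D - 1 + n) \<le> 2 ^ d * (D + n)"
        using cI by (intro mult_mono power_increasing) auto
      then have 1: "d * 2 ^ card I * (D - 1 + n) \<le> d * 2 ^ d * (D + n)"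
        "2 ^ card I * (D - 1 + n) \<le> 2 ^ d * (D + n)" by simp_all
      show "d * 2 ^ card I * (D - 1 + degree f) < p" using le_less_trans[OF 1(1) large] unfolding n .
      have "d \<le> 2 ^ d * 1" using less_exp[of d] by simp
      also have "\<dots> \<le> 2 ^ d * (D + n)" using Dpos by (intro mult_left_mono) auto
      finally have "2 ^ d * (D + n) + d \<le> 2 * (2 ^ d * (D + n))" by linarith
      also have "\<dots> \<le> d * (2 ^ d * (D + n))" using \<open>d \<ge> 2\<close> by (intro mult_right_mono) auto
      also have "\<dots> < p" using large by (simp add: mult.assoc)
      finally show "2 ^ card I * (D - 1 + degree f) + card I < p"
        using 1(2) cI unfolding n[symmetric] by linarith
    qed (insert deg_r, auto simp: I_def)
    ultimately show False by blast
  qed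
  have van: "int p dvd poly ((pderiv ^^ l) R) a" if a: "a \<in> S" and l: "l < M" for a l
  proof -
    let ?N = "\<lambda>i k. deriv_numerator f (int (i * s)) l (r u i k)"
    have "[:int p:] dvd (\<Sum>i<d. \<Sum>k<K. f ^ l * ((pderiv ^^ l) (f ^ (i * s) * r u i k * monom 1 (p * k))
        - (pderiv ^^ l) (f ^ (i * s) * r u i k) * monom 1 (p * k)))"
      by (intro dvd_sum dvd_mult higher_pderiv_mult_frobenius)
    also have "\<dots> = f ^ l * (pderiv ^^ l) R - (\<Sum>i<d. \<Sum>k<K. f ^ (i * s) * ?N i k * monom 1 (p * k))"
      unfolding R_def higher_pderiv_sum sum_distrib_left right_diff_distrib mult.assoc[symmetric]
        higher_pderiv_power_mult sum_subtractf ..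
    finally have "int p dvd poly (f ^ l * (pderiv ^^ l) R - (\<Sum>i<d. \<Sum>k<K. f ^ (i * s) * ?N i k * monom 1 (p * k))) a"
      by (rule const_dvd_poly)
    then have 1: "[poly f a ^ l * poly ((pderiv ^^ l) R) a
        = (\<Sum>i<d. \<Sum>k<K. (poly f a ^ s) ^ i * poly (?N i k) a * (a ^ p) ^ k)] (mod int p)"
      by (simp add: cong_iff_dvd_diff poly_sum poly_monom power_mult mult.commute[of _ s])
    have fermat: "[a ^ p = a] (mod int p)"
    proof (cases "int p dvd a")
      case True
      then have "int p dvd a ^ p" using p1 by (intro dvd_trans[OF _ dvd_power]) auto
      with True show ?thesis by (simp add: cong_iff_dvd_diff)
    next
      case False
      have "[a ^ (p - 1) * a = 1 * a] (mod int p)"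
        using False p by (intro cong_mult fermat_theorem_int cong_refl)
      then show ?thesis using p1 by (simp flip: power_Suc2)
    qed
    have "[(\<Sum>i<d. \<Sum>k<K. (poly f a ^ s) ^ i * poly (?N i k) a * (a ^ p) ^ k)
      = (\<Sum>i<d. \<Sum>k<K. c ^ i * poly (?N i k) a * a ^ k)] (mod int p)"
      using a fermat by (intro cong_sum cong_mult cong_pow cong_refl) (auto simp: S_def)
    also have "(\<Sum>i<d. \<Sum>k<K. c ^ i * poly (?N i k) a * a ^ k) = poly (C u l) a"
      unfolding C_def by (simp add: poly_sum poly_monom algebra_simps)
    finally have "[poly f a ^ l * poly ((pderiv ^^ l) R) a = poly (C u l) a] (mod int p)"
      using 1 cong_trans by blast
    moreover have "int p dvd poly (C u l) a" using C0[OF l] by (rule const_dvd_poly)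
    ultimately have "int p dvd poly f a ^ l * poly ((pderiv ^^ l) R) a"
      using cong_dvd_iff by blast
    moreover have "\<not> int p dvd poly f a ^ l"
      using a p prime_dvd_power[of "int p" "poly f a" l] by (auto simp: S_def)
    ultimately show ?thesis using p by (simp add: prime_dvd_mult_iff)
  qed
  have "M \<le> p"
  proof -
    have "K \<le> K\<^sup>2" by (simp add: power2_eq_square)
    then have "d * K \<le> d * K\<^sup>2" by simp
    also have "\<dots> \<le> d * K\<^sup>2 * (d * n + 1)" by simp
    finally have "d * K \<le> d * K\<^sup>2 * (d * n + 1)" .
    then show ?thesis using Dp unfolding M_def D by linarith
  qed
  moreover have "a = b" if "a \<in> S" "b \<in> S" "int p dvd b - a" for a b
  proof (rule ccontr)
    assume "a \<noteq> b"
    then have "int p \<le> \<bar>b - a\<bar>" using that(3) dvd_imp_le_int[of "b - a" "int p"] by simp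
    then show False using that(1,2) by (auto simp: S_def)
  qed
  moreover have "finite S" by (rule finite_subset[of _ "{0..<int p}"]) (auto simp: S_def)
  ultimately have "card S * M \<le> degree R"
    using card_high_order_zeros[OF p _ R_nz, of M S] van by blast
  also note deg_R
  finally show ?thesis unfolding S_def M_def .
qed

section \<open>Character sums\<close>

lemma dirichlet_character_cong:
  assumes chi: "dirichlet_character q chi" and "[a = b] (mod int q)"
  shows "chi a = chi b"
proof -
  have per: "chi (a + int q) = chi a" for a using chi by (simp add: dirichlet_character_def)
  have nat: "chi (a + int q * int n) = chi a" for a n
  proof (induction n)
    case (Suc n)
    have "chi (a + int q * int (Suc n)) = chi ((a + int q * int n) + int q)" by (simp add: algebra_simps)
    then show ?case using per Suc by simp
  qed simp
  obtain k where k: "b = a + int q * k"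
    using assms(2) by (metis cong_iff_lin)
  show ?thesis
  proof (cases "k \<ge> 0")
    case True
    then show ?thesis using nat[of a "nat k"] k by simp
  next
    case False
    then have "a = b + int q * int (nat (-k))" using k by simp
    then show ?thesis using nat[of b "nat (-k)"] by simp
  qed
qed

lemma dirichlet_character_mult:
  "dirichlet_character q chi \<Longrightarrow> chi (a * b) = chi a * chi b"
  by (simp add: dirichlet_character_def)

lemma dirichlet_character_1:
  assumes chi: "dirichlet_character q chi"
  shows "chi 1 = 1"
proof -
  have "chi 1 \<noteq> 0" using chi by (simp add: dirichlet_character_def)
  moreover have "chi 1 * chi 1 = chi 1" using dirichlet_character_mult[OF chi, of 1 1] by simp
  ultimately show ?thesis by simp
qed

lemma dirichlet_character_power:
  assumes chi: "dirichlet_character q chi"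
  shows "chi (a ^ n) = chi a ^ n"
  by (induction n) (simp_all add: dirichlet_character_1[OF chi] dirichlet_character_mult[OF chi])

lemma dirichlet_character_prod:
  assumes chi: "dirichlet_character q chi"
  shows "chi (\<Prod>j\<in>J. h j) = (\<Prod>j\<in>J. chi (h j))"
  by (induction J rule: infinite_finite_induct)
     (simp_all add: dirichlet_character_1[OF chi] dirichlet_character_mult[OF chi])

lemma dirichlet_character_eq_0_iff:
  assumes chi: "dirichlet_character p chi" and p: "prime p"
  shows "chi a = 0 \<longleftrightarrow> int p dvd a"
proof -
  have "coprime a (int p) \<longleftrightarrow> \<not> int p dvd a"
    using p by (metis coprime_commute prime_imp_coprime prime_nat_int_transfer coprime_absorb_left not_prime_unit)
  then show ?thesis using chi by (auto simp: dirichlet_character_def)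
qed

lemma dirichlet_character_fermat:
  assumes chi: "dirichlet_character p chi" and p: "prime p" and "\<not> int p dvd a"
  shows "chi a ^ (p - 1) = 1"
  using dirichlet_character_cong[OF chi fermat_theorem_int[OF p assms(3)]]
  by (simp add: dirichlet_character_power[OF chi] dirichlet_character_1[OF chi])

lemma norm_dirichlet_character:
  assumes chi: "dirichlet_character p chi" and p: "prime p" and "\<not> int p dvd a"
  shows "norm (chi a) = 1"
  using power_eq_1_iff[OF dirichlet_character_fermat[OF assms]] prime_gt_1_nat[OF p] by simp

text \<open>The order expressed through values at units, with minimality given by explicit
  witnesses; in this form it passes easily to powers of \<open>chi\<close>.\<close>

definition exact_order :: "nat \<Rightarrow> (int \<Rightarrow> complex) \<Rightarrow> nat \<Rightarrow> bool" where
  "exact_order p chi d \<longleftrightarrow> d > 0 \<and> (\<forall>a. \<not> int p dvd a \<longrightarrow> chi a ^ d = 1) \<and>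
     (\<forall>k. 0 < k \<and> k < d \<longrightarrow> (\<exists>a. \<not> int p dvd a \<and> chi a ^ k \<noteq> 1))"

lemma character_order_imp_exact_order:
  assumes chi: "dirichlet_character p chi" and p: "prime p"
  shows "exact_order p chi (character_order p chi)"
proof -
  let ?P = "\<lambda>k. k > 0 \<and> (\<lambda>a. chi a ^ k) = principal_character p"
  have cop: "coprime a (int p) \<longleftrightarrow> \<not> int p dvd a" for a
    using dirichlet_character_eq_0_iff[OF chi p] chi by (auto simp: dirichlet_character_def)
  have iff: "(\<lambda>a. chi a ^ k) = principal_character p \<longleftrightarrow> (\<forall>a. \<not> int p dvd a \<longrightarrow> chi a ^ k = 1)" if "k > 0" for k
    using that dirichlet_character_eq_0_iff[OF chi p]
    by (auto simp: fun_eq_iff principal_character_def cop)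
  have "?P (p - 1)"
    using prime_gt_1_nat[OF p] dirichlet_character_fermat[OF chi p] by (simp add: iff)
  then have "?P (LEAST k. ?P k)" by (rule LeastI)
  then have "?P (character_order p chi)" unfolding character_order_def .
  moreover have "\<not> ?P k" if "k < character_order p chi" for k
    using that unfolding character_order_def by (rule not_less_Least)
  ultimately show ?thesis unfolding exact_order_def using iff by blast
qed

text \<open>In terms of a primitive root, \<open>chi a\<close> and \<open>a ^ s\<close> modulo
  \<open>p\<close> both depend on the discrete logarithm of \<open>a\<close> modulo
  \<open>d\<close>. Thus a condition on the character becomes a polynomial congruence, accessible to
  Stepanov's method.\<close>

lemma exact_order_level_sets:
  assumes chi: "dirichlet_character p chi" and p: "prime p" and ord: "exact_order p chi d"
  obtains s where "d * s = p - 1"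
    "\<And>a b. \<not> int p dvd a \<Longrightarrow> \<not> int p dvd b \<Longrightarrow> chi a = chi b \<Longrightarrow> [a ^ s = b ^ s] (mod int p)"
proof -
  have d0: "d > 0" using ord by (simp add: exact_order_def)
  obtain g where g: "residue_primroot p g"
    using prime_primitive_root_exists[of p] p prime_gt_1_nat[OF p] by auto
  have gen: "\<exists>i. [a = int g ^ i] (mod int p)" if "\<not> int p dvd a" for a
  proof -
    have p0: "int p > 0" using prime_gt_0_nat[OF p] by simp
    define r where "r = nat (a mod int p)"
    have r: "int r = a mod int p" using p0 by (simp add: r_def)
    have "\<not> p dvd r" using that r by (metis int_dvd_int_iff dvd_mod_iff dvd_refl)
    then have "coprime r p" using p by (metis coprime_commute prime_imp_coprime)
    moreover have "r < p" using r p0 by (metis of_nat_less_iff pos_mod_bound)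
    moreover have "r > 0" using \<open>\<not> p dvd r\<close> by (cases r) auto
    ultimately have "r \<in> totatives p" by (simp add: in_totatives_iff)
    then obtain i where "r = g ^ i mod p"
      using residue_primroot_is_generator[OF prime_gt_1_nat[OF p] g] by (auto simp: bij_betw_def)
    then have "a mod int p = int g ^ i mod int p" using r by (metis of_nat_mod of_nat_power)
    then show ?thesis by (auto simp: cong_def)
  qed
  have gp: "\<not> int p dvd int g"
    using g p unfolding residue_primroot_def
    by (metis coprime_absorb_left int_dvd_int_iff not_prime_unit)
  let ?z = "chi (int g)"
  have chi_gen: "chi a = ?z ^ i" if "[a = int g ^ i] (mod int p)" for a i
    using dirichlet_character_cong[OF chi that] by (simp add: dirichlet_character_power[OF chi])
  have zd: "?z ^ d = 1" using ord gp by (simp add: exact_order_def)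
  have zn: "d dvd n" if "?z ^ n = 1" for n
  proof (rule ccontr)
    assume "\<not> d dvd n"
    then have k: "0 < n mod d" "n mod d < d" using d0 by (auto simp: dvd_eq_mod_eq_0)
    have "?z ^ n = ?z ^ (n mod d)"
      by (metis div_mult_mod_eq mult.commute mult_1 power_add power_mult power_one zd)
    then have z1: "?z ^ (n mod d) = 1" using that by simp
    obtain a where a: "\<not> int p dvd a" "chi a ^ (n mod d) \<noteq> 1"
      using ord k unfolding exact_order_def by blast
    obtain i where "[a = int g ^ i] (mod int p)" using gen a(1) by blast
    then have "chi a ^ (n mod d) = (?z ^ (n mod d)) ^ i" using chi_gen by (metis mult.commute power_mult)
    with z1 a(2) show False by simp
  qed
  have "d dvd p - 1" using zn dirichlet_character_fermat[OF chi p gp] by blast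
  then obtain s where s: "p - 1 = d * s" by (auto elim: dvdE)
  have main: "[(int g ^ i) ^ s = (int g ^ j) ^ s] (mod int p)" if ij: "i \<le> j" "?z ^ i = ?z ^ j" for i j
  proof -
    obtain k where k: "j = i + k" using ij(1) le_Suc_ex by blast
    have "?z ^ i \<noteq> 0" using dirichlet_character_eq_0_iff[OF chi p] gp by simp
    moreover have "?z ^ i * ?z ^ k = ?z ^ i * 1" using ij(2) k by (metis mult_1_right power_add)
    ultimately have "?z ^ k = 1" using mult_left_cancel by blast
    then obtain e where e: "k = d * e" using zn by (auto elim: dvdE)
    have "[(int g ^ (p - 1)) ^ e = 1 ^ e] (mod int p)"
      by (intro cong_pow fermat_theorem_int p gp)
    then have "[(int g ^ i) ^ s * (int g ^ (p - 1)) ^ e = (int g ^ i) ^ s * 1] (mod int p)"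
      by (intro cong_mult cong_refl) simp
    also have "(int g ^ i) ^ s * (int g ^ (p - 1)) ^ e = (int g ^ j) ^ s"
      unfolding s k e by (simp add: power_mult[symmetric] power_add[symmetric] algebra_simps)
    finally show ?thesis by (simp add: cong_sym)
  qed
  show ?thesis
  proof (rule that)
    show "d * s = p - 1" using s by simp
    fix a b assume ab: "\<not> int p dvd a" "\<not> int p dvd b" "chi a = chi b"
    obtain i j where ij: "[a = int g ^ i] (mod int p)" "[b = int g ^ j] (mod int p)"
      using gen ab by metis
    have z: "?z ^ i = ?z ^ j" using chi_gen[OF ij(1)] chi_gen[OF ij(2)] ab(3) by simp
    have "[(int g ^ i) ^ s = (int g ^ j) ^ s] (mod int p)"
    proof (cases "i \<le> j")
      case True
      then show ?thesis using z by (rule main)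
    next
      case False
      then show ?thesis using main[of j i] z by (intro cong_sym[OF main]) auto
    qed
    then show "[a ^ s = b ^ s] (mod int p)"
      using cong_pow[OF ij(1), of s] cong_pow[OF ij(2), of s] by (metis cong_trans cong_sym)
  qed
qed

text \<open>The \<open>d\<close>-th roots of unity sum to 0, so \<open>T\<close> may be subtracted
  from every count. The resulting coefficients have one sign and known total, and the triangle
  inequality turns upper bounds on level sets into a bound for the sum.\<close>

lemma sum_roots_of_unity_levels:
  fixes w :: "'a \<Rightarrow> complex"
  assumes "finite X" "d \<ge> 2" and w: "\<And>x. x \<in> X \<Longrightarrow> w x = 0 \<or> w x ^ d = 1"
    and zeros: "card {x\<in>X. w x = 0} \<le> m"
    and level: "\<And>z. z ^ d = 1 \<Longrightarrow> real (card {x\<in>X. w x = z}) \<le> T"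
  shows "norm (\<Sum>x\<in>X. w x) \<le> real d * T - (real (card X) - real m)"
proof -
  define Z where "Z = {z::complex. z ^ d = 1}"
  have Z: "finite Z" "card Z = d"
    unfolding Z_def using assms(2) finite_nth_roots[of d 1] card_nth_roots[of 1 d] by auto
  have Z0: "0 \<notin> Z" using assms(2) by (auto simp: Z_def power_0_left)
  have sumZ: "(\<Sum>z\<in>Z. z) = 0"
    unfolding Z_def using sum_nth_roots[of d 1] assms(2) by simp
  let ?N = "\<lambda>z. card {x\<in>X. w x = z}"
  have "(\<Sum>x\<in>X. w x) = (\<Sum>z\<in>insert 0 Z. \<Sum>x\<in>{x\<in>X. w x = z}. w x)"
    using Z assms(1) w by (intro sum.group[symmetric]) (auto simp: Z_def)
  also have "\<dots> = (\<Sum>z\<in>insert 0 Z. of_nat (?N z) * z)"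
    by (intro sum.cong refl) simp
  also have "\<dots> = (\<Sum>z\<in>Z. of_nat (?N z) * z)" using Z Z0 by simp
  also have "\<dots> = - (\<Sum>z\<in>Z. of_real (T - real (?N z)) * z)"
    using sumZ by (simp add: algebra_simps sum_subtractf flip: sum_distrib_right)
  finally have "norm (\<Sum>x\<in>X. w x) = norm (\<Sum>z\<in>Z. of_real (T - real (?N z)) * z)" by simp
  also have "\<dots> \<le> (\<Sum>z\<in>Z. norm (of_real (T - real (?N z)) * z))" by (rule norm_sum)
  also have "\<dots> = (\<Sum>z\<in>Z. T - real (?N z))"
  proof (intro sum.cong refl)
    fix z assume z: "z \<in> Z"
    then have "norm z = 1" using assms(2) power_eq_1_iff[of z d] by (auto simp: Z_def)
    moreover have "T - real (?N z) \<ge> 0" using level z by (simp add: Z_def)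
    ultimately show "norm (of_real (T - real (?N z)) * z) = T - real (?N z)"
      by (simp only: norm_mult norm_of_real abs_of_nonneg mult_1_right)
  qed
  also have "\<dots> = real d * T - real (\<Sum>z\<in>Z. ?N z)" using Z by (simp add: sum_subtractf)
  also have "real (card X) \<le> real (\<Sum>z\<in>Z. ?N z) + real m"
  proof -
    have "w ` X \<subseteq> insert 0 Z" using w by (auto simp: Z_def)
    then have "card X = (\<Sum>z\<in>insert 0 Z. ?N z)"
      using sum.group[of X "insert 0 Z" w "\<lambda>_. 1::nat"] Z assms(1) by simp
    also have "\<dots> = ?N 0 + (\<Sum>z\<in>Z. ?N z)" using Z Z0 by simp
    finally show ?thesis using zeros by linarith
  qed
  then have "real d * T - real (\<Sum>z\<in>Z. ?N z) \<le> real d * T - (real (card X) - real m)" by linarith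
  finally show ?thesis .
qed

text \<open>Otherwise \<open>d\<close> would divide \<open>i - i'\<close> times the gcd, that is
  \<open>i - i'\<close> itself, which is nonzero and smaller than \<open>d\<close> in absolute
  value. The \<open>j\<close> found is the root at which residues are compared for the pair
  \<open>i\<close>, \<open>i'\<close>.\<close>

lemma gcd_one_separates:
  fixes d :: nat and a :: "'j \<Rightarrow> nat"
  assumes "finite J" and gcd: "Gcd (insert d (a ` J)) = 1" and "i < d" "i' < d" "i \<noteq> i'"
  shows "\<exists>j\<in>J. \<not> int d dvd (int i - int i') * int (a j)"
proof (rule ccontr)
  assume "\<not> ?thesis"
  then have all: "int d dvd (int i - int i') * int (a j)" if "j \<in> J" for j using that by blast
  define x where "x = nat \<bar>int i - int i'\<bar>"
  have "d dvd x * y" if y: "y \<in> insert d (a ` J)" for y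
  proof (cases "y = d")
    case False
    then obtain j where j: "j \<in> J" "y = a j" using y by auto
    have "int d dvd \<bar>(int i - int i') * int y\<bar>" using all[OF j(1)] j(2) by simp
    then have "int d dvd \<bar>int i - int i'\<bar> * int y" by (simp add: abs_mult)
    then have "int d dvd int (x * y)" by (simp add: x_def)
    then show ?thesis by (simp only: int_dvd_int_iff)
  qed simp
  then have "d dvd Gcd ((*) x ` insert d (a ` J))" by (intro Gcd_greatest) auto
  also have "\<dots> = x" unfolding Gcd_mult gcd by simp
  finally have "d dvd x" .
  moreover have "0 < x" "x < d" using assms(3-5) by (auto simp: x_def)
  ultimately show False by (auto dest: dvd_imp_le)
qed

lemma exact_order_power:
  assumes "exact_order p chi d" "g dvd d"
  shows "exact_order p (\<lambda>a. chi a ^ g) (d div g)"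
proof -
  obtain e where e: "d = g * e" using assms(2) by (auto elim: dvdE)
  have g0: "g > 0" and e0: "e > 0" using assms(1) e by (auto simp: exact_order_def)
  have "\<exists>a. \<not> int p dvd a \<and> (chi a ^ g) ^ k \<noteq> 1" if "0 < k" "k < e" for k
  proof -
    have "0 < g * k" "g * k < d" using that g0 e by auto
    then show ?thesis using assms(1) by (auto simp: exact_order_def power_mult[symmetric])
  qed
  moreover have "(chi a ^ g) ^ e = 1" if "\<not> int p dvd a" for a
    using assms(1) that by (auto simp: exact_order_def e power_mult)
  ultimately show ?thesis using e0 g0 by (simp add: exact_order_def e)
qed

lemma dirichlet_character_powers:
  assumes "dirichlet_character q chi" "g > 0"
  shows "dirichlet_character q (\<lambda>a. chi a ^ g)"
  using assms by (auto simp: dirichlet_character_def power_mult_distrib)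

lemma incongruent_residue:
  fixes a :: int
  assumes "a \<in> {0..<int p}" "b \<in> {0..<int p}" "int p dvd a - b"
  shows "a = b"
proof -
  have "a mod int p = b mod int p" using assms(3) by (simp add: mod_eq_dvd_iff)
  then show ?thesis using assms(1,2) by simp
qed

lemma character_sum_bound_coprime:
  fixes a :: "int \<Rightarrow> nat" and J :: "int set"
  assumes chi: "dirichlet_character p chi" and p: "prime p" and ord: "exact_order p chi d" and "d \<ge> 2"
    and "finite J" and incong: "\<And>i j. i \<in> J \<Longrightarrow> j \<in> J \<Longrightarrow> int p dvd i - j \<Longrightarrow> i = j"
    and J0: "\<And>j. j \<in> J \<Longrightarrow> \<not> int p dvd j" and a: "\<And>j. j \<in> J \<Longrightarrow> a j > 0"
    and gcd: "Gcd (insert d (a ` J)) = 1"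
    and n: "n = (\<Sum>j\<in>J. a j)" and K: "K \<ge> 1"
    and large: "d * 2 ^ d * (d * K\<^sup>2 * (d * n + 1) + 1 + n) < p"
  shows "norm (\<Sum>x\<in>{0..<int p}. \<Prod>j\<in>J. chi (x - j) ^ a j) \<le> real p * real (d * n + 1) / real (d * K - 1) + real (card J)"
proof -
  define f where "f = (\<Prod>j\<in>J. [:-j, 1::int:] ^ a j)"
  have poly_f: "poly f x = (\<Prod>j\<in>J. (x - j) ^ a j)" for x by (simp add: f_def poly_prod)
  have deg_f: "degree f = n"
    unfolding f_def n by (subst degree_prod_eq_sum_degree) (simp_all add: degree_power_eq)
  have fdvd: "int p dvd poly f x \<longleftrightarrow> (\<exists>j\<in>J. int p dvd x - j)" for x
    unfolding poly_f using p a \<open>finite J\<close>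
    by (auto simp: prime_dvd_prod_iff prime_dvd_power_iff)
  have root: "\<exists>j b h. f = [:-j, 1:] ^ b * h \<and> \<not> int p dvd poly h j \<and> \<not> int d dvd (int i - int i') * int b \<and> b \<le> degree f"
    if ii: "i < d" "i' < d" "i \<noteq> i'" for i i'
  proof -
    obtain j where j: "j \<in> J" "\<not> int d dvd (int i - int i') * int (a j)"
      using gcd_one_separates[OF \<open>finite J\<close> gcd ii] by blast
    define h where "h = (\<Prod>i\<in>J - {j}. [:-i, 1::int:] ^ a i)"
    have "f = [:-j, 1:] ^ a j * h" unfolding f_def h_def using j \<open>finite J\<close> by (subst prod.remove[of _ j]) auto
    moreover have "\<not> int p dvd poly h j"
    proof
      assume "int p dvd poly h j"
      then have "int p dvd (\<Prod>i\<in>J - {j}. (j - i) ^ a i)" by (simp add: h_def poly_prod)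
      then obtain i where i: "i \<in> J - {j}" "int p dvd (j - i) ^ a i"
        using p \<open>finite J\<close> by (auto simp: prime_dvd_prod_iff)
      then have "int p dvd j - i" using p by (metis prime_dvd_power prime_nat_int_transfer)
      with incong i j show False by blast
    qed
    moreover have "a j \<le> degree f" unfolding deg_f n using j \<open>finite J\<close> by (intro member_le_sum) auto
    ultimately show ?thesis using j by blast
  qed
  have f0: "\<not> int p dvd poly f 0" using J0 by (auto simp: fdvd)
  obtain s where s: "d * s = p - 1"
    "\<And>a b. \<not> int p dvd a \<Longrightarrow> \<not> int p dvd b \<Longrightarrow> chi a = chi b \<Longrightarrow> [a ^ s = b ^ s] (mod int p)"
    using exact_order_level_sets[OF chi p ord] by blast
  let ?X = "{0..<int p}"
  have M0: "d * K - 1 > 0"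
  proof -
    have "2 * 1 \<le> d * K" using K \<open>d \<ge> 2\<close> by (intro mult_mono) auto
    then show ?thesis by simp
  qed
  \<comment> \<open>The Stepanov bound for one level set, close to \<open>p / d\<close>:
    \<open>d * T\<close> exceeds \<open>p\<close> only by
    \<open>p * (d * n + 1) / (d * K - 1)\<close>, which becomes the final bound.\<close>
  define T where "T = real p * real (K + n) / real (d * K - 1)"
  have T0: "T \<ge> 0" by (simp add: T_def)
  have w: "(\<Prod>j\<in>J. chi (x - j) ^ a j) = chi (poly f x)" for x
    unfolding poly_f by (simp add: dirichlet_character_prod[OF chi] dirichlet_character_power[OF chi])
  have "norm (\<Sum>x\<in>?X. chi (poly f x)) \<le> real d * T - (real (card ?X) - real (card J))"
  proof (rule sum_roots_of_unity_levels[OF _ \<open>d \<ge> 2\<close>])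
    show "chi (poly f x) = 0 \<or> chi (poly f x) ^ d = 1" for x
      using ord dirichlet_character_eq_0_iff[OF chi p] by (auto simp: exact_order_def)
  next
    have "{x\<in>?X. chi (poly f x) = 0} \<subseteq> (\<lambda>j. j mod int p) ` J"
    proof
      fix x assume x: "x \<in> {x\<in>?X. chi (poly f x) = 0}"
      then obtain j where j: "j \<in> J" "int p dvd x - j"
        using dirichlet_character_eq_0_iff[OF chi p] fdvd by auto
      then have "x mod int p = j mod int p" by (simp add: mod_eq_dvd_iff)
      then have "x = j mod int p" using x by simp
      with j show "x \<in> (\<lambda>j. j mod int p) ` J" by blast
    qed
    then show "card {x\<in>?X. chi (poly f x) = 0} \<le> card J"
      using \<open>finite J\<close> surj_card_le by blast
  next
    fix z :: complex assume z: "z ^ d = 1"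
    show "real (card {x\<in>?X. chi (poly f x) = z}) \<le> T"
    proof (cases "{x\<in>?X. chi (poly f x) = z} = {}")
      case True
      then show ?thesis using T0 by (simp only: card.empty of_nat_0)
    next
      case False
      then obtain y where y: "chi (poly f y) = z" by auto
      have "z \<noteq> 0" using z \<open>d \<ge> 2\<close> by (auto simp: power_0_left)
      then have nd: "\<not> int p dvd poly f x" if "chi (poly f x) = z" for x
        using that dirichlet_character_eq_0_iff[OF chi p] by auto
      define c where "c = poly f y ^ s"
      let ?S = "{x\<in>?X. \<not> int p dvd poly f x \<and> [poly f x ^ s = c] (mod int p)}"
      have "card {x\<in>?X. chi (poly f x) = z} \<le> card ?S"
      proof (rule card_mono)
        show "finite ?S" by (rule finite_subset[of _ ?X]) auto
      qed (use nd s(2) y in \<open>auto simp: c_def\<close>)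
      moreover have "card ?S * (d * K - 1) \<le> p * (K + n)"
        by (rule stepanov_bound[OF p s(1) \<open>d \<ge> 2\<close> f0 root deg_f[symmetric] K refl]) (use large in auto)
      ultimately have "card {x\<in>?X. chi (poly f x) = z} * (d * K - 1) \<le> p * (K + n)"
        by (meson mult_le_mono1 order_trans)
      then have "real (card {x\<in>?X. chi (poly f x) = z}) * real (d * K - 1) \<le> real p * real (K + n)"
        by (metis of_nat_le_iff of_nat_mult)
      then show ?thesis unfolding T_def using M0 by (simp add: pos_le_divide_eq)
    qed
  qed simp
  also have "real d * T - (real (card ?X) - real (card J)) = real p * real (d * n + 1) / real (d * K - 1) + real (card J)"
  proof -
    define y where "y = real (d * K - 1)"
    have "y = real (d * K) - 1" unfolding y_def using M0 by linarith
    then have y: "real d * real K = y + 1" by simp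
    have y0: "y > 0" using M0 by (simp add: y_def)
    have "real d * T = real p * (real d * real K + real d * real n) / y"
      by (simp add: T_def y_def algebra_simps)
    then show ?thesis unfolding y y_def[symmetric] using y0 by (simp add: field_simps)
  qed
  finally show ?thesis unfolding w .
qed

lemma sum_periodic_shift:
  fixes h :: "int \<Rightarrow> 'a::comm_monoid_add"
  assumes "p > 0" and per: "\<And>x y. [x = y] (mod int p) \<Longrightarrow> h x = h y"
  shows "(\<Sum>x\<in>{0..<int p}. h (x + t)) = (\<Sum>x\<in>{0..<int p}. h x)"
proof (rule sum.reindex_bij_witness[where i = "\<lambda>x. (x - t) mod int p" and j = "\<lambda>x. (x + t) mod int p"])
  fix x assume x: "x \<in> {0..<int p}"
  show "((x + t) mod int p - t) mod int p = x" "((x - t) mod int p + t) mod int p = x"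
    using x by (simp_all add: mod_diff_left_eq mod_add_left_eq)
  show "(x + t) mod int p \<in> {0..<int p}" "(x - t) mod int p \<in> {0..<int p}" using assms(1) by auto
  show "h ((x + t) mod int p) = h (x + t)" by (rule per) (simp add: cong_def)
qed

text \<open>Reduction to coprime exponents: if \<open>g\<close> is the gcd of \<open>d\<close> and
  all \<open>b j\<close>, then \<open>chi ^ g\<close> has order \<open>d div g\<close> and the
  exponents become \<open>b j div g\<close>. The estimates use only \<open>m\<close> and
  \<open>d\<close>, so one bound serves all exponent choices.\<close>

lemma character_sum_bound:
  fixes b :: "int \<Rightarrow> nat" and J :: "int set"
  assumes chi: "dirichlet_character p chi" and p: "prime p" and ord: "exact_order p chi d"
    and "finite J" and incong: "\<And>i j. i \<in> J \<Longrightarrow> j \<in> J \<Longrightarrow> int p dvd i - j \<Longrightarrow> i = j"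
    and b: "\<And>j. j \<in> J \<Longrightarrow> b j \<in> {1..d}" and nontriv: "\<exists>j\<in>J. b j \<noteq> d"
    and m: "card J \<le> m" and K: "K \<ge> 1"
    and large: "d * 2 ^ d * (d * K\<^sup>2 * (d\<^sup>2 * m + 1) + 1 + d * m) < p"
  shows "norm (\<Sum>x\<in>{0..<int p}. \<Prod>j\<in>J. chi (x - j) ^ b j) \<le> real p * real (d\<^sup>2 * m + 1) / real K + real m"
proof -
  have d0: "d > 0" using ord by (simp add: exact_order_def)
  have mp: "m < p"
  proof -
    have "m \<le> d * m" using d0 by simp
    also have "\<dots> \<le> d * K\<^sup>2 * (d\<^sup>2 * m + 1) + 1 + d * m" by simp
    also have "\<dots> \<le> d * 2 ^ d * (d * K\<^sup>2 * (d\<^sup>2 * m + 1) + 1 + d * m)"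
      (is "?X \<le> _ * ?X")
    proof -
      have "1 \<le> d * 2 ^ d" using d0 by simp
      from mult_le_mono1[OF this, of ?X] show ?thesis by (simp only: mult_1)
    qed
    also have "\<dots> < p" by (rule large)
    finally show ?thesis .
  qed
  \<comment> \<open>translate so that none of the roots is \<open>0\<close>\<close>
  have "\<not> {0..<int p} \<subseteq> (\<lambda>j. (-j) mod int p) ` J"
  proof
    assume "{0..<int p} \<subseteq> (\<lambda>j. (-j) mod int p) ` J"
    then have "card {0..<int p} \<le> card J" using \<open>finite J\<close> surj_card_le by blast
    with m mp show False by simp
  qed
  then obtain t where t: "t \<in> {0..<int p}" "t \<notin> (\<lambda>j. (-j) mod int p) ` J" by blast
  define g where "g = Gcd (insert d (b ` J))"
  have gd: "g dvd d" and gb: "\<And>j. j \<in> J \<Longrightarrow> g dvd b j" unfolding g_def by (rule Gcd_dvd, simp)+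
  have g0: "g > 0" using gd d0 by (auto intro: Nat.gr0I)
  define e where "e = d div g"
  define a where "a j = b (j - t) div g" for j
  define J' where "J' = (\<lambda>j. j + t) ` J"
  have de: "d = g * e" using gd by (simp add: e_def)
  \<comment> \<open>This is where nontriviality enters: for \<open>e = 1\<close> every
    \<open>b j\<close> would be a multiple of \<open>d\<close> in \<open>{1..d}\<close>, hence
    \<open>d\<close>.\<close>
  have e2: "e \<ge> 2"
  proof (rule ccontr)
    assume "\<not> e \<ge> 2"
    then have "e = 1" using de d0 by (cases e) auto
    then have dvd: "d dvd b j" if "j \<in> J" for j using gb that de by simp
    have "b j = d" if "j \<in> J" for j using b[OF that] dvd_imp_le[OF dvd[OF that]] by auto
    with nontriv show False by blast
  qed
  have ab: "b j = g * a (j + t)" if "j \<in> J" for j using gb[OF that] by (simp add: a_def)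
  have img: "(*) g ` insert e (a ` J') = insert d (b ` J)"
    using ab by (force simp: de J'_def image_iff)
  have "g * Gcd (insert e (a ` J')) = g * 1"
    using Gcd_mult[of g "insert e (a ` J')"] unfolding img g_def[symmetric] by auto
  then have gcd1: "Gcd (insert e (a ` J')) = 1" using g0 by (metis mult_left_cancel less_irrefl)
  define n where "n = (\<Sum>j\<in>J'. a j)"
  have finJ': "finite J'" and cardJ': "card J' = card J"
    using \<open>finite J\<close> by (auto simp: J'_def card_image)
  have ed: "e \<le> d" using de g0 by simp
  have a_pos: "a j > 0" and a_le: "a j \<le> d" if "j \<in> J'" for j
  proof -
    obtain i where i: "i \<in> J" "j = i + t" using \<open>j \<in> J'\<close> by (auto simp: J'_def)
    have "b i = g * a j" using ab[OF i(1)] i(2) by simp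
    then show "a j > 0" "a j \<le> d" using b[OF i(1)] g0 by (auto intro!: Nat.gr0I intro: order_trans[of _ "g * a j"])
  qed
  have nm: "n \<le> d * m"
  proof -
    have "n \<le> (\<Sum>j\<in>J'. d)" unfolding n_def by (intro sum_mono a_le)
    also have "\<dots> = card J * d" by (simp add: cardJ')
    also have "\<dots> \<le> m * d" using m by simp
    finally show ?thesis by (simp add: mult.commute)
  qed
  have en: "e * n \<le> d\<^sup>2 * m"
    using mult_le_mono[OF ed nm] by (simp add: power2_eq_square algebra_simps)
  let ?psi = "\<lambda>a. chi a ^ g"
  let ?H = "\<lambda>x. \<Prod>j\<in>J. chi (x - j) ^ b j"
  have "norm (\<Sum>x\<in>{0..<int p}. \<Prod>j\<in>J'. ?psi (x - j) ^ a j) \<le> real p * real (e * n + 1) / real (e * K - 1) + real (card J')"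
  proof (rule character_sum_bound_coprime[OF _ p _ e2 finJ' _ _ a_pos gcd1 n_def K])
    show "dirichlet_character p ?psi" using chi g0 by (rule dirichlet_character_powers)
    show "exact_order p ?psi e" unfolding e_def using ord gd by (rule exact_order_power)
    show "i = j" if "i \<in> J'" "j \<in> J'" "int p dvd i - j" for i j
      using that incong by (auto simp: J'_def)
    show "\<not> int p dvd j" if j: "j \<in> J'" for j
    proof
      assume "int p dvd j"
      obtain i where i: "i \<in> J" "j = i + t" using j by (auto simp: J'_def)
      have "t mod int p = (- i) mod int p" using \<open>int p dvd j\<close> i by (simp add: mod_eq_dvd_iff add.commute)
      then have "t = (- i) mod int p" using t(1) by simp
      with t(2) i show False by blast
    qed
    have "e * 2 ^ e * (e * K\<^sup>2 * (e * n + 1) + 1 + n) \<le> d * 2 ^ d * (d * K\<^sup>2 * (d\<^sup>2 * m + 1) + 1 + d * m)"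
      by (intro en ed nm order_refl mult_le_mono add_le_mono power_increasing) auto
    then show "e * 2 ^ e * (e * K\<^sup>2 * (e * n + 1) + 1 + n) < p" using large by simp
  qed
  also have "real p * real (e * n + 1) / real (e * K - 1) + real (card J') \<le> real p * real (d\<^sup>2 * m + 1) / real K + real m"
  proof -
    have "2 * K \<le> e * K" using e2 by simp
    then have "K \<le> e * K - 1" using K by linarith
    then have "real K \<le> real (e * K - 1)" by (simp only: of_nat_le_iff)
    moreover have "real (e * n + 1) \<le> real (d\<^sup>2 * m + 1)"
      using en by (simp only: of_nat_le_iff add_le_cancel_right)
    ultimately show ?thesis
      using m K cardJ' by (intro add_mono frac_le mult_left_mono) auto
  qed
  also have "(\<Sum>x\<in>{0..<int p}. \<Prod>j\<in>J'. ?psi (x - j) ^ a j) = (\<Sum>x\<in>{0..<int p}. ?H (x + (- t)))"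
  proof (intro sum.cong refl)
    fix x
    have "(\<Prod>j\<in>J'. ?psi (x - j) ^ a j) = (\<Prod>j\<in>J. ?psi (x - (j + t)) ^ a (j + t))"
      unfolding J'_def by (subst prod.reindex) auto
    also have "\<dots> = ?H (x + (- t))"
      by (intro prod.cong refl) (simp add: ab power_mult algebra_simps)
    finally show "(\<Prod>j\<in>J'. ?psi (x - j) ^ a j) = ?H (x + (- t))" .
  qed
  also have "\<dots> = (\<Sum>x\<in>{0..<int p}. ?H x)"
  proof (rule sum_periodic_shift)
    show "p > 0" using p by (rule prime_gt_0_nat)
    fix x y assume xy: "[x = y] (mod int p)"
    have "chi (x - j) = chi (y - j)" for j
      by (intro dirichlet_character_cong[OF chi] cong_diff xy cong_refl)
    then show "?H x = ?H y" by simp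
  qed
  finally show ?thesis .
qed

section \<open>Prescribed character values\<close>

text \<open>Exponents run over \<open>1..d\<close> instead of \<open>0..d-1\<close>: this changes
  nothing for roots of unity but makes \<open>w = 0\<close> contribute 0. Accordingly exponent
  \<open>d\<close>, not 0, stands for the trivial character below.\<close>

lemma root_of_unity_indicator:
  fixes w c :: complex
  assumes "d > 0" "c ^ d = 1" "w = 0 \<or> w ^ d = 1"
  shows "(\<Sum>a\<in>{1..d}. (w / c) ^ a) / of_nat d = (if w = c then 1 else 0)"
proof -
  have c0: "c \<noteq> 0" using assms(1,2) by (auto simp: power_0_left)
  show ?thesis
  proof (cases "w = c")
    case True
    then show ?thesis using c0 assms(1) by simp
  next
    case False
    show ?thesis
    proof (cases "w = 0")
      case True
      then show ?thesis using False by (simp add: power_0_left)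
    next
      case w0: False
      define z where "z = w / c"
      have z: "z ^ d = 1" "z \<noteq> 1" using assms w0 False c0 by (auto simp: z_def power_divide)
      have "(\<Sum>a\<in>{1..d}. z ^ a) = (\<Sum>a<d. z ^ Suc a)"
        by (rule sum.reindex_bij_witness[of _ Suc "\<lambda>a. a - 1"]) auto
      also have "\<dots> = z * (\<Sum>a<d. z ^ a)" by (simp add: sum_distrib_left)
      also have "(\<Sum>a<d. z ^ a) = 0" using z by (simp add: sum_gp_strict)
      finally show ?thesis using False by (simp add: z_def)
    qed
  qed
qed

definition pattern_set :: "nat \<Rightarrow> (int \<Rightarrow> complex) \<Rightarrow> int set \<Rightarrow> (int \<Rightarrow> complex) \<Rightarrow> int set" where
  "pattern_set p chi J c = {x\<in>{0..<int p}. \<forall>j\<in>J. chi (x - j) = c j}"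

text \<open>The product of indicators is multiplied out. The free weight \<open>F\<close> lets one
  expansion serve both the size of the pattern set and the correlations over it.\<close>

lemma sum_pattern_set:
  fixes F :: "int \<Rightarrow> complex"
  assumes chi: "dirichlet_character p chi" and p: "prime p" and ord: "exact_order p chi d"
    and "finite J" and c: "\<And>j. j \<in> J \<Longrightarrow> c j ^ d = 1"
  shows "(\<Sum>x\<in>pattern_set p chi J c. F x) =
    (\<Sum>a\<in>PiE J (\<lambda>_. {1..d}). (\<Prod>j\<in>J. inverse (c j) ^ a j) *
       (\<Sum>x\<in>{0..<int p}. (\<Prod>j\<in>J. chi (x - j) ^ a j) * F x)) / of_nat d ^ card J"
proof -
  let ?X = "{0..<int p}" and ?A = "PiE J (\<lambda>_. {1..d})"
  have d0: "d > 0" using ord by (simp add: exact_order_def)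
  have w: "chi x = 0 \<or> chi x ^ d = 1" for x
    using ord dirichlet_character_eq_0_iff[OF chi p] by (auto simp: exact_order_def)
  have "(\<Sum>x\<in>pattern_set p chi J c. F x) = (\<Sum>x\<in>?X. (if \<forall>j\<in>J. chi (x - j) = c j then F x else 0))"
    unfolding pattern_set_def by (subst sum.inter_filter) auto
  also have "\<dots> = (\<Sum>x\<in>?X. (\<Prod>j\<in>J. (\<Sum>a\<in>{1..d}. (chi (x - j) / c j) ^ a) / of_nat d) * F x)"
  proof (intro sum.cong refl)
    fix x
    have "(\<Prod>j\<in>J. (\<Sum>a\<in>{1..d}. (chi (x - j) / c j) ^ a) / of_nat d) = (\<Prod>j\<in>J. if chi (x - j) = c j then 1 else 0)"
      by (intro prod.cong refl root_of_unity_indicator d0 c w)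
    also have "\<dots> = (if \<forall>j\<in>J. chi (x - j) = c j then 1 else 0)"
      using \<open>finite J\<close> by (auto simp: prod_zero_iff)
    finally show "(if \<forall>j\<in>J. chi (x - j) = c j then F x else 0) = (\<Prod>j\<in>J. (\<Sum>a\<in>{1..d}. (chi (x - j) / c j) ^ a) / of_nat d) * F x"
      by simp
  qed
  also have "\<dots> = (\<Sum>x\<in>?X. (\<Sum>a\<in>?A. (\<Prod>j\<in>J. inverse (c j) ^ a j) * ((\<Prod>j\<in>J. chi (x - j) ^ a j) * F x)) / of_nat d ^ card J)"
  proof (intro sum.cong refl)
    fix x
    have "(\<Prod>j\<in>J. (\<Sum>a\<in>{1..d}. (chi (x - j) / c j) ^ a) / of_nat d) = (\<Prod>j\<in>J. \<Sum>a\<in>{1..d}. (chi (x - j) / c j) ^ a) / of_nat d ^ card J"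
      by (simp add: prod_dividef)
    also have "(\<Prod>j\<in>J. \<Sum>a\<in>{1..d}. (chi (x - j) / c j) ^ a) = (\<Sum>a\<in>?A. \<Prod>j\<in>J. (chi (x - j) / c j) ^ a j)"
      using \<open>finite J\<close> by (intro prod_sum_PiE) auto
    also have "\<dots> = (\<Sum>a\<in>?A. (\<Prod>j\<in>J. inverse (c j) ^ a j) * (\<Prod>j\<in>J. chi (x - j) ^ a j))"
      by (intro sum.cong refl) (simp add: divide_inverse power_mult_distrib prod.distrib mult.commute)
    finally show "(\<Prod>j\<in>J. (\<Sum>a\<in>{1..d}. (chi (x - j) / c j) ^ a) / of_nat d) * F x
      = (\<Sum>a\<in>?A. (\<Prod>j\<in>J. inverse (c j) ^ a j) * ((\<Prod>j\<in>J. chi (x - j) ^ a j) * F x)) / of_nat d ^ card J"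
      by (simp add: sum_distrib_right mult.assoc)
  qed
  also have "\<dots> = (\<Sum>a\<in>?A. (\<Prod>j\<in>J. inverse (c j) ^ a j) * (\<Sum>x\<in>?X. (\<Prod>j\<in>J. chi (x - j) ^ a j) * F x)) / of_nat d ^ card J"
    unfolding sum_divide_distrib[symmetric] sum_distrib_left by (subst sum.swap) simp
  finally show ?thesis .
qed

definition incongruent :: "nat \<Rightarrow> int set \<Rightarrow> bool" where
  "incongruent p J \<longleftrightarrow> (\<forall>i\<in>J. \<forall>j\<in>J. int p dvd i - j \<longrightarrow> i = j)"

text \<open>\<open>E\<close> abstracts the cancellation in nontrivial products over at most
  \<open>m\<close> shifts, so the counting below does not depend on how it is obtained. The only
  excluded exponents are those constantly equal to \<open>d\<close>.\<close>

locale character_sums =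
  fixes p :: nat and chi :: "int \<Rightarrow> complex" and d m :: nat and E :: real
  assumes chi: "dirichlet_character p chi" and p: "prime p" and ord: "exact_order p chi d" and d2: "d \<ge> 2"
    and E: "\<And>J b. finite J \<Longrightarrow> card J \<le> m \<Longrightarrow> incongruent p J \<Longrightarrow> (\<And>j. j \<in> J \<Longrightarrow> b j \<in> {1..d}) \<Longrightarrow>
      \<exists>j\<in>J. b j \<noteq> d \<Longrightarrow> norm (\<Sum>x\<in>{0..<int p}. \<Prod>j\<in>J. chi (x - j) ^ b j) \<le> E"
begin

lemma d0: "d > 0" using d2 by simp

lemma norm_root:
  fixes z :: complex
  assumes "z ^ d = 1"
  shows "norm z = 1"
  using power_eq_1_iff[OF assms] d0 by simp

lemma cnj_chi: "cnj (chi y) = chi y ^ (d - 1)"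
proof (cases "chi y = 0")
  case True
  then show ?thesis using d2 by (simp add: power_0_left)
next
  case False
  then have "\<not> int p dvd y" using dirichlet_character_eq_0_iff[OF chi p] by simp
  then have 1: "chi y ^ d = 1" using ord by (simp add: exact_order_def)
  have "chi y * cnj (chi y) = 1" using norm_root[OF 1] by (simp add: complex_norm_square[symmetric])
  moreover have "chi y * chi y ^ (d - 1) = 1" using 1 d0 by (simp flip: power_Suc)
  ultimately show ?thesis using False by (metis mult_left_cancel)
qed

lemma norm_chi_le: "norm (chi y) \<le> 1"
  using norm_dirichlet_character[OF chi p, of y] dirichlet_character_eq_0_iff[OF chi p, of y] by (cases "int p dvd y") auto

lemma finite_pattern_set: "finite (pattern_set p chi J c)"
  by (rule finite_subset[of _ "{0..<int p}"]) (auto simp: pattern_set_def)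

lemma E_nonneg:
  assumes "m \<ge> 1"
  shows "E \<ge> 0"
  using E[of "{0}" "\<lambda>_. 1"] d2 assms by (simp add: incongruent_def) (meson norm_ge_zero order_trans)

lemma norm_pattern_weights:
  fixes c :: "int \<Rightarrow> complex"
  assumes "\<And>j. j \<in> J \<Longrightarrow> c j ^ d = 1"
  shows "norm (\<Prod>j\<in>J. inverse (c j) ^ a j) = 1"
proof -
  have "norm (c j) = 1" if "j \<in> J" for j by (rule norm_root) (rule assms[OF that])
  then show ?thesis unfolding prod_norm[symmetric] norm_power norm_inverse by simp
qed

text \<open>The tuple constantly \<open>d\<close> counts the \<open>x\<close> that avoid all shifts
  and gives the main term. Fewer than \<open>d ^ card J\<close> other tuples contribute at most
  \<open>E\<close> each, and the normalising division reduces their total to at most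
  \<open>E\<close>.\<close>

lemma card_pattern_set_ge:
  assumes "finite J" "card J \<le> m" "incongruent p J" "m \<ge> 1" and c: "\<And>j. j \<in> J \<Longrightarrow> c j ^ d = 1"
  shows "real (card (pattern_set p chi J c)) \<ge> (real p - real (card J)) / real d ^ card J - E"
proof -
  let ?X = "{0..<int p}" and ?A = "PiE J (\<lambda>_. {1..d})"
  define G where "G a = (\<Prod>j\<in>J. inverse (c j) ^ a j) * (\<Sum>x\<in>?X. (\<Prod>j\<in>J. chi (x - j) ^ a j))" for a
  define a0 where "a0 = restrict (\<lambda>_. d) J"
  have a0: "a0 \<in> ?A" using d0 by (auto simp: a0_def)
  have finA: "finite ?A" using assms(1) by (intro finite_PiE) auto
  have cardA: "card ?A = d ^ card J" using assms(1) by (simp add: card_PiE)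
  have eq: "of_nat (card (pattern_set p chi J c)) = (\<Sum>a\<in>?A. G a) / of_nat d ^ card J"
    using sum_pattern_set[OF chi p ord assms(1), where c = c and F = "\<lambda>_. 1"] c by (simp add: G_def)
  have G0: "G a0 = of_nat (card {x\<in>?X. \<forall>j\<in>J. \<not> int p dvd x - j})"
  proof -
    have "(\<Prod>j\<in>J. inverse (c j) ^ a0 j) = (\<Prod>j\<in>J. 1)"
      by (intro prod.cong refl) (simp add: a0_def c power_inverse)
    moreover have "(\<Sum>x\<in>?X. \<Prod>j\<in>J. chi (x - j) ^ a0 j) = (\<Sum>x\<in>?X. if \<forall>j\<in>J. \<not> int p dvd x - j then 1 else 0)"
    proof (intro sum.cong refl)
      fix x
      have "(\<Prod>j\<in>J. chi (x - j) ^ a0 j) = (\<Prod>j\<in>J. if \<not> int p dvd x - j then 1 else 0)"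
        using ord dirichlet_character_eq_0_iff[OF chi p] d0
        by (intro prod.cong refl) (auto simp: a0_def exact_order_def)
      also have "\<dots> = (if \<forall>j\<in>J. \<not> int p dvd x - j then 1 else 0)"
        using assms(1) by (auto simp: prod_zero_iff)
      finally show "(\<Prod>j\<in>J. chi (x - j) ^ a0 j) = (if \<forall>j\<in>J. \<not> int p dvd x - j then 1 else 0)" .
    qed
    ultimately show ?thesis
      by (simp add: G_def sum.If_cases Int_def)
  qed
  have cnt: "real (card {x\<in>?X. \<forall>j\<in>J. \<not> int p dvd x - j}) \<ge> real p - real (card J)"
  proof -
    have "?X - (\<lambda>j. j mod int p) ` J \<subseteq> {x\<in>?X. \<forall>j\<in>J. \<not> int p dvd x - j}"
    proof
      fix x assume x: "x \<in> ?X - (\<lambda>j. j mod int p) ` J"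
      have "\<not> int p dvd x - j" if j: "j \<in> J" for j
      proof
        assume "int p dvd x - j"
        then have "x mod int p = j mod int p" by (simp add: mod_eq_dvd_iff)
        then have "x = j mod int p" using x by simp
        with x j show False by blast
      qed
      with x show "x \<in> {x\<in>?X. \<forall>j\<in>J. \<not> int p dvd x - j}" by blast
    qed
    moreover have "finite {x\<in>?X. \<forall>j\<in>J. \<not> int p dvd x - j}" by (rule finite_subset[of _ ?X]) auto
    ultimately have "card (?X - (\<lambda>j. j mod int p) ` J) \<le> card {x\<in>?X. \<forall>j\<in>J. \<not> int p dvd x - j}"
      by (intro card_mono)
    moreover have "card ?X - card ((\<lambda>j. j mod int p) ` J) \<le> card (?X - (\<lambda>j. j mod int p) ` J)"
      using assms(1) by (intro diff_card_le_card_Diff) auto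
    moreover have "card ((\<lambda>j. j mod int p) ` J) \<le> card J" using assms(1) by (rule card_image_le)
    ultimately show ?thesis by simp
  qed
  have rest: "norm (\<Sum>a\<in>?A - {a0}. G a) \<le> real d ^ card J * E"
  proof -
    have "norm (\<Sum>a\<in>?A - {a0}. G a) \<le> (\<Sum>a\<in>?A - {a0}. E)"
    proof (rule sum_norm_le)
      fix a assume a: "a \<in> ?A - {a0}"
      have "\<exists>j\<in>J. a j \<noteq> d"
      proof (rule ccontr)
        assume "\<not> ?thesis"
        then have "a = a0" using a a0 by (intro PiE_ext[of a J "\<lambda>_. {1..d}" a0]) (auto simp: a0_def)
        with a show False by blast
      qed
      then have "norm (\<Sum>x\<in>?X. \<Prod>j\<in>J. chi (x - j) ^ a j) \<le> E"
        using a by (intro E assms(1-3)) auto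
      then show "norm (G a) \<le> E" unfolding G_def norm_mult using norm_pattern_weights[of J c] c by simp
    qed
    also have "\<dots> = real (card (?A - {a0})) * E" by simp
    also have "\<dots> \<le> real (card ?A) * E"
      using E_nonneg[OF assms(4)] finA by (intro mult_right_mono) (auto intro: card_mono)
    finally show ?thesis by (simp only: cardA of_nat_power)
  qed
  have "of_nat (card (pattern_set p chi J c)) * of_nat d ^ card J = G a0 + (\<Sum>a\<in>?A - {a0}. G a)"
    using eq d0 sum.remove[OF finA a0, of G] by (simp add: field_simps)
  then have "of_nat (card (pattern_set p chi J c)) * of_nat d ^ card J - G a0 = (\<Sum>a\<in>?A - {a0}. G a)" by simp
  then have "norm (of_real (real (card (pattern_set p chi J c)) * real d ^ card J - real (card {x\<in>?X. \<forall>j\<in>J. \<not> int p dvd x - j})) :: complex)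
      \<le> real d ^ card J * E"
    using rest G0 by simp
  then have "real (card (pattern_set p chi J c)) * real d ^ card J \<ge> real p - real (card J) - real d ^ card J * E"
    using cnt unfolding norm_of_real by linarith
  then have "real (card (pattern_set p chi J c)) \<ge> (real p - real (card J) - real d ^ card J * E) / real d ^ card J"
    using d0 by (simp add: pos_divide_le_eq)
  then show ?thesis using d0 by (simp add: diff_divide_distrib)
qed

text \<open>Conjugation is the power \<open>d - 1\<close>, so the two extra factors enter as shifts
  with exponents 1 and \<open>d - 1\<close>. Since 1 differs from \<open>d\<close>, every tuple of
  the expansion is nontrivial and there is no main term.\<close>

lemma pattern_set_correlation:
  assumes "finite J" "card J + 2 \<le> m" and i: "i \<notin> J" "i' \<notin> J" "i \<noteq> i'" and inc: "incongruent p (insert i (insert i' J))"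
    and c: "\<And>j. j \<in> J \<Longrightarrow> c j ^ d = 1"
  shows "norm (\<Sum>x\<in>pattern_set p chi J c. chi (x - i) * cnj (chi (x - i'))) \<le> E"
proof -
  let ?X = "{0..<int p}" and ?A = "PiE J (\<lambda>_. {1..d})"
  have cardA: "card ?A = d ^ card J" using assms(1) by (simp add: card_PiE)
  let ?G = "\<lambda>a. (\<Prod>j\<in>J. inverse (c j) ^ a j) * (\<Sum>x\<in>?X. (\<Prod>j\<in>J. chi (x - j) ^ a j) * (chi (x - i) * cnj (chi (x - i'))))"
  have "norm (?G a) \<le> E" if a: "a \<in> ?A" for a
  proof -
    define b where "b j = (if j = i then 1 else if j = i' then d - 1 else a j)" for j
    have "(\<Prod>j\<in>J. chi (x - j) ^ a j) * (chi (x - i) * cnj (chi (x - i'))) = (\<Prod>j\<in>insert i (insert i' J). chi (x - j) ^ b j)" for x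
    proof -
      have "(\<Prod>j\<in>J. chi (x - j) ^ b j) = (\<Prod>j\<in>J. chi (x - j) ^ a j)"
        using i by (intro prod.cong refl) (auto simp: b_def)
      then show ?thesis using assms(1) i by (simp add: b_def cnj_chi)
    qed
    moreover have "norm (\<Sum>x\<in>?X. \<Prod>j\<in>insert i (insert i' J). chi (x - j) ^ b j) \<le> E"
    proof (rule E)
      show "\<exists>j\<in>insert i (insert i' J). b j \<noteq> d" using d2 by (intro bexI[of _ i]) (auto simp: b_def)
      show "b j \<in> {1..d}" if "j \<in> insert i (insert i' J)" for j
        using that a i d2 by (auto simp: b_def PiE_iff)
    qed (use assms(1,2) i inc in auto)
    ultimately show ?thesis unfolding norm_mult using norm_pattern_weights[of J c] c by simp
  qed
  then have "norm (\<Sum>a\<in>?A. ?G a) \<le> (\<Sum>a\<in>?A. E)" by (intro sum_norm_le)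
  then have "norm (\<Sum>a\<in>?A. ?G a) \<le> real d ^ card J * E" by (simp only: sum_constant cardA of_nat_power)
  moreover have "(\<Sum>x\<in>pattern_set p chi J c. chi (x - i) * cnj (chi (x - i'))) = (\<Sum>a\<in>?A. ?G a) / of_nat d ^ card J"
    by (rule sum_pattern_set[OF chi p ord assms(1)]) (rule c)
  ultimately show ?thesis
    using d0 by (simp add: norm_divide norm_power pos_divide_le_eq mult.commute)
qed

text \<open>The square is expanded: diagonal pairs give at most the size of the pattern set, all
  others at most \<open>E\<close>. Up to this error the values outside the pattern are
  uncorrelated.\<close>

lemma pattern_set_second_moment:
  fixes wt :: "int \<Rightarrow> real"
  assumes "finite J" "card J + 2 \<le> m" "finite I" "I \<inter> J = {}" and inc: "incongruent p (I \<union> J)"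
    and c: "\<And>j. j \<in> J \<Longrightarrow> c j ^ d = 1"
  shows "(\<Sum>x\<in>pattern_set p chi J c. (norm (\<Sum>i\<in>I. of_real (wt i) * chi (x - i)))\<^sup>2)
    \<le> real (card (pattern_set p chi J c)) * (\<Sum>i\<in>I. (wt i)\<^sup>2) + E * (\<Sum>i\<in>I. \<bar>wt i\<bar>)\<^sup>2"
proof -
  let ?P = "pattern_set p chi J c"
  let ?T = "\<lambda>x. \<Sum>i\<in>I. of_real (wt i) * chi (x - i)"
  have E0: "E \<ge> 0" using assms(2) by (intro E_nonneg) simp
  have "of_real (\<Sum>x\<in>?P. (norm (?T x))\<^sup>2) = (\<Sum>x\<in>?P. ?T x * cnj (?T x))"
    by (simp only: of_real_sum complex_norm_square)
  also have "\<dots> = (\<Sum>x\<in>?P. \<Sum>i\<in>I. \<Sum>i'\<in>I. of_real (wt i * wt i') * (chi (x - i) * cnj (chi (x - i'))))"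
    by (simp add: sum_product algebra_simps)
  also have "\<dots> = (\<Sum>i\<in>I. \<Sum>i'\<in>I. of_real (wt i * wt i') * (\<Sum>x\<in>?P. chi (x - i) * cnj (chi (x - i'))))"
    unfolding sum_distrib_left by (subst (2) sum.swap, subst sum.swap) (rule refl)
  finally have eq: "of_real (\<Sum>x\<in>?P. (norm (?T x))\<^sup>2) =
    (\<Sum>i\<in>I. \<Sum>i'\<in>I. of_real (wt i * wt i') * (\<Sum>x\<in>?P. chi (x - i) * cnj (chi (x - i'))))" .
  have "(\<Sum>x\<in>?P. (norm (?T x))\<^sup>2) = norm (of_real (\<Sum>x\<in>?P. (norm (?T x))\<^sup>2) :: complex)"
    by (simp only: norm_of_real) (simp add: sum_nonneg)
  also have "\<dots> \<le> (\<Sum>i\<in>I. \<Sum>i'\<in>I. (if i = i' then real (card ?P) * (wt i)\<^sup>2 else 0) + E * (\<bar>wt i\<bar> * \<bar>wt i'\<bar>))"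
    unfolding eq
  proof (intro sum_norm_le)
    fix i i' assume ii: "i \<in> I" "i' \<in> I"
    show "norm (of_real (wt i * wt i') * (\<Sum>x\<in>?P. chi (x - i) * cnj (chi (x - i'))))
      \<le> (if i = i' then real (card ?P) * (wt i)\<^sup>2 else 0) + E * (\<bar>wt i\<bar> * \<bar>wt i'\<bar>)"
    proof (cases "i = i'")
      case True
      have "norm (\<Sum>x\<in>?P. chi (x - i) * cnj (chi (x - i))) \<le> (\<Sum>x\<in>?P. 1)"
        by (intro sum_norm_le) (simp add: norm_mult mult_le_one norm_chi_le)
      then have "(wt i)\<^sup>2 * norm (\<Sum>x\<in>?P. chi (x - i) * cnj (chi (x - i))) \<le> (wt i)\<^sup>2 * real (card ?P)"
        by (intro mult_left_mono) auto
      moreover have "E * (\<bar>wt i\<bar> * \<bar>wt i\<bar>) \<ge> 0" using E0 by simp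
      ultimately show ?thesis using True by (simp add: norm_mult power2_eq_square mult.commute)
    next
      case False
      have "norm (\<Sum>x\<in>?P. chi (x - i) * cnj (chi (x - i'))) \<le> E"
      proof (rule pattern_set_correlation[OF assms(1,2) _ _ False])
        show "i \<notin> J" "i' \<notin> J" using ii assms(4) by auto
        show "incongruent p (insert i (insert i' J))" using inc ii by (auto simp: incongruent_def)
      qed (rule c)
      then have "\<bar>wt i * wt i'\<bar> * norm (\<Sum>x\<in>?P. chi (x - i) * cnj (chi (x - i'))) \<le> \<bar>wt i * wt i'\<bar> * E"
        by (intro mult_left_mono) auto
      then show ?thesis using False by (simp only: norm_mult norm_of_real abs_mult) (simp add: mult.commute)
    qed
  qed
  also have "\<dots> = real (card ?P) * (\<Sum>i\<in>I. (wt i)\<^sup>2) + E * (\<Sum>i\<in>I. \<bar>wt i\<bar>)\<^sup>2"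
  proof -
    have "(\<Sum>i\<in>I. \<Sum>i'\<in>I. if i = i' then real (card ?P) * (wt i)\<^sup>2 else 0) = real (card ?P) * (\<Sum>i\<in>I. (wt i)\<^sup>2)"
      unfolding sum_distrib_left by (intro sum.cong refl) (simp add: assms(3))
    moreover have "(\<Sum>i\<in>I. \<Sum>i'\<in>I. E * (\<bar>wt i\<bar> * \<bar>wt i'\<bar>)) = E * (\<Sum>i\<in>I. \<bar>wt i\<bar>)\<^sup>2"
      unfolding power2_eq_square sum_product by (simp only: sum_distrib_left)
    ultimately show ?thesis by (simp only: sum.distrib)
  qed
  finally show ?thesis .
qed

text \<open>Chebyshev's inequality on the pattern set.\<close>

lemma card_pattern_set_small_tail:
  fixes wt :: "int \<Rightarrow> real"
  assumes "finite J" "card J + 2 \<le> m" "finite I" "I \<inter> J = {}" and inc: "incongruent p (I \<union> J)"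
    and c: "\<And>j. j \<in> J \<Longrightarrow> c j ^ d = 1" and "T > 0"
  shows "real (card {x\<in>pattern_set p chi J c. norm (\<Sum>i\<in>I. of_real (wt i) * chi (x - i)) \<le> T})
    \<ge> real (card (pattern_set p chi J c)) * (1 - (\<Sum>i\<in>I. (wt i)\<^sup>2) / T\<^sup>2) - E * (\<Sum>i\<in>I. \<bar>wt i\<bar>)\<^sup>2 / T\<^sup>2"
proof -
  let ?P = "pattern_set p chi J c"
  let ?t = "\<lambda>x. norm (\<Sum>i\<in>I. of_real (wt i) * chi (x - i))"
  let ?G = "{x\<in>?P. ?t x \<le> T}"
  have fin: "finite ?P" by (rule finite_pattern_set)
  have "real (card (?P - ?G)) * T\<^sup>2 = (\<Sum>x\<in>?P - ?G. T\<^sup>2)" by simp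
  also have "\<dots> \<le> (\<Sum>x\<in>?P - ?G. (?t x)\<^sup>2)" using \<open>T > 0\<close> by (intro sum_mono power_mono) auto
  also have "\<dots> \<le> (\<Sum>x\<in>?P. (?t x)\<^sup>2)" using fin by (intro sum_mono2) auto
  also have "\<dots> \<le> real (card ?P) * (\<Sum>i\<in>I. (wt i)\<^sup>2) + E * (\<Sum>i\<in>I. \<bar>wt i\<bar>)\<^sup>2"
    by (rule pattern_set_second_moment[OF assms(1-4) inc]) (rule c)
  finally have "real (card (?P - ?G)) \<le> (real (card ?P) * (\<Sum>i\<in>I. (wt i)\<^sup>2) + E * (\<Sum>i\<in>I. \<bar>wt i\<bar>)\<^sup>2) / T\<^sup>2"
    using \<open>T > 0\<close> by (simp add: pos_le_divide_eq)
  moreover have "card (?P - ?G) = card ?P - card ?G" "card ?G \<le> card ?P"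
    using fin by (auto intro!: card_Diff_subset card_mono)
  ultimately show ?thesis by (simp add: of_nat_diff add_divide_distrib algebra_simps)
qed

end

section \<open>Fekete polynomials at the midpoints of arcs\<close>

lemma e_mod_cis: "e_mod p x = cis (2 * pi * x / real p)"
  unfolding e_mod_def cis_conv_exp by (rule arg_cong[of _ _ exp]) simp

lemma e_mod_add: "e_mod p (x + y) = e_mod p x * e_mod p y"
  by (simp add: e_mod_cis cis_mult add_divide_distrib distrib_left)

lemma e_mod_mult_nat: "e_mod p (x * real n) = e_mod p x ^ n"
  unfolding e_mod_cis Complex.DeMoivre by (rule arg_cong[of _ _ cis]) simp

lemma cnj_e_mod: "cnj (e_mod p x) = e_mod p (- x)"
  by (simp add: e_mod_cis cis_cnj)

lemma e_mod_multiple: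
  assumes "p > 0"
  shows "e_mod p (real_of_int (int p * k)) = 1"
proof -
  have "2 * pi * real_of_int (int p * k) / real p = 2 * pi * real_of_int k" using assms by simp
  then show ?thesis unfolding e_mod_cis using cis_multiple_2pi[OF Ints_of_int] by metis
qed

lemma e_mod_cong:
  assumes "p > 0" "[a = b] (mod int p)"
  shows "e_mod p (real_of_int a + x) = e_mod p (real_of_int b + x)"
proof -
  obtain k where "b = a + int p * k" using assms(2) by (metis cong_iff_lin)
  then have "real_of_int b + x = (real_of_int a + x) + real_of_int (int p * k)" by simp
  then show ?thesis by (simp only: e_mod_add e_mod_multiple[OF assms(1)] mult_1_right)
qed

lemma e_mod_eq_1:
  assumes "p > 0" "e_mod p (real_of_int k) = 1"
  shows "int p dvd k"
proof -
  have "cos (2 * pi * real_of_int k / real p) = 1"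
    using assms(2) by (metis cis.simps(1) e_mod_cis one_complex.simps(1))
  then obtain n :: int where "2 * pi * real_of_int k / real p = of_int n * 2 * pi"
    by (auto simp: cos_one_2pi_int)
  then have "pi * (real_of_int k) = pi * (of_int n * real p)" using assms(1) by (simp add: field_simps)
  then have "real_of_int k = real_of_int (n * int p)" by simp
  then have "k = n * int p" by (simp only: of_int_eq_iff)
  then show ?thesis by simp
qed

lemma sum_e_mod:
  assumes "p > 0"
  shows "(\<Sum>n<p. e_mod p (real_of_int k * real n)) = (if int p dvd k then of_nat p else 0)"
proof (cases "int p dvd k")
  case True
  then obtain l where "k = int p * l" by (auto elim: dvdE)
  then have "e_mod p (real_of_int k) = 1" using e_mod_multiple[OF assms] by blast
  then show ?thesis using True by (simp add: e_mod_mult_nat)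
next
  case False
  define z where "z = e_mod p (real_of_int k)"
  have "z \<noteq> 1" using e_mod_eq_1[OF assms] False by (auto simp: z_def)
  moreover have "z ^ p = 1"
    using e_mod_multiple[OF assms, of k] by (simp add: z_def mult.commute flip: e_mod_mult_nat)
  ultimately have "(\<Sum>n<p. z ^ n) = 0" by (simp add: sum_gp_strict)
  then show ?thesis using False by (simp add: e_mod_mult_nat z_def)
qed

lemma sum_periodic_mult:
  fixes h :: "int \<Rightarrow> 'a::comm_monoid_add"
  assumes p: "prime p" and per: "\<And>x y. [x = y] (mod int p) \<Longrightarrow> h x = h y" and n: "\<not> int p dvd n"
  shows "(\<Sum>x\<in>{0..<int p}. h (x * n)) = (\<Sum>x\<in>{0..<int p}. h x)"
proof -
  let ?X = "{0..<int p}" and ?g = "\<lambda>x. (x * n) mod int p"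
  have p0: "int p > 0" using prime_gt_0_nat[OF p] by simp
  have inj: "inj_on ?g ?X"
  proof (rule inj_onI)
    fix x y assume xy: "x \<in> ?X" "y \<in> ?X" "?g x = ?g y"
    then have "int p dvd (x - y) * n" by (simp add: mod_eq_dvd_iff left_diff_distrib)
    then have "int p dvd x - y" using n p by (simp add: prime_dvd_mult_iff)
    then show "x = y" using xy incongruent_residue by blast
  qed
  moreover have "?g ` ?X \<subseteq> ?X" using p0 by auto
  ultimately have "?g ` ?X = ?X" by (intro endo_inj_surj) auto
  then have "(\<Sum>x\<in>?X. h x) = (\<Sum>x\<in>?X. h (?g x))"
    using sum.reindex[OF inj, of h] by simp
  also have "\<dots> = (\<Sum>x\<in>?X. h (x * n))" by (intro sum.cong refl per) (simp add: cong_def)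
  finally show ?thesis by simp
qed

lemma sum_residues_eq_nat: "(\<Sum>x\<in>{0..<int p}. h x) = (\<Sum>n<p. h (int n))"
  by (rule sum.reindex_bij_witness[of _ int nat]) auto

text \<open>This is \<open>1 - cis (2 * y) = -2 * \<i> * sin y * cis y\<close>, inverted. The
  constant real part matters: it will cancel against the sum of the character.\<close>

lemma two_over_one_minus_cis:
  assumes "cis (2 * y) \<noteq> 1"
  shows "2 / (1 - cis (2 * y)) = Complex 1 (cot y)"
proof -
  have sn: "sin y \<noteq> 0"
  proof
    assume "sin y = 0"
    then have "cis (2 * y) = 1" by (simp add: complex_eq_iff sin_double cos_double_sin)
    with assms show False by blast
  qed
  have 1: "cot y * sin (2 * y) = 2 * (cos y)\<^sup>2"
    using sn by (simp add: sin_double cot_def power2_eq_square)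
  have 2: "cot y * (1 - cos (2 * y)) = sin (2 * y)"
    using sn by (simp add: sin_double cos_double_sin cot_def power2_eq_square)
  have "Complex 1 (cot y) * (1 - cis (2 * y)) = 2"
  proof (rule complex_eqI)
    have "Re (Complex 1 (cot y) * (1 - cis (2 * y))) = (1 - cos (2 * y)) + cot y * sin (2 * y)" by simp
    also have "\<dots> = 2" using 1 cos_double_sin[of y] sin_cos_squared_add[of y] by linarith
    finally show "Re (Complex 1 (cot y) * (1 - cis (2 * y))) = Re 2" by simp
    have "Im (Complex 1 (cot y) * (1 - cis (2 * y))) = cot y * (1 - cos (2 * y)) - sin (2 * y)" by simp
    then show "Im (Complex 1 (cot y) * (1 - cis (2 * y))) = Im 2" unfolding 2 by simp
  qed
  moreover have "1 - cis (2 * y) \<noteq> 0" using assms by (metis eq_iff_diff_eq_0)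
  ultimately show ?thesis by (metis nonzero_divide_eq_eq)
qed

section \<open>Gauss sums and the values at midpoints\<close>

context character_sums
begin

text \<open>The conjugate is used so that twisting by \<open>n\<close> reproduces
  \<open>chi n\<close> itself.\<close>

definition gauss :: complex where
  "gauss = (\<Sum>k\<in>{0..<int p}. cnj (chi k) * e_mod p (real_of_int k))"

lemma p0: "p > 0" using p by (rule prime_gt_0_nat)

lemma chi_cong: "[x = y] (mod int p) \<Longrightarrow> chi x = chi y"
  by (rule dirichlet_character_cong[OF chi])

lemma chi_norm: "\<not> int p dvd a \<Longrightarrow> norm (chi a) = 1"
  by (rule norm_dirichlet_character[OF chi p])

lemma chi_dvd: "int p dvd a \<Longrightarrow> chi a = 0"
  using dirichlet_character_eq_0_iff[OF chi p] by simp

lemma sum_cnj_chi: "(\<Sum>k\<in>{0..<int p}. cnj (chi k)) = 0"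
proof -
  obtain a where a: "\<not> int p dvd a" "chi a ^ 1 \<noteq> 1"
    using ord d2 unfolding exact_order_def by (metis One_nat_def Suc_1 Suc_le_lessD zero_less_one)
  have "(\<Sum>k\<in>{0..<int p}. cnj (chi (k * a))) = (\<Sum>k\<in>{0..<int p}. cnj (chi k))"
    using a(1) by (intro sum_periodic_mult[OF p]) (simp_all add: chi_cong)
  then have "(\<Sum>k\<in>{0..<int p}. cnj (chi k)) * (cnj (chi a) - 1) = 0"
    by (simp add: dirichlet_character_mult[OF chi] right_diff_distrib flip: sum_distrib_right)
  moreover have "cnj (chi a) \<noteq> 1" using a(2) by (metis complex_cnj_cnj complex_cnj_one power_one_right)
  ultimately show ?thesis by simp
qed

lemma gauss_twist:
  "(\<Sum>k\<in>{0..<int p}. cnj (chi k) * e_mod p (real_of_int (k * n))) = chi n * gauss"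
proof (cases "int p dvd n")
  case True
  then obtain l where l: "n = int p * l" by (auto elim: dvdE)
  have "e_mod p (real_of_int (k * n)) = 1" for k
    using e_mod_multiple[OF p0, of "k * l"] by (simp add: l mult_ac)
  then show ?thesis using True sum_cnj_chi chi_dvd by simp
next
  case False
  let ?h = "\<lambda>k. cnj (chi k) * e_mod p (real_of_int k)"
  have "(\<Sum>k\<in>{0..<int p}. ?h (k * n)) = gauss"
    unfolding gauss_def
  proof (rule sum_periodic_mult[OF p _ False])
    fix x y assume "[x = y] (mod int p)"
    then show "?h x = ?h y" using chi_cong e_mod_cong[OF p0, of x y 0] by simp
  qed
  moreover have "?h (k * n) = cnj (chi n) * (cnj (chi k) * e_mod p (real_of_int (k * n)))" for k
    by (simp add: dirichlet_character_mult[OF chi])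
  ultimately have "gauss = cnj (chi n) * (\<Sum>k\<in>{0..<int p}. cnj (chi k) * e_mod p (real_of_int (k * n)))"
    by (simp only: sum_distrib_left)
  moreover have "chi n * cnj (chi n) = 1" using chi_norm[OF False] by (simp add: complex_norm_square[symmetric])
  ultimately show ?thesis by (simp flip: mult.assoc)
qed

lemma norm_chi_squared_sum: "(\<Sum>k\<in>{0..<int p}. chi k * cnj (chi k)) = of_nat (p - 1)"
proof -
  have "chi k * cnj (chi k) = (if k = 0 then 0 else 1)" if "k \<in> {0..<int p}" for k
  proof (cases "k = 0")
    case False
    then have "\<not> int p dvd k" using that by (auto dest: zdvd_imp_le)
    then show ?thesis using False chi_norm by (simp add: complex_norm_square[symmetric])
  qed (simp add: chi_dvd)
  then have "(\<Sum>k\<in>{0..<int p}. chi k * cnj (chi k)) = (\<Sum>k\<in>{0..<int p}. if k = 0 then 0 else 1)"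
    by (intro sum.cong refl) auto
  also have "\<dots> = (\<Sum>k\<in>{0..<int p} - {0}. 1)" using p0 by (intro sum.mono_neutral_cong_right) auto
  also have "\<dots> = of_nat (p - 1)" using p0 by (simp add: card_Diff_singleton_if)
  finally show ?thesis .
qed

text \<open>Parseval: the squares of \<open>norm (chi n * gauss)\<close> are summed over
  \<open>n\<close> in two ways, and the common factor \<open>p - 1\<close> is cancelled.\<close>

lemma norm_gauss: "norm gauss = sqrt (real p)"
proof -
  let ?X = "{0..<int p}"
  have "of_nat (p - 1) * (gauss * cnj gauss) = (\<Sum>n\<in>?X. (chi n * gauss) * cnj (chi n * gauss))"
    unfolding norm_chi_squared_sum[symmetric] sum_distrib_right
    by (intro sum.cong refl) (simp add: mult_ac)
  also have "\<dots> = (\<Sum>n\<in>?X. \<Sum>k\<in>?X. \<Sum>l\<in>?X. (cnj (chi k) * chi l) * e_mod p (real_of_int (k - l) * real_of_int n))"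
  proof (intro sum.cong refl)
    fix n
    have e: "e_mod p (real_of_int (k - l) * real_of_int n) = e_mod p (real_of_int (k * n)) * e_mod p (- real_of_int (l * n))" for k l
      unfolding e_mod_add[symmetric] by (simp add: algebra_simps)
    have "(cnj (chi k) * e_mod p (real_of_int (k * n))) * cnj (cnj (chi l) * e_mod p (real_of_int (l * n)))
      = (cnj (chi k) * chi l) * e_mod p (real_of_int (k - l) * real_of_int n)" for k l
      unfolding e by (simp only: complex_cnj_mult complex_cnj_cnj cnj_e_mod mult_ac)
    then show "(chi n * gauss) * cnj (chi n * gauss) = (\<Sum>k\<in>?X. \<Sum>l\<in>?X. (cnj (chi k) * chi l) * e_mod p (real_of_int (k - l) * real_of_int n))"
      unfolding gauss_twist[symmetric] cnj_sum sum_product by (simp only:)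
  qed
  also have "\<dots> = (\<Sum>k\<in>?X. \<Sum>l\<in>?X. (cnj (chi k) * chi l) * (\<Sum>n\<in>?X. e_mod p (real_of_int (k - l) * real_of_int n)))"
    unfolding sum_distrib_left by (subst sum.swap, subst (2) sum.swap) (rule refl)
  also have "\<dots> = (\<Sum>k\<in>?X. \<Sum>l\<in>?X. if k = l then of_nat p * (chi k * cnj (chi k)) else 0)"
  proof (intro sum.cong refl)
    fix k l assume "k \<in> ?X" "l \<in> ?X"
    then have "int p dvd k - l \<longleftrightarrow> k = l" using incongruent_residue by auto
    then show "(cnj (chi k) * chi l) * (\<Sum>n\<in>?X. e_mod p (real_of_int (k - l) * real_of_int n))
      = (if k = l then of_nat p * (chi k * cnj (chi k)) else 0)"
      unfolding sum_residues_eq_nat of_int_of_nat_eq sum_e_mod[OF p0] by simp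
  qed
  also have "\<dots> = of_nat p * of_nat (p - 1)"
    by (simp add: norm_chi_squared_sum flip: sum_distrib_left)
  finally have "of_nat (p - 1) * (gauss * cnj gauss) = of_nat (p - 1) * of_nat p" by (simp only: mult.commute)
  moreover have "(of_nat (p - 1) :: complex) \<noteq> 0" using prime_gt_1_nat[OF p] by simp
  ultimately have "gauss * cnj gauss = of_nat p" using mult_left_cancel by blast
  then have "complex_of_real ((norm gauss)\<^sup>2) = complex_of_real (real p)" by (simp only: complex_norm_square of_real_of_nat_eq)
  then have "(norm gauss)\<^sup>2 = real p" by (simp only: of_real_eq_iff)
  then show ?thesis by (metis norm_ge_zero real_sqrt_unique)
qed

text \<open>Written through the exponential so that periodicity modulo \<open>p\<close> is
  immediate; the cotangent form is \<open>arc_weight_cot\<close>.\<close>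

definition arc_weight :: "int \<Rightarrow> real" where
  "arc_weight i = Im (2 / (1 - e_mod p (real_of_int i + 1 / 2))) / real p"

lemma arc_weight_cong: "[i = j] (mod int p) \<Longrightarrow> arc_weight i = arc_weight j"
  unfolding arc_weight_def by (simp only: e_mod_cong[OF p0, of i j])

text \<open>At midpoints the \<open>p\<close>-th power is \<open>-1\<close> for every
  \<open>i\<close>, so all geometric sums have the same numerator 2 and no denominator
  vanishes.\<close>

lemma half_e_mod_power: "e_mod p (real_of_int i + 1 / 2) ^ p = - 1"
proof -
  have "e_mod p (real_of_int i + 1 / 2) ^ p = e_mod p (real_of_int (int p * i) + real p / 2)"
    by (simp add: algebra_simps flip: e_mod_mult_nat)
  also have "\<dots> = e_mod p (real p / 2)" by (simp only: e_mod_add e_mod_multiple[OF p0] mult_1_left)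
  also have "\<dots> = - 1" using p0 by (simp add: e_mod_cis)
  finally show ?thesis .
qed

lemma half_e_mod_neq_1: "e_mod p (real_of_int i + 1 / 2) \<noteq> 1"
proof
  assume "e_mod p (real_of_int i + 1 / 2) = 1"
  then show False using half_e_mod_power[of i] by simp
qed

lemma half_e_mod_quotient:
  "2 / (1 - e_mod p (real_of_int i + 1 / 2)) = Complex 1 (cot (pi * (real_of_int i + 1 / 2) / real p))"
  using two_over_one_minus_cis[of "pi * (real_of_int i + 1 / 2) / real p"] half_e_mod_neq_1[of i]
  by (simp add: e_mod_cis mult.assoc)

lemma arc_weight_cot: "arc_weight i = cot (pi * (real_of_int i + 1 / 2) / real p) / real p"
  unfolding arc_weight_def half_e_mod_quotient by simp

lemma half_e_mod_quotient':
  "2 / (1 - e_mod p (real_of_int i + 1 / 2)) = 1 + \<i> * of_real (real p * arc_weight i)"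
  unfolding half_e_mod_quotient arc_weight_cot using p0 by (simp add: complex_eq_iff)

lemma sum_half_e_mod: "(\<Sum>n<p. e_mod p (real_of_int i + 1 / 2) ^ n) = 1 + \<i> * of_real (real p * arc_weight i)"
proof -
  let ?u = "e_mod p (real_of_int i + 1 / 2)"
  have "(\<Sum>n<p. ?u ^ n) = 2 / (1 - ?u)"
    using half_e_mod_neq_1[of i] half_e_mod_power[of i] by (simp add: sum_gp_strict)
  then show ?thesis by (simp only: half_e_mod_quotient')
qed

lemma fekete_half:
  "norm (fekete p chi (e_mod p (real K + 1 / 2)) / of_real (sqrt (real p)))
    = norm (\<Sum>k\<in>{0..<int p}. of_real (arc_weight (k + int K)) * chi k)"
proof -
  let ?X = "{0..<int p}" and ?z = "e_mod p (real K + 1 / 2)"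
  let ?W = "\<lambda>k. arc_weight (k + int K)"
  have "gauss * fekete p chi ?z = (\<Sum>n<p. (chi (int n) * gauss) * ?z ^ n)"
    by (simp add: fekete_def sum_distrib_left algebra_simps)
  also have "\<dots> = (\<Sum>n<p. \<Sum>k\<in>?X. cnj (chi k) * e_mod p (real_of_int (k + int K) + 1 / 2) ^ n)"
  proof (intro sum.cong refl)
    fix n
    have "e_mod p (real_of_int (k * int n)) * ?z ^ n = e_mod p (real_of_int (k + int K) + 1 / 2) ^ n" for k
      unfolding e_mod_mult_nat[symmetric] e_mod_add[symmetric] by (simp add: algebra_simps)
    then show "(chi (int n) * gauss) * ?z ^ n = (\<Sum>k\<in>?X. cnj (chi k) * e_mod p (real_of_int (k + int K) + 1 / 2) ^ n)"
      unfolding gauss_twist[symmetric] sum_distrib_right by (simp add: mult.assoc)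
  qed
  also have "\<dots> = (\<Sum>k\<in>?X. cnj (chi k) * (1 + \<i> * of_real (real p * ?W k)))"
    by (subst sum.swap) (simp only: sum_distrib_left[symmetric] sum_half_e_mod)
  \<comment> \<open>The real parts of the geometric sums are all 1 and drop out by
    \<open>sum_cnj_chi\<close>; only the imaginary parts remain.\<close>
  also have "\<dots> = (\<Sum>k\<in>?X. cnj (chi k)) + (\<Sum>k\<in>?X. cnj (chi k) * (\<i> * of_real (real p * ?W k)))"
    by (simp add: distrib_left sum.distrib)
  also have "\<dots> = \<i> * of_nat p * cnj (\<Sum>k\<in>?X. of_real (?W k) * chi k)"
    by (simp add: sum_cnj_chi sum_distrib_left mult_ac)
  finally have "norm (gauss * fekete p chi ?z) = norm (\<i> * of_nat p * cnj (\<Sum>k\<in>?X. of_real (?W k) * chi k))" by simp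
  then have "sqrt (real p) * norm (fekete p chi ?z) = real p * norm (\<Sum>k\<in>?X. of_real (?W k) * chi k)"
    by (simp add: norm_mult norm_gauss del: cnj_sum)
  also have "real p = sqrt (real p) * sqrt (real p)" by simp
  finally have "norm (fekete p chi ?z) = sqrt (real p) * norm (\<Sum>k\<in>?X. of_real (?W k) * chi k)"
    using p0 by (simp only: mult.assoc) simp
  then show ?thesis using p0 by (simp add: norm_divide)
qed

lemma sum_periodic_window:
  fixes f :: "int \<Rightarrow> complex"
  assumes "\<And>x y. [x = y] (mod int p) \<Longrightarrow> f x = f y"
  shows "(\<Sum>x\<in>{0..<int p}. f x) = (\<Sum>x\<in>{t..<t + int p}. f x)"
proof -
  have "(\<Sum>x\<in>{t..<t + int p}. f x) = (\<Sum>x\<in>{0..<int p}. f (x + t))"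
    by (rule sum.reindex_bij_witness[of _ "\<lambda>x. x + t" "\<lambda>x. x - t"]) auto
  also have "\<dots> = (\<Sum>x\<in>{0..<int p}. f x)" by (rule sum_periodic_shift[OF p0]) (rule assms)
  finally show ?thesis by simp
qed

text \<open>The substitution \<open>k = i - K\<close> turns \<open>chi k\<close> into
  \<open>chi (-1) * chi (K - i)\<close>, and the first factor has modulus 1. By periodicity the
  window may start anywhere; later it is centred at the arc, so that the weights decay away from
  it.\<close>

lemma arc_max_ge:
  "arc_max p chi K \<ge> norm (\<Sum>i\<in>{t..<t + int p}. of_real (arc_weight i) * chi (int K - i))"
proof -
  let ?X = "{0..<int p}"
  let ?h = "\<lambda>k. of_real (arc_weight (k + int K)) * chi k"
  let ?f = "\<lambda>i. of_real (arc_weight i) * chi (int K - i)"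
  have "(\<Sum>k\<in>?X. ?h k) = (\<Sum>k\<in>?X. ?h (k + (- int K)))"
  proof (rule sum_periodic_shift[OF p0, symmetric])
    fix x y assume xy: "[x = y] (mod int p)"
    then have "[x + int K = y + int K] (mod int p)" by (intro cong_add cong_refl)
    then show "?h x = ?h y" by (simp only: arc_weight_cong[of "x + int K" "y + int K"] chi_cong[OF xy])
  qed
  also have "\<dots> = (\<Sum>k\<in>?X. chi (-1) * ?f k)"
    by (intro sum.cong refl) (simp add: dirichlet_character_mult[OF chi, symmetric])
  also have "\<dots> = chi (-1) * (\<Sum>i\<in>?X. ?f i)" by (simp only: sum_distrib_left)
  also have "(\<Sum>i\<in>?X. ?f i) = (\<Sum>i\<in>{t..<t + int p}. ?f i)"
  proof (rule sum_periodic_window)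
    fix x y assume xy: "[x = y] (mod int p)"
    then have "[int K - x = int K - y] (mod int p)" by (intro cong_diff cong_refl)
    then show "?f x = ?f y" by (simp only: arc_weight_cong[OF xy] chi_cong[of "int K - x" "int K - y"])
  qed
  finally have "norm (\<Sum>k\<in>?X. ?h k) = norm (chi (-1)) * norm (\<Sum>i\<in>{t..<t + int p}. ?f i)"
    by (simp only: norm_mult)
  moreover have "norm (chi (-1)) = 1" using prime_gt_1_nat[OF p] by (intro chi_norm) simp
  moreover have "norm (fekete p chi (e_mod p (real K + 1 / 2)) / of_real (sqrt (real p))) \<le> arc_max p chi K"
    using arc_max_attained[of p chi K] by (elim bexE conjE ballE[of _ _ "1/2"]) auto
  ultimately show ?thesis unfolding fekete_half by simp
qed

end

section \<open>Size of the weights\<close>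

lemma cot_bounds:
  fixes y :: real
  assumes "0 < y" "y \<le> pi / 2"
  shows "0 \<le> cot y" "cot y \<le> 1 / y"
proof -
  have s: "sin y > 0" using assms by (intro sin_gt_zero) auto
  have c: "cos y \<ge> 0" using assms by (intro cos_ge_zero) auto
  show "0 \<le> cot y" using s c by (simp add: cot_def)
  show "cot y \<le> 1 / y"
  proof (cases "y = pi / 2")
    case True
    then have "cos y = 0" by (simp only: cos_pi_half)
    then show ?thesis using assms(1) by (simp add: cot_def)
  next
    case False
    then have lt: "y < pi / 2" using assms by simp
    then have cp: "cos y > 0" using assms by (intro cos_gt_zero) auto
    have "y \<le> \<bar>tan y\<bar>" using abs_tan_ge[of y] assms lt by simp
    then have "y \<le> sin y / cos y" using s cp by (simp add: tan_def)
    then have "y * cos y \<le> sin y" using cp by (simp add: pos_le_divide_eq)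
    then show ?thesis using s assms(1) by (simp add: cot_def field_simps)
  qed
qed

text \<open>From \<open>cos y \<ge> 1 - y\<^sup>2 / 2\<close>, by the half-angle formula, and
  \<open>sin y \<le> y\<close>.\<close>

lemma cot_ge:
  fixes y :: real
  assumes "0 < y" "y \<le> pi / 2"
  shows "cot y \<ge> 1 / y - y / 2"
proof -
  have s: "sin y > 0" using assms by (intro sin_gt_zero) auto
  have c: "cos y \<ge> 0" using assms by (intro cos_ge_zero) auto
  have "cos y = 1 - 2 * (sin (y / 2))\<^sup>2" using cos_double_sin[of "y / 2"] by simp
  moreover have "(sin (y / 2))\<^sup>2 \<le> (y / 2)\<^sup>2"
    using abs_sin_x_le_abs_x[of "y / 2"] by (metis abs_le_square_iff)
  ultimately have cos: "1 - y\<^sup>2 / 2 \<le> cos y" by (simp add: power_divide)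
  have "1 / y - y / 2 = (1 - y\<^sup>2 / 2) / y" using assms(1) by (simp add: field_simps power2_eq_square)
  also have "\<dots> \<le> cos y / y" using cos assms(1) by (intro divide_right_mono) auto
  also have "\<dots> \<le> cos y / sin y"
    using s c assms(1) sin_x_le_x[of y] by (intro divide_left_mono) auto
  finally show ?thesis by (simp add: cot_def)
qed

lemma sum_inverse_squares_le: "(\<Sum>n<N. 1 / (real n + 1)\<^sup>2) \<le> 2"
proof (cases N)
  case (Suc M)
  have "(\<Sum>n<Suc M. 1 / (real n + 1)\<^sup>2) \<le> 2 - 1 / (real M + 1)"
  proof (induction M)
    case (Suc M)
    have "1 / (real M + 2)\<^sup>2 \<le> 1 / ((real M + 1) * (real M + 2))"
      unfolding power2_eq_square by (intro divide_left_mono mult_right_mono) auto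
    also have "\<dots> = 1 / (real M + 1) - 1 / (real M + 2)" by (simp add: divide_simps)
    finally show ?case using Suc.IH by (simp add: add.commute)
  qed simp
  moreover have "1 / (real M + 1) \<ge> 0" by simp
  ultimately show ?thesis unfolding Suc by linarith
qed simp

lemma sum_symmetric_window:
  fixes g :: "int \<Rightarrow> 'a::comm_monoid_add"
  shows "(\<Sum>i\<in>{- int h..<int k}. g i) = (\<Sum>n<k. g (int n)) + (\<Sum>n<h. g (- 1 - int n))"
proof -
  have "{- int h..<int k} = {0..<int k} \<union> {- int h..<0}" by auto
  then have "(\<Sum>i\<in>{- int h..<int k}. g i) = (\<Sum>i\<in>{0..<int k}. g i) + (\<Sum>i\<in>{- int h..<0}. g i)"
    by (simp add: sum.union_disjoint)
  also have "(\<Sum>i\<in>{0..<int k}. g i) = (\<Sum>n<k. g (int n))" by (rule sum_residues_eq_nat)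
  also have "(\<Sum>i\<in>{- int h..<0}. g i) = (\<Sum>n<h. g (- 1 - int n))"
    by (rule sum.reindex_bij_witness[of _ "\<lambda>n. - 1 - int n" "\<lambda>i. nat (- 1 - i)"]) auto
  finally show ?thesis .
qed

section \<open>The opposite root of unity and its distance from 1\<close>

lemma delta_pos: "d \<ge> 3 \<Longrightarrow> delta d > 0"
  unfolding delta_def by (simp, rule cos_gt_zero) (auto simp: field_simps)

lemma delta_le: "delta d \<le> 2"
  unfolding delta_def by simp

text \<open>This is \<open>exp (2 * pi * \<i> * k / d)\<close> with \<open>k = (d - 1) / 2\<close>,
  an integer for odd \<open>d\<close>. Its distance from 1 is the source of
  \<open>delta d\<close>.\<close>

definition opp_root :: "nat \<Rightarrow> complex" where
  "opp_root d = cis (pi - pi / real d)"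

lemma opp_root_power:
  assumes "odd d"
  shows "opp_root d ^ d = 1"
proof -
  have d0: "d > 0" using assms by (rule odd_pos)
  obtain k where k: "d = 2 * k + 1" using assms by (auto elim: oddE)
  have "real d * (pi - pi / real d) = 2 * pi * real k"
    using d0 by (simp add: right_diff_distrib) (simp add: k algebra_simps)
  then show ?thesis unfolding opp_root_def Complex.DeMoivre by (simp add: cis_multiple_2pi)
qed

lemma norm_one_minus_opp_root:
  assumes "d \<ge> 3"
  shows "norm (1 - opp_root d) = delta d"
proof -
  let ?t = "pi / real d"
  have "(norm (1 - opp_root d))\<^sup>2 = (1 + cos ?t)\<^sup>2 + (sin ?t)\<^sup>2"
    unfolding opp_root_def cmod_power2 by simp
  also have "\<dots> = 2 + 2 * cos ?t" using sin_cos_squared_add[of ?t] by (simp add: power2_eq_square algebra_simps)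
  also have "cos ?t = 2 * (cos (?t / 2))\<^sup>2 - 1" using cos_double_cos[of "?t / 2"] by simp
  finally have "(norm (1 - opp_root d))\<^sup>2 = (delta d)\<^sup>2"
    by (simp add: delta_def power2_eq_square field_simps)
  then show ?thesis using delta_pos[OF assms] by (metis norm_ge_zero less_imp_le power2_eq_iff_nonneg)
qed

section \<open>Sums of the weights and the bound for \<open>Phi\<close>\<close>

context character_sums
begin

text \<open>Half-integers are traded for \<open>n + 1\<close> to match harmonic sums. The upper
  bound serves only the tail and may lose the factor \<open>1 / pi\<close>; the lower bound feeds
  the main term and keeps it.\<close>

lemma arc_weight_bounds:
  assumes "2 * n + 1 \<le> p"
  shows "0 \<le> arc_weight (int n)" "arc_weight (int n) \<le> 1 / (real n + 1)"
    "arc_weight (int n) \<ge> 1 / (pi * (real n + 1)) - 2 * (real n + 1) / (real p)\<^sup>2"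
proof -
  define y where "y = pi * (real n + 1 / 2) / real p"
  have "real (2 * n + 1) \<le> real p" using assms by (simp only: of_nat_le_iff)
  then have "(real n + 1 / 2) / real p \<le> 1 / 2" using p0 by (simp add: pos_divide_le_eq)
  then have "pi * ((real n + 1 / 2) / real p) \<le> pi * (1 / 2)" by (intro mult_left_mono) auto
  then have y: "0 < y" "y \<le> pi / 2" using p0 by (simp_all add: y_def)
  have W: "arc_weight (int n) = cot y / real p" by (simp add: arc_weight_cot y_def)
  show "0 \<le> arc_weight (int n)" unfolding W using cot_bounds[OF y] by simp
  have "cot y / real p \<le> (1 / y) / real p" using cot_bounds[OF y] by (intro divide_right_mono) auto
  also have yp: "(1 / y) / real p = 1 / (pi * (real n + 1 / 2))" using p0 by (simp add: y_def)
  also have "\<dots> \<le> 1 / (real n + 1)"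
  proof (rule divide_left_mono)
    have "real n + 1 \<le> 2 * (real n + 1 / 2)" by simp
    also have "\<dots> \<le> pi * (real n + 1 / 2)" using pi_ge_two by (intro mult_right_mono) auto
    finally show "real n + 1 \<le> pi * (real n + 1 / 2)" .
  qed auto
  finally show "arc_weight (int n) \<le> 1 / (real n + 1)" unfolding W .
  have "1 / (pi * (real n + 1)) \<le> (1 / y) / real p"
    unfolding yp by (intro divide_left_mono mult_left_mono) auto
  moreover have "(y / 2) / real p \<le> 2 * (real n + 1) / (real p)\<^sup>2"
  proof -
    have "(y / 2) / real p = (pi / 2) * (real n + 1 / 2) / (real p)\<^sup>2"
      by (simp add: y_def power2_eq_square)
    also have "\<dots> \<le> 2 * (real n + 1) / (real p)\<^sup>2"
      using pi_less_4 by (intro divide_right_mono mult_mono) auto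
    finally show ?thesis .
  qed
  moreover have "(1 / y - y / 2) / real p \<le> cot y / real p"
    using cot_ge[OF y] by (intro divide_right_mono) auto
  ultimately show "arc_weight (int n) \<ge> 1 / (pi * (real n + 1)) - 2 * (real n + 1) / (real p)\<^sup>2"
    unfolding W by (simp add: diff_divide_distrib)
qed

text \<open>The cotangent is odd about the midpoint. The two halves of the window therefore have
  opposite signs, and the pattern with value 1 on one half and \<open>opp_root d\<close> on the
  other produces the factor \<open>1 - opp_root d\<close>.\<close>

lemma arc_weight_reflect: "arc_weight (- 1 - i) = - arc_weight i"
proof -
  have "real_of_int (- 1 - i) + 1 / 2 = - (real_of_int i + 1 / 2)" by simp
  then have "pi * (real_of_int (- 1 - i) + 1 / 2) / real p = - (pi * (real_of_int i + 1 / 2) / real p)"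
    by (simp only: mult_minus_right minus_divide_left)
  then show ?thesis unfolding arc_weight_cot by (simp only: cot_minus)
qed

lemma sum_arc_weight_squares:
  assumes "p = 2 * h + 1"
  shows "(\<Sum>i\<in>{- int h..<int (h + 1)}. (arc_weight i)\<^sup>2) \<le> 4"
proof -
  have le: "(\<Sum>n<k. (arc_weight (int n))\<^sup>2) \<le> 2" if "k \<le> h + 1" for k
  proof -
    have "(\<Sum>n<k. (arc_weight (int n))\<^sup>2) \<le> (\<Sum>n<k. 1 / (real n + 1)\<^sup>2)"
    proof (intro sum_mono)
      fix n assume "n \<in> {..<k}"
      then have "2 * n + 1 \<le> p" using that assms by auto
      then have "(arc_weight (int n))\<^sup>2 \<le> (1 / (real n + 1))\<^sup>2"
        using arc_weight_bounds by (intro power_mono) auto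
      then show "(arc_weight (int n))\<^sup>2 \<le> 1 / (real n + 1)\<^sup>2" by (simp add: power_divide)
    qed
    also have "\<dots> \<le> 2" by (rule sum_inverse_squares_le)
    finally show ?thesis .
  qed
  have "(\<Sum>n<h + 1. (arc_weight (int n))\<^sup>2) \<le> 2" "(\<Sum>n<h. (arc_weight (int n))\<^sup>2) \<le> 2"
    by (rule le, simp)+
  then show ?thesis unfolding sum_symmetric_window arc_weight_reflect power2_minus by linarith
qed

lemma sum_abs_arc_weight:
  assumes "p = 2 * h + 1"
  shows "(\<Sum>i\<in>{- int h..<int (h + 1)}. \<bar>arc_weight i\<bar>) \<le> 2 * (1 + ln (real p))"
proof -
  have le: "(\<Sum>n<k. \<bar>arc_weight (int n)\<bar>) \<le> 1 + ln (real p)" if "k \<le> h + 1" for k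
  proof (cases "k = 0")
    case True
    then show ?thesis using assms by simp
  next
    case False
    have "(\<Sum>n<k. \<bar>arc_weight (int n)\<bar>) \<le> (\<Sum>n<k. 1 / (real n + 1))"
    proof (intro sum_mono)
      fix n assume "n \<in> {..<k}"
      then have "2 * n + 1 \<le> p" using that assms by auto
      then show "\<bar>arc_weight (int n)\<bar> \<le> 1 / (real n + 1)" using arc_weight_bounds by simp
    qed
    also have "\<dots> = harm k"
      unfolding harm_def by (rule sum.reindex_bij_witness[of _ "\<lambda>n. n - 1" Suc]) (auto simp: inverse_eq_divide)
    also have "\<dots> \<le> 1 + ln (real k)"
      using euler_mascheroni_sequence_decreasing[of 1 k] False by (simp add: harm_def)
    also have "\<dots> \<le> 1 + ln (real p)" using False that assms by simp
    finally show ?thesis .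
  qed
  have "(\<Sum>n<h + 1. \<bar>arc_weight (int n)\<bar>) \<le> 1 + ln (real p)" "(\<Sum>n<h. \<bar>arc_weight (int n)\<bar>) \<le> 1 + ln (real p)"
    by (rule le, simp)+
  then have "(\<Sum>n<h + 1. \<bar>arc_weight (int n)\<bar>) + (\<Sum>n<h. \<bar>arc_weight (int n)\<bar>) \<le> (1 + ln (real p)) + (1 + ln (real p))"
    by (rule add_mono)
  also have "\<dots> = 2 * (1 + ln (real p))" by simp
  finally show ?thesis unfolding sum_symmetric_window arc_weight_reflect abs_minus_cancel .
qed

lemma sum_main_weights:
  assumes "8 * N \<le> p"
  shows "(\<Sum>n<N. arc_weight (int n)) \<ge> ln (real N + 1) / pi - 1 / 8"
proof -
  have "(\<Sum>n<N. arc_weight (int n)) \<ge> (\<Sum>n<N. 1 / (pi * (real n + 1)) - 2 * real N / (real p)\<^sup>2)"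
  proof (intro sum_mono)
    fix n assume n: "n \<in> {..<N}"
    then have "2 * n + 1 \<le> p" using assms by auto
    then have "arc_weight (int n) \<ge> 1 / (pi * (real n + 1)) - 2 * (real n + 1) / (real p)\<^sup>2"
      by (rule arc_weight_bounds)
    moreover have "2 * (real n + 1) / (real p)\<^sup>2 \<le> 2 * real N / (real p)\<^sup>2"
      using n by (intro divide_right_mono) auto
    ultimately show "1 / (pi * (real n + 1)) - 2 * real N / (real p)\<^sup>2 \<le> arc_weight (int n)" by linarith
  qed
  also have "(\<Sum>n<N. 1 / (pi * (real n + 1)) - 2 * real N / (real p)\<^sup>2)
    = (\<Sum>n<N. 1 / (real n + 1)) / pi - real N * (2 * real N / (real p)\<^sup>2)"
    by (simp add: sum_subtractf sum_divide_distrib mult.commute)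
  also have "(\<Sum>n<N. 1 / (real n + 1)) = harm N"
    unfolding harm_def by (rule sum.reindex_bij_witness[of _ "\<lambda>n. n - 1" Suc]) (auto simp: inverse_eq_divide)
  finally have "(\<Sum>n<N. arc_weight (int n)) \<ge> harm N / pi - real N * (2 * real N / (real p)\<^sup>2)" .
  moreover have "harm N / pi \<ge> ln (real N + 1) / pi" using ln_le_harm[of N] by (intro divide_right_mono) auto
  moreover have "real N * (2 * real N / (real p)\<^sup>2) \<le> 1 / 8"
  proof -
    have "real (8 * N) \<le> real p" using assms by (simp only: of_nat_le_iff)
    then have "(8 * real N)\<^sup>2 \<le> (real p)\<^sup>2" by (intro power_mono) auto
    then have "64 * (real N)\<^sup>2 \<le> (real p)\<^sup>2" by (simp add: power_mult_distrib)
    then have "16 * (real N)\<^sup>2 \<le> (real p)\<^sup>2" using zero_le_power2[of "real N"] by linarith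
    then show ?thesis using p0 by (simp add: field_simps power2_eq_square)
  qed
  ultimately show ?thesis by linarith
qed

text \<open>In the constant \<open>17 / 4\<close>, 4 is reserved for the tail and
  \<open>1 / 4\<close> covers \<open>delta d / 8\<close>, the error of the main weights.\<close>

lemma Phi_ge:
  assumes d: "d \<ge> 3" "odd d" and h: "p = 2 * h + 1" and N: "8 * N \<le> p" and m: "2 * N + 2 \<le> m"
    and V: "V + 17 / 4 \<le> delta d / pi * ln (real N + 1)"
    and small: "E * (1 + (1 + ln (real p))\<^sup>2) \<le> real p / (4 * real d ^ (2 * N))"
  shows "Phi p chi V \<ge> 1 / (4 * real d ^ (2 * N))"
proof -
  define J where "J = {- int N..<int N}"
  define I where "I = {- int h..<int (h + 1)} - J"
  define c where "c j = (if j \<ge> (0::int) then 1 else opp_root d)" for j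
  define P where "P = pattern_set p chi J c"
  define tail where "tail x = (\<Sum>i\<in>I. of_real (arc_weight i) * chi (x - i))" for x
  \<comment> \<open>The squared weights sum to at most 4, so threshold 4 leaves an exceptional
    proportion of at most \<open>4 / 16\<close>, apart from the error involving
    \<open>E\<close>.\<close>
  define G where "G = {x\<in>P. norm (tail x) \<le> 4}"
  have finJ: "finite J" and cardJ: "card J = 2 * N" and finI: "finite I" by (auto simp: J_def I_def)
  have Nh: "N \<le> h" using N h by simp
  have win: "I \<union> J = {- int h..<int (h + 1)}" "I \<inter> J = {}" using Nh by (auto simp: I_def J_def)
  have inc: "incongruent p (I \<union> J)"
    unfolding incongruent_def win(1)
  proof (intro ballI impI)
    fix i j assume ij: "i \<in> {- int h..<int (h + 1)}" "j \<in> {- int h..<int (h + 1)}" "int p dvd i - j"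
    show "i = j"
    proof (rule ccontr)
      assume "i \<noteq> j"
      then have "int p \<le> \<bar>i - j\<bar>" using ij(3) dvd_imp_le_int[of "i - j" "int p"] by simp
      then show False using ij(1,2) h by auto
    qed
  qed
  have c1: "c j ^ d = 1" for j using opp_root_power[OF d(2)] by (simp add: c_def)
  have E0: "E \<ge> 0" using m by (intro E_nonneg) simp
  have main: "norm (\<Sum>i\<in>J. of_real (arc_weight i) * chi (x - i)) \<ge> V + 4" if x: "x \<in> P" for x
  proof -
    have "(\<Sum>i\<in>J. of_real (arc_weight i) * chi (x - i)) = (\<Sum>i\<in>J. of_real (arc_weight i) * c i)"
      using x by (intro sum.cong refl) (auto simp: P_def pattern_set_def)
    also have "\<dots> = (\<Sum>n<N. of_real (arc_weight (int n))) - (\<Sum>n<N. of_real (arc_weight (int n))) * opp_root d"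
      unfolding J_def sum_symmetric_window arc_weight_reflect
      by (simp add: c_def sum_negf sum_distrib_right)
    also have "\<dots> = of_real (\<Sum>n<N. arc_weight (int n)) * (1 - opp_root d)" by (simp add: right_diff_distrib)
    finally have "norm (\<Sum>i\<in>J. of_real (arc_weight i) * chi (x - i)) = \<bar>\<Sum>n<N. arc_weight (int n)\<bar> * delta d"
      by (simp only: norm_mult norm_of_real norm_one_minus_opp_root[OF d(1)])
    also have "\<dots> \<ge> (\<Sum>n<N. arc_weight (int n)) * delta d"
      using delta_pos[OF d(1)] by (intro mult_right_mono) auto
    also have "(\<Sum>n<N. arc_weight (int n)) * delta d \<ge> (ln (real N + 1) / pi - 1 / 8) * delta d"
      using sum_main_weights[OF N] delta_pos[OF d(1)] by (intro mult_right_mono) auto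
    also have "(ln (real N + 1) / pi - 1 / 8) * delta d = delta d / pi * ln (real N + 1) - delta d / 8"
      by (simp add: algebra_simps)
    finally show ?thesis using V delta_le[of d] by linarith
  qed
  have arc: "arc_max p chi (nat x) \<ge> V" if x: "x \<in> G" for x
  proof -
    have x0: "x \<ge> 0" and xP: "x \<in> P" using x by (auto simp: G_def P_def pattern_set_def)
    have "{- int h..<- int h + int p} = I \<union> J" unfolding win(1) using h by auto
    then have "(\<Sum>i\<in>{- int h..<- int h + int p}. of_real (arc_weight i) * chi (int (nat x) - i))
      = tail x + (\<Sum>i\<in>J. of_real (arc_weight i) * chi (x - i))"
      using win(2) finI finJ x0 by (simp add: sum.union_disjoint tail_def)
    then have "arc_max p chi (nat x) \<ge> norm (tail x + (\<Sum>i\<in>J. of_real (arc_weight i) * chi (x - i)))"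
      using arc_max_ge[of "nat x" "- int h"] by simp
    moreover have "norm (tail x) \<le> 4" using x by (simp add: G_def)
    ultimately show ?thesis
      using main[OF xP] norm_diff_ineq[of "\<Sum>i\<in>J. of_real (arc_weight i) * chi (x - i)" "tail x"]
      by (simp add: add.commute)
  qed
  have "card G \<le> card {K\<in>{0..<p}. arc_max p chi K \<ge> V}"
  proof (rule card_inj_on_le)
    show "inj_on nat G" by (rule inj_onI) (auto simp: G_def P_def pattern_set_def)
    show "nat ` G \<subseteq> {K\<in>{0..<p}. arc_max p chi K \<ge> V}"
      using arc by (auto simp: G_def P_def pattern_set_def)
  qed auto
  then have "Phi p chi V \<ge> real (card G) / real p"
    unfolding Phi_def by (intro divide_right_mono) auto
  moreover have "real (card G) \<ge> real p / (4 * real d ^ (2 * N))"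
  proof -
    define D where "D = real d ^ (2 * N)"
    have D0: "D > 0" using d by (simp add: D_def)
    have subI: "I \<subseteq> {- int h..<int (h + 1)}" by (auto simp: I_def)
    have "(\<Sum>i\<in>I. (arc_weight i)\<^sup>2) \<le> (\<Sum>i\<in>{- int h..<int (h + 1)}. (arc_weight i)\<^sup>2)"
      by (rule sum_mono2) (use subI in auto)
    also have "\<dots> \<le> 4" by (rule sum_arc_weight_squares[OF h])
    finally have Q: "(\<Sum>i\<in>I. (arc_weight i)\<^sup>2) \<le> 4" .
    have "(\<Sum>i\<in>I. \<bar>arc_weight i\<bar>) \<le> (\<Sum>i\<in>{- int h..<int (h + 1)}. \<bar>arc_weight i\<bar>)"
      by (rule sum_mono2) (use subI in auto)
    also have "\<dots> \<le> 2 * (1 + ln (real p))" by (rule sum_abs_arc_weight[OF h])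
    finally have "(\<Sum>i\<in>I. \<bar>arc_weight i\<bar>)\<^sup>2 \<le> (2 * (1 + ln (real p)))\<^sup>2"
      by (intro power_mono) (auto intro: sum_nonneg)
    then have L: "(\<Sum>i\<in>I. \<bar>arc_weight i\<bar>)\<^sup>2 \<le> 4 * (1 + ln (real p))\<^sup>2" unfolding power_mult_distrib by simp
    have "real (card G) \<ge> real (card P) * (1 - (\<Sum>i\<in>I. (arc_weight i)\<^sup>2) / 4\<^sup>2) - E * (\<Sum>i\<in>I. \<bar>arc_weight i\<bar>)\<^sup>2 / 4\<^sup>2"
      unfolding G_def tail_def P_def
      by (rule card_pattern_set_small_tail) (use finJ finI win inc c1 m cardJ in auto)
    moreover have "real (card P) * (3 / 4) \<le> real (card P) * (1 - (\<Sum>i\<in>I. (arc_weight i)\<^sup>2) / 4\<^sup>2)"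
      using Q by (intro mult_left_mono) auto
    moreover have "E * (\<Sum>i\<in>I. \<bar>arc_weight i\<bar>)\<^sup>2 / 4\<^sup>2 \<le> E * (4 * (1 + ln (real p))\<^sup>2) / 4\<^sup>2"
      using L E0 by (intro divide_right_mono mult_left_mono) auto
    moreover have "real (card P) \<ge> (real p - real (2 * N)) / D - E"
      unfolding P_def D_def cardJ[symmetric]
      by (rule card_pattern_set_ge) (use finJ inc c1 m cardJ in \<open>auto simp: incongruent_def\<close>)
    moreover have "(real p - real (2 * N)) / D \<ge> (3 / 4 * real p) / D"
    proof (rule divide_right_mono)
      have "real (8 * N) \<le> real p" using N by (simp only: of_nat_le_iff)
      then show "3 / 4 * real p \<le> real p - real (2 * N)" by simp
    qed (use D0 in simp)
    \<comment> \<open>One factor \<open>3 / 4\<close> comes from Chebyshev, the other from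
      \<open>2 * N \<le> p / 4\<close>. By \<open>small\<close> the errors take at most
      \<open>3 / 16\<close> of \<open>p / D\<close>, which leaves more than the \<open>1 / 4\<close>
      required.\<close>
    ultimately have "real (card G) \<ge> 9 / 16 * (real p / D) - 3 / 4 * E - E * (1 + ln (real p))\<^sup>2 / 4" by simp
    moreover have "E * (1 + ln (real p))\<^sup>2 \<ge> 0" using E0 by simp
    moreover have "E + E * (1 + ln (real p))\<^sup>2 \<le> (real p / D) / 4" using small by (simp add: D_def algebra_simps)
    moreover have "real p / D \<ge> 0" using D0 by simp
    ultimately have "real (card G) \<ge> (real p / D) / 4" using E0 by argo
    then show ?thesis by (simp add: D_def)
  qed
  then have "real (card G) / real p \<ge> 1 / (4 * real d ^ (2 * N))"
    using p0 by (simp add: field_simps)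
  ultimately show ?thesis by linarith
qed

end

section \<open>The lower bound\<close>

text \<open>With \<open>x = p\<close>, the parameters \<open>d\<close> and \<open>2 ^ d\<close> are
  dominated by \<open>ln x\<close>. The last two conditions are the size requirement of Stepanov's
  method for \<open>K\<close> up to \<open>x powr (1/4)\<close>, and the statement that the saving
  beats \<open>x powr (1/8)\<close> times logarithms.\<close>

lemma eventually_large:
  fixes d :: nat
  shows "eventually (\<lambda>x::real. real d \<le> ln x \<and> 2 ^ d \<le> ln x \<and> ln (real d) \<le> (ln (ln x))\<^sup>2 \<and>
    1 \<le> ln (ln x) \<and> 16 \<le> x \<and> ln x \<le> x / 8 \<and> ln x / 8 + 2 \<le> ln x \<and> 2 \<le> x powr (1/4) \<and>
    (ln x)\<^sup>2 * (ln x * x powr (1/2) * ((ln x)^3 + 1) + 1 + (ln x)\<^sup>2) < x \<and>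
    (2 * x * ((ln x)^3 + 1) / x powr (1/4) + ln x) * (1 + (1 + ln x)\<^sup>2) * x powr (1/8) \<le> x / 4) at_top"
proof (intro eventually_conj)
  have l: "filterlim (\<lambda>x::real. ln x) at_top at_top" by real_asymp
  show "eventually (\<lambda>x::real. real d \<le> ln x) at_top" "eventually (\<lambda>x::real. 2 ^ d \<le> ln x) at_top"
    using l by (auto simp: filterlim_at_top)
  have "filterlim (\<lambda>x::real. (ln (ln x))\<^sup>2) at_top at_top" by real_asymp
  then show "eventually (\<lambda>x::real. ln (real d) \<le> (ln (ln x))\<^sup>2) at_top" by (auto simp: filterlim_at_top)
qed real_asymp+

theorem theorem6p2:
  fixes d :: nat
  assumes "d \<ge> 3" and "odd d"
  shows "\<exists>A::real. A > 0 \<and> (\<exists>p0::nat. \<forall>p\<ge>p0. prime p \<longrightarrow>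
    (\<forall>chi. dirichlet_character p chi \<and> character_order p chi = d \<longrightarrow>
      (\<forall>V::real. 1 \<le> V \<and>
         V \<le> delta d / pi * (ln (ln (real p)) - 2 * ln (ln (ln (real p)))) - 7 * sqrt (ln (real d)) \<longrightarrow>
         (\<exists>\<eta>::real. \<bar>\<eta>\<bar> \<le> A * exp (- pi * V / (2 * delta d)) \<and>
            Phi p chi V \<ge> exp (- C_minus d * exp (pi / delta d * V) * (1 + \<eta>))))))"
proof -
  obtain X0 where X0: "\<And>x::real. x \<ge> X0 \<Longrightarrow> real d \<le> ln x \<and> 2 ^ d \<le> ln x \<and> ln (real d) \<le> (ln (ln x))\<^sup>2 \<and>
    1 \<le> ln (ln x) \<and> 16 \<le> x \<and> ln x \<le> x / 8 \<and> ln x / 8 + 2 \<le> ln x \<and> 2 \<le> x powr (1/4) \<and>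
    (ln x)\<^sup>2 * (ln x * x powr (1/2) * ((ln x)^3 + 1) + 1 + (ln x)\<^sup>2) < x \<and>
    (2 * x * ((ln x)^3 + 1) / x powr (1/4) + ln x) * (1 + (1 + ln x)\<^sup>2) * x powr (1/8) \<le> x / 4"
    using eventually_large[of d] unfolding eventually_at_top_linorder by blast
  have "Phi p chi V \<ge> exp (- C_minus d * exp (pi / delta d * V) * (1 + 0))"
    if "p \<ge> nat \<lceil>X0\<rceil>" and p: "prime p" and chi: "dirichlet_character p chi" and ord: "character_order p chi = d"
      and V1: "1 \<le> V" and V2: "V \<le> delta d / pi * (ln (ln (real p)) - 2 * ln (ln (ln (real p)))) - 7 * sqrt (ln (real d))"
    for p chi V
  proof -
    define x l where "x = real p" and "l = ln x"
    have "x \<ge> X0" using that(1) unfolding x_def by linarith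
    note X = X0[OF this, folded l_def]
    have x1: "d \<le> l" "2 ^ d \<le> l" "ln (real d) \<le> (ln l)\<^sup>2" "1 \<le> ln l" "16 \<le> x" "l \<le> x / 8"
        "l / 8 + 2 \<le> l" "2 \<le> x powr (1/4)" using X by auto
    have large: "l\<^sup>2 * (l * x powr (1/2) * (l^3 + 1) + 1 + l\<^sup>2) < x"
      and small: "(2 * x * (l^3 + 1) / x powr (1/4) + l) * (1 + (1 + l)\<^sup>2) * x powr (1/8) \<le> x / 4"
      using X by auto
    have l0: "l > 0" using x1(1) assms(1) by linarith
    have x0: "x > 0" using x1(5) by simp
    have \<delta>: "0 < delta d" "delta d \<le> 2" using delta_pos[OF assms(1)] delta_le by auto
    have lnd: "ln (real d) \<ge> 1"
    proof -
      have "exp 1 \<le> real d" using exp_le assms(1) by linarith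
      then show ?thesis by (metis exp_gt_zero ln_exp ln_le_cancel_iff order_less_le_trans)
    qed
    then have sq: "sqrt (ln (real d)) \<ge> 1" by simp
    define q where "q = pi / delta d * (V + 7 * sqrt (ln (real d)))"
    define W where "W = exp q"
    define N where "N = nat \<lfloor>W / 16\<rfloor>"
    have W0: "W > 0" by (simp add: W_def)
    have "real N = of_int \<lfloor>W / 16\<rfloor>" using W0 by (simp add: N_def)
    then have N: "real N \<le> W / 16" "W / 16 < real N + 1" by linarith+
    have q_le: "q \<le> ln l - 2 * ln (ln l)"
    proof -
      have "V + 7 * sqrt (ln (real d)) \<le> delta d / pi * (ln l - 2 * ln (ln l))"
        using V2 unfolding l_def x_def by simp
      then have "q \<le> pi / delta d * (delta d / pi * (ln l - 2 * ln (ln l)))"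
        unfolding q_def using \<delta> by (intro mult_left_mono) auto
      then show ?thesis using \<delta> by simp
    qed
    have lnl: "0 < ln l" using x1(4) by linarith
    \<comment> \<open>Here the term \<open>- 2 * ln (ln (ln p))\<close> in the range of
      \<open>V\<close> is spent: it provides the factor \<open>(ln l)\<^sup>2\<close>, which absorbs
      \<open>ln d\<close> for large \<open>p\<close> and yields
      \<open>D \<le> x powr (1/8)\<close>.\<close>
    have W_le: "W * (ln l)\<^sup>2 \<le> l"
    proof -
      have "W \<le> exp (ln l - 2 * ln (ln l))" unfolding W_def using q_le by simp
      also have "\<dots> = l / (ln l)\<^sup>2"
        using l0 lnl by (simp add: exp_diff exp_double)
      finally show ?thesis using lnl by (simp add: pos_le_divide_eq)
    qed
    have ll1: "(ln l)\<^sup>2 \<ge> 1" using x1(4) by simp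
    have "W * 1 \<le> W * (ln l)\<^sup>2" using ll1 W0 by (intro mult_left_mono) auto
    then have Wl: "W \<le> l" using W_le by simp
    define D where "D = real d ^ (2 * N)"
    have D0: "D > 0" using assms(1) by (simp add: D_def)
    have lnD: "ln D = 2 * real N * ln (real d)"
      using assms(1) by (simp add: D_def ln_realpow)
    have D_le: "D \<le> x powr (1/8)"
    proof -
      have "2 * real N * ln (real d) \<le> W / 8 * (ln l)\<^sup>2"
        using N(1) x1(3) lnd W0 by (intro mult_mono) auto
      also have "\<dots> \<le> l / 8" using W_le by simp
      finally have "ln D \<le> l / 8" unfolding lnD .
      then have "exp (ln D) \<le> exp (l / 8)" by simp
      also have "exp (l / 8) = x powr (1/8)" using x0 by (simp add: powr_def l_def)
      finally show ?thesis using D0 by simp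
    qed
    define m where "m = 2 * N + 2"
    have m_le: "real m \<le> l" using N(1) Wl x1(7) by (simp add: m_def)
    have N8: "8 * N \<le> p"
    proof -
      have "real (8 * N) \<le> real p" using N(1) Wl x1(6) x0 unfolding x_def by simp
      then show ?thesis by (simp only: of_nat_le_iff)
    qed
    \<comment> \<open>With \<open>K\<close> near \<open>x powr (1/4)\<close>, the term
      \<open>K\<^sup>2\<close> keeps the size condition below \<open>p\<close>, while the saving of
      order \<open>1 / K\<close> still outweighs \<open>D\<close>.\<close>
    define y where "y = x powr (1/4)"
    define K where "K = nat \<lfloor>y\<rfloor>"
    have y2: "y \<ge> 2" using x1(8) by (simp add: y_def)
    have "real K = of_int \<lfloor>y\<rfloor>" using y2 by (simp add: K_def)
    then have K: "real K \<le> y" "y / 2 \<le> real K" using y2 by linarith+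
    then have K1: "K \<ge> 1" using y2 by (cases K) auto
    have yy: "y\<^sup>2 = x powr (1/2)" unfolding y_def power2_eq_square by (simp flip: powr_add)
    have dm: "real (d\<^sup>2 * m + 1) \<le> l ^ 3 + 1"
    proof -
      have "real d ^ 2 * real m \<le> l ^ 2 * l"
        using x1(1) m_le l0 by (intro mult_mono power_mono) auto
      then show ?thesis by (simp add: power3_eq_cube power2_eq_square)
    qed
    have exact: "exact_order p chi d"
      using character_order_imp_exact_order[OF chi p] ord by simp
    have "real (d * 2 ^ d * (d * K\<^sup>2 * (d\<^sup>2 * m + 1) + 1 + d * m))
        = real d * 2 ^ d * (real d * (real K)\<^sup>2 * real (d\<^sup>2 * m + 1) + 1 + real d * real m)"
      by (simp only: of_nat_mult of_nat_add of_nat_power of_nat_1 of_nat_numeral)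
    also have "\<dots> \<le> l * l * (l * y\<^sup>2 * (l^3 + 1) + 1 + l * l)"
      using x1(1,2) K(1) dm m_le l0 by (intro mult_mono add_mono power_mono) auto
    also have "\<dots> < x" using large unfolding yy power2_eq_square[of l] .
    finally have size: "d * 2 ^ d * (d * K\<^sup>2 * (d\<^sup>2 * m + 1) + 1 + d * m) < p"
      unfolding x_def by (simp only: of_nat_less_iff)
    define E where "E = real p * real (d\<^sup>2 * m + 1) / real K + real m"
    interpret character_sums p chi d m E
    proof
      fix J :: "int set" and b :: "int \<Rightarrow> nat"
      assume J: "finite J" "card J \<le> m" "incongruent p J" "\<And>j. j \<in> J \<Longrightarrow> b j \<in> {1..d}" "\<exists>j\<in>J. b j \<noteq> d"
      show "norm (\<Sum>x\<in>{0..<int p}. \<Prod>j\<in>J. chi (x - j) ^ b j) \<le> E"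
        unfolding E_def
      proof (rule character_sum_bound[OF chi p exact J(1)])
        show "i = j" if "i \<in> J" "j \<in> J" "int p dvd i - j" for i j
          using J(3) that by (auto simp: incongruent_def)
      qed (use J K1 size in auto)
    qed (use chi p exact assms(1) in auto)
    have "odd p" using prime_odd_nat[OF p] x1(5) by (simp add: x_def)
    then obtain h where h: "p = 2 * h + 1" by (auto elim: oddE)
    have "E * (1 + (1 + l)\<^sup>2) \<le> real p / (4 * D)"
    proof -
      have "E \<le> x * (l^3 + 1) / (y / 2) + l"
        unfolding E_def x_def[symmetric] using dm m_le K(2) y2 x0 l0
        by (intro add_mono frac_le mult_left_mono) auto
      also have "\<dots> = 2 * x * (l^3 + 1) / y + l" by simp
      finally have E: "E \<le> 2 * x * (l^3 + 1) / y + l" .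
      have "E * (1 + (1 + l)\<^sup>2) * D \<le> (2 * x * (l^3 + 1) / y + l) * (1 + (1 + l)\<^sup>2) * x powr (1/8)"
        using E D_le D0 x0 l0 y2 by (intro mult_mono) (auto intro!: add_nonneg_nonneg divide_nonneg_nonneg mult_nonneg_nonneg)
      also have "\<dots> \<le> x / 4" using small by (simp add: y_def)
      finally show ?thesis using D0 by (simp add: x_def field_simps)
    qed
    moreover have "V + 17 / 4 \<le> delta d / pi * ln (real N + 1)"
    proof -
      have "ln (real N + 1) \<ge> ln (W / 16)" using N(2) W0 by simp
      also have "ln (W / 16) = q - ln 16" using W0 by (simp add: ln_div W_def)
      finally have "delta d / pi * ln (real N + 1) \<ge> delta d / pi * (q - ln 16)"
        using \<delta> by (intro mult_left_mono) auto
      moreover have "delta d / pi * (q - ln 16) = V + 7 * sqrt (ln (real d)) - delta d / pi * ln 16"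
        using \<delta> by (simp add: q_def right_diff_distrib)
      \<comment> \<open>The cost of the divisor 16 is at most \<open>50 / 27\<close>. Added to
        \<open>17 / 4\<close> it stays below \<open>7 * sqrt (ln d)\<close>, because
        \<open>ln d \<ge> 1\<close>.\<close>
      moreover have "delta d / pi * ln 16 \<le> 2 / 3 * (100 / 36)"
      proof (intro mult_mono)
        have "ln (16::real) = ln (2 ^ 4)" by simp
        also have "\<dots> = 4 * ln 2" by (subst ln_realpow) auto
        finally show "ln (16::real) \<le> 100 / 36" using ln2_le_25_over_36 by simp
        show "delta d / pi \<le> 2 / 3" using \<delta> pi_gt3 by (intro frac_le) auto
      qed auto
      ultimately show ?thesis using sq by linarith
    qed
    ultimately have "Phi p chi V \<ge> 1 / (4 * D)"
      using Phi_ge[OF assms h N8, of V] unfolding D_def m_def l_def x_def by simp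
    moreover have "exp (- C_minus d * exp (pi / delta d * V) * (1 + 0)) \<le> 1 / (4 * D)"
    proof -
      have "C_minus d * exp (pi / delta d * V) = ln (real d) / 2 * (exp (- euler_mascheroni) * W)"
        unfolding C_minus_def W_def q_def mult.assoc exp_add[symmetric]
        by (simp add: algebra_simps add_divide_distrib)
      \<comment> \<open>From \<open>exp (- gamma) \<ge> 1 - gamma\<close> and
        \<open>gamma < 13 / 22\<close>.\<close>
      also have "\<dots> \<ge> ln (real d) / 2 * (9 / 22 * W)"
      proof (intro mult_left_mono mult_right_mono)
        show "9 / 22 \<le> exp (- euler_mascheroni :: real)"
          using exp_ge_add_one_self[of "- euler_mascheroni :: real"] euler_mascheroni_less_13_over_22 by linarith
      qed (use W0 lnd in auto)
      finally have C: "C_minus d * exp (pi / delta d * V) \<ge> ln (real d) * (9 / 44 * W)" by simp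
      \<comment> \<open>The gap \<open>9 / 44 - 1 / 8 = 7 / 88\<close> times \<open>W\<close> has to
        pay for \<open>ln 4\<close>. Since \<open>V \<ge> 1\<close> and \<open>ln d \<ge> 1\<close>,
        the exponent \<open>q\<close> is at least 12, and \<open>exp 6 \<ge> 7\<close> gives
        49.\<close>
      have "W \<ge> 49"
      proof -
        have "pi / delta d \<ge> 3 / 2" using \<delta> pi_gt3 by (intro frac_le) auto
        moreover have "8 \<le> V + 7 * sqrt (ln (real d))" using V1 sq by linarith
        ultimately have "q \<ge> 3 / 2 * 8" unfolding q_def using \<delta> by (intro mult_mono) auto
        then have "W \<ge> exp (6 + 6)" by (simp add: W_def)
        moreover have "exp (6::real) * exp 6 \<ge> 7 * 7"
          using exp_ge_add_one_self[of "6::real"] by (intro mult_mono) auto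
        ultimately show ?thesis by (simp only: exp_add)
      qed
      moreover have "ln (4::real) \<le> 50 / 36"
      proof -
        have "ln (4::real) = ln (2 ^ 2)" by simp
        also have "\<dots> = 2 * ln 2" by (subst ln_realpow) auto
        finally show ?thesis using ln2_le_25_over_36 by simp
      qed
      ultimately have "50 / 36 + W / 8 \<le> 9 / 44 * W" by linarith
      then have "ln (real d) * (50 / 36 + W / 8) \<le> ln (real d) * (9 / 44 * W)"
        using lnd by (intro mult_left_mono) auto
      moreover have "ln (real d) * (50 / 36) \<ge> 1 * (50 / 36)" using lnd by (intro mult_right_mono) auto
      moreover have "2 * real N * ln (real d) \<le> W / 8 * ln (real d)"
        using N(1) lnd by (intro mult_right_mono) auto
      moreover have ln4D: "ln (4 * D) = ln 4 + 2 * real N * ln (real d)"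
        using D0 by (simp add: ln_mult lnD)
      ultimately have "ln (4 * D) \<le> C_minus d * exp (pi / delta d * V)"
        using C \<open>ln 4 \<le> 50 / 36\<close> ln4D unfolding distrib_left mult.commute[of "W / 8"] by linarith
      then have "exp (- (C_minus d * exp (pi / delta d * V))) \<le> exp (- ln (4 * D))" by simp
      also have "\<dots> = 1 / (4 * D)" using D0 by (simp add: exp_minus inverse_eq_divide)
      finally show ?thesis by simp
    qed
    ultimately show ?thesis by linarith
  qed
  then show ?thesis
    by (intro exI[of _ 1] conjI exI[of _ "nat \<lceil>X0\<rceil>"] allI impI exI[of _ 0]) auto
qed

end
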